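(* Fix $r>0$. For $\rho\in\mathbb R$ let $A(x)=A_\rho(x)=\rho x^\perp$ with $x^\perp=(-x_2,x_1,0)$, and $V(x)=|x|^2-\rho^2|x^\perp|^2$, $x\in\mathbb R^3$. For $0<c<c_{A,V}(r)$ let $(u_{c,A,V},\lambda_{c,A,V})$ be a weak solution of $$(i\nabla+A(x))^2u+(V(x)-\lambda)u=|u|^2u\ \text{ in }\mathbb R^3,\qquad \int_{\mathbb R^3}|u|^2=c,$$ with $u_{c,A,V}\in\mathcal M^r_c$. Then there exist $\rho_0>0$ and $c(\rho_0)>0$ such that, if $|\rho|<\rho_0$ and $0<c<c(\rho_0)$, $$3-\lambda_{c,A,V}=O(c),\qquad \Big\|u_{c,A,V}-l_{c,A,V}\,e^{-\frac{|x|^2}2}\Big\|^2_{\Sigma_{A,V}}=o(c)\qquad(\text{as }c\to0^+),$$ where $$l_{c,A,V}=\frac1{\pi^{3/2}}\int_{\mathbb R^3}u_{c,A,V}\,e^{-\frac{|x|^2}2}.$$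
   Context: Functions $u$ are complex valued and $\|\cdot\|_p$ is the $L^p(\mathbb R^3,\mathbb C)$ norm. The magnetic Laplacian is $(i\nabla+A)^2=-\Delta+2iA\cdot\nabla+i\,\mathrm{div}A+|A|^2$. $H^1_A=\{u\in L^2(\mathbb R^3,\mathbb C):\|(i\nabla+A)u\|_2<\infty\}$, $\Sigma_{A,V}=\{u\in H^1_A:\int_{\mathbb R^3}V|u|^2<\infty\}$, $\|u\|^2_{\dot\Sigma_{A,V}}=\int_{\mathbb R^3}|(i\nabla+A)u|^2+V|u|^2$, $\|u\|^2_{\Sigma_{A,V}}=\|u\|^2_{\dot\Sigma_{A,V}}+\|u\|_2^2$. $S_c=\{v\in\Sigma_{A,V}:\|v\|_2^2=c\}$, $B(r)=\{u\in\Sigma_{A,V}:\|u\|^2_{\dot\Sigma_{A,V}}\le r\}$, $$\mathcal E(v)=\tfrac12\|v\|^2_{\dot\Sigma_{A,V}}-\tfrac14\int_{\mathbb R^3}|v|^4,\quad m^r_c=\inf_{S_c\cap B(r)}\mathcal E,\quad \mathcal M^r_c=\{u\in S_c\cap B(r):\mathcal E(u)=m^r_c\}.$$ Weak solution: $u\in S_c$, $\lambda\in\mathbb R$, with $\mathrm{Re}\int\big[(i\nabla+A)u\cdot\overline{(i\nabla+A)v}+(V-\lambda)u\bar v-|u|^2u\bar v\big]=0$ for all $v\in\Sigma_{A,V}$. Constant (for $|\rho|<1$): $$c_{A,V}(r)=\max_{\sigma\in(0,1)}\min\Big\{\frac{\sigma r}{\hat\lambda_{1,A,V}},\frac{4(1-\sigma)^2}{C_{3,4}^8\,r}\Big\},\qquad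 \hat\lambda_{1,A,V}=\min\{\|u\|^2_{\dot\Sigma_{A,V}}:u\in\Sigma_{A,V},\|u\|_2=1\},$$ where $C_{3,4}$ is the Gagliardo–Nirenberg constant in $\|u\|_4\le C_{3,4}\|\nabla u\|_2^{3/4}\|u\|_2^{1/4}$ on $H^1(\mathbb R^3)$, i.e. $C_{3,4}^4=2/\|W_4\|_2^2$ with $W_4$ the (positive) ground state of $-\Delta W+\frac13W=\frac23W^3$ in $\mathbb R^3$. For $0<c<c_{A,V}(r)$ such weak solutions exist. *)

theory Defs
  imports "HOL-Analysis.Analysis" "HOL-Library.Landau_Symbols"
begin

text \<open>Elements of Lebesgue and Sobolev spaces are represented by Borel measurable functions;
  every quantity below depends only on the class of the function modulo null sets.\<close>

definition L2_space :: "(real^3 \<Rightarrow> 'a::real_normed_vector) set" where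
  "L2_space = {u \<in> borel_measurable lborel. integrable lborel (\<lambda>x. (norm (u x))\<^sup>2)}"

definition partial_deriv :: "3 \<Rightarrow> (real^3 \<Rightarrow> complex) \<Rightarrow> real^3 \<Rightarrow> complex" where
  "partial_deriv j f x = frechet_derivative f (at x) (axis j 1)"

primrec C_diff :: "nat \<Rightarrow> (real^3 \<Rightarrow> complex) \<Rightarrow> bool" where
  "C_diff 0 f \<longleftrightarrow> continuous_on UNIV f"
| "C_diff (Suc k) f \<longleftrightarrow> (\<forall>x. f differentiable (at x)) \<and> (\<forall>j. C_diff k (partial_deriv j f))"

definition test_fun :: "(real^3 \<Rightarrow> complex) set" where
  "test_fun = {\<phi>. (\<forall>k. C_diff k \<phi>) \<and> compact (closure {x. \<phi> x \<noteq> 0})}"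

text \<open>The distribution \<open>(\<i>\<nabla> + A) u\<close> is represented by the square integrable field \<open>g\<close>;
  the minus sign comes from moving the derivative to the test function.\<close>

definition is_mag_grad ::
    "(real^3 \<Rightarrow> real^3) \<Rightarrow> (real^3 \<Rightarrow> complex) \<Rightarrow> (real^3 \<Rightarrow> complex^3) \<Rightarrow> bool" where
  "is_mag_grad A u g \<longleftrightarrow> g \<in> L2_space \<and>
     (\<forall>\<phi>\<in>test_fun. \<forall>j.
        (\<integral>x. g x $ j * \<phi> x \<partial>lborel) =
        (\<integral>x. u x * (- \<i> * partial_deriv j \<phi> x + complex_of_real (A x $ j) * \<phi> x) \<partial>lborel))"

text \<open>For \<open>A = 0\<close> this is the usual \<open>H\<^sup>1\<close>.\<close>

definition H1_mag :: "(real^3 \<Rightarrow> real^3) \<Rightarrow> (real^3 \<Rightarrow> complex) set" where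
  "H1_mag A = {u \<in> L2_space. \<exists>g. is_mag_grad A u g}"

text \<open>Unique up to a null set for \<open>u\<close> in \<open>H1_mag A\<close>; for \<open>A = 0\<close> it is \<open>\<i>\<nabla>u\<close>.\<close>

definition mag_grad ::
    "(real^3 \<Rightarrow> real^3) \<Rightarrow> (real^3 \<Rightarrow> complex) \<Rightarrow> real^3 \<Rightarrow> complex^3" where
  "mag_grad A u = (SOME g. is_mag_grad A u g)"

definition Sigma_space ::
    "(real^3 \<Rightarrow> real^3) \<Rightarrow> (real^3 \<Rightarrow> real) \<Rightarrow> (real^3 \<Rightarrow> complex) set" where
  "Sigma_space A V = {u \<in> H1_mag A. integrable lborel (\<lambda>x. V x * (norm (u x))\<^sup>2)}"

definition mass :: "(real^3 \<Rightarrow> complex) \<Rightarrow> real" where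
  "mass u = (\<integral>x. (norm (u x))\<^sup>2 \<partial>lborel)"

definition Sigma_dot_norm_sq ::
    "(real^3 \<Rightarrow> real^3) \<Rightarrow> (real^3 \<Rightarrow> real) \<Rightarrow> (real^3 \<Rightarrow> complex) \<Rightarrow> real" where
  "Sigma_dot_norm_sq A V u =
     (\<integral>x. (norm (mag_grad A u x))\<^sup>2 + V x * (norm (u x))\<^sup>2 \<partial>lborel)"

definition Sigma_norm_sq ::
    "(real^3 \<Rightarrow> real^3) \<Rightarrow> (real^3 \<Rightarrow> real) \<Rightarrow> (real^3 \<Rightarrow> complex) \<Rightarrow> real" where
  "Sigma_norm_sq A V u = Sigma_dot_norm_sq A V u + mass u"

definition mass_sphere ::
    "(real^3 \<Rightarrow> real^3) \<Rightarrow> (real^3 \<Rightarrow> real) \<Rightarrow> real \<Rightarrow> (real^3 \<Rightarrow> complex) set" where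
  "mass_sphere A V c = {v \<in> Sigma_space A V. mass v = c}"

definition Sigma_ball ::
    "(real^3 \<Rightarrow> real^3) \<Rightarrow> (real^3 \<Rightarrow> real) \<Rightarrow> real \<Rightarrow> (real^3 \<Rightarrow> complex) set" where
  "Sigma_ball A V r = {u \<in> Sigma_space A V. Sigma_dot_norm_sq A V u \<le> r}"

definition energy ::
    "(real^3 \<Rightarrow> real^3) \<Rightarrow> (real^3 \<Rightarrow> real) \<Rightarrow> (real^3 \<Rightarrow> complex) \<Rightarrow> real" where
  "energy A V v = 1/2 * Sigma_dot_norm_sq A V v - 1/4 * (\<integral>x. (norm (v x))^4 \<partial>lborel)"

definition local_min_level ::
    "(real^3 \<Rightarrow> real^3) \<Rightarrow> (real^3 \<Rightarrow> real) \<Rightarrow> real \<Rightarrow> real \<Rightarrow> real" where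
  "local_min_level A V r c = (INF v \<in> mass_sphere A V c \<inter> Sigma_ball A V r. energy A V v)"

definition local_minimizers ::
    "(real^3 \<Rightarrow> real^3) \<Rightarrow> (real^3 \<Rightarrow> real) \<Rightarrow> real \<Rightarrow> real \<Rightarrow> (real^3 \<Rightarrow> complex) set" where
  "local_minimizers A V r c =
     {u \<in> mass_sphere A V c \<inter> Sigma_ball A V r. energy A V u = local_min_level A V r c}"

definition weak_solution ::
    "(real^3 \<Rightarrow> real^3) \<Rightarrow> (real^3 \<Rightarrow> real) \<Rightarrow> real \<Rightarrow> (real^3 \<Rightarrow> complex) \<Rightarrow> real \<Rightarrow> bool" where
  "weak_solution A V c u lam \<longleftrightarrow> u \<in> mass_sphere A V c \<and>
     (\<forall>v\<in>Sigma_space A V.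
        Re (\<integral>x. (\<Sum>j\<in>UNIV. mag_grad A u x $ j * cnj (mag_grad A v x $ j))
               + complex_of_real (V x - lam) * u x * cnj (v x)
               - complex_of_real ((norm (u x))\<^sup>2) * u x * cnj (v x) \<partial>lborel) = 0)"

text \<open>The inequality \<open>\<parallel>u\<parallel>\<^sub>4 \<le> C \<parallel>\<nabla>u\<parallel>\<^sub>2\<^sup>3\<^sup>/\<^sup>4 \<parallel>u\<parallel>\<^sub>2\<^sup>1\<^sup>/\<^sup>4\<close> on \<open>H\<^sup>1\<close>.
  Integrability of the fourth power is part of it, because a divergent integral has the
  value \<open>0\<close>.\<close>

definition GN_inequality :: "real \<Rightarrow> bool" where
  "GN_inequality C \<longleftrightarrow> (\<forall>u\<in>H1_mag (\<lambda>x. 0).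
     integrable lborel (\<lambda>x. (norm (u x))^4) \<and>
     (\<integral>x. (norm (u x))^4 \<partial>lborel) powr (1/4)
       \<le> C * sqrt (\<integral>x. (norm (mag_grad (\<lambda>x. 0) u x))\<^sup>2 \<partial>lborel) powr (3/4)
           * sqrt (mass u) powr (1/4))"

text \<open>The best constant.\<close>

definition GN_const :: real where
  "GN_const = Inf {C. 0 \<le> C \<and> GN_inequality C}"

definition lambda1_hat :: "(real^3 \<Rightarrow> real^3) \<Rightarrow> (real^3 \<Rightarrow> real) \<Rightarrow> real" where
  "lambda1_hat A V =
     Inf {Sigma_dot_norm_sq A V u |u. u \<in> Sigma_space A V \<and> sqrt (mass u) = 1}"

definition c_thr :: "(real^3 \<Rightarrow> real^3) \<Rightarrow> (real^3 \<Rightarrow> real) \<Rightarrow> real \<Rightarrow> real" where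
  "c_thr A V r = (SUP \<sigma>\<in>{0<..<1}.
     min (\<sigma> * r / lambda1_hat A V) (4 * (1 - \<sigma>)\<^sup>2 / (GN_const ^ 8 * r)))"

definition xperp :: "real^3 \<Rightarrow> real^3" where
  "xperp x = vector [- (x $ 2), x $ 1, 0]"

definition A_rot :: "real \<Rightarrow> real^3 \<Rightarrow> real^3" where
  "A_rot \<rho> x = \<rho> *\<^sub>R xperp x"

definition V_rot :: "real \<Rightarrow> real^3 \<Rightarrow> real" where
  "V_rot \<rho> x = (norm x)\<^sup>2 - \<rho>\<^sup>2 * (norm (xperp x))\<^sup>2"

definition gauss :: "real^3 \<Rightarrow> complex" where
  "gauss x = complex_of_real (exp (- (norm x)\<^sup>2 / 2))"

definition gauss_coeff :: "(real^3 \<Rightarrow> complex) \<Rightarrow> complex" where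
  "gauss_coeff u = complex_of_real (1 / pi powr (3/2)) * (\<integral>x. u x * gauss x \<partial>lborel)"

end

theory Submission
  imports Defs "HOL-Probability.Probability"
begin

text \<open>Since \<open>div A = 0\<close> and \<open>V + |A|\<^sup>2 = |x|\<^sup>2\<close>, the quadratic form is that of the harmonic oscillator plus
  \<open>2 \<rho>\<close> times an angular momentum term. Write \<open>u = l e + w\<close> with \<open>w\<close> orthogonal to the Gaussian \<open>e\<close>. The
  oscillator form exceeds \<open>3 \<parallel>u\<parallel>\<^sup>2\<close> by \<open>\<Sum>\<^sub>j \<parallel>(\<partial>\<^sub>j + x\<^sub>j) u\<parallel>\<^sup>2\<close>, which depends on \<open>w\<close> only and bounds \<open>\<parallel>w\<parallel>\<^sup>2\<close> by
  the Gaussian Poincare inequality; the angular momentum term also depends on \<open>w\<close> only, so for small \<open>\<rho>\<close>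
  it is absorbed. Comparing the minimizer with the multiple of the Gaussian of the same mass gives
  \<open>\<parallel>u\<parallel>\<^sup>2 \<le> 3 c + O(\<parallel>u\<parallel>\<^sub>4\<^sup>4)\<close> for the homogeneous norm, and a Gagliardo--Nirenberg inequality turns the
  error into \<open>O(c\<^sup>2)\<close>. Hence \<open>w\<close> is \<open>O(c\<^sup>2)\<close> in the squared norm, and testing the equation with \<open>u\<close> yields
  the estimate of \<open>\<lambda>\<close>. Weak derivatives are reduced to classical ones by mollification.\<close>

section \<open>Test functions\<close>

text \<open>Only the powers of \<open>c\<close> matter, so every constant is explicit but crude. The
  remainder is controlled through the substitution \<open>u = f * gauss\<close>: since
  \<open>(d_j + x_j) u = gauss * d_j f\<close>, the excess is a Dirichlet integral for the measure
  \<open>exp (- |x|^2) dx\<close>, and the Poincare inequality comes from the rotation argument of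
  Maurey and Pisier, which gives an explicit constant without Hermite functions. The quartic term
  obeys a bound \<open>C * sqrt c * Q^(3/2)\<close>, where \<open>Q\<close> is the homogeneous norm
  squared; making it \<open>O(c^2)\<close> requires \<open>Q = O(c)\<close>, and this costs a first
  round: inside the ball a small \<open>c\<close> makes the quartic term at most \<open>Q\<close>,
  so the comparison gives \<open>Q \<le> 3 c + Q / 2\<close>. The obstacle is regularity:
  \<open>mag_grad\<close> is a Hilbert choice and gradients are distributions, while all identities
  come from integrating derivatives of \<open>C^1\<close> products. For small \<open>\<rho>\<close>
  a function of the energy space has a weak gradient and finite second moments separately, and both
  survive mollification, the weight up to a commutator of order \<open>1 / n\<close>.\<close>

primrec smooth1 :: "nat \<Rightarrow> (real \<Rightarrow> real) \<Rightarrow> bool" where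
  "smooth1 0 f \<longleftrightarrow> continuous_on UNIV f"
| "smooth1 (Suc k) f \<longleftrightarrow> (\<exists>f'. (\<forall>x. (f has_real_derivative f' x) (at x)) \<and> smooth1 k f')"

lemma smooth1_Suc_D: "smooth1 (Suc k) f \<Longrightarrow> smooth1 k f"
proof (induction k arbitrary: f)
  case 0
  then obtain f' where "\<And>x. (f has_real_derivative f' x) (at x)" by auto
  then show ?case
    by (metis DERIV_isCont continuous_at_imp_continuous_on smooth1.simps(1))
next
  case (Suc k)
  then show ?case by (metis smooth1.simps(2))
qed

lemma smooth1_add: "smooth1 k f \<Longrightarrow> smooth1 k g \<Longrightarrow> smooth1 k (\<lambda>x. f x + g x)"
proof (induction k arbitrary: f g)
  case 0
  then show ?case by (auto intro: continuous_intros)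
next
  case (Suc k)
  then obtain f' g' where "\<And>x. (f has_real_derivative f' x) (at x)" "smooth1 k f'"
    "\<And>x. (g has_real_derivative g' x) (at x)" "smooth1 k g'" by auto
  then show ?case using Suc.IH[of f' g']
    by (auto intro!: exI[of _ "\<lambda>x. f' x + g' x"] derivative_eq_intros)
qed

lemma smooth1_mult: "smooth1 k f \<Longrightarrow> smooth1 k g \<Longrightarrow> smooth1 k (\<lambda>x. f x * g x)"
proof (induction k arbitrary: f g)
  case 0
  then show ?case by (auto intro: continuous_intros)
next
  case (Suc k)
  then obtain f' g' where *: "\<And>x. (f has_real_derivative f' x) (at x)" "smooth1 k f'"
    "\<And>x. (g has_real_derivative g' x) (at x)" "smooth1 k g'" by auto
  have "smooth1 k f" "smooth1 k g" using Suc.prems smooth1_Suc_D by auto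
  then have "smooth1 k (\<lambda>x. f' x * g x + f x * g' x)"
    using * Suc.IH by (intro smooth1_add) auto
  then show ?case using *
    by (auto intro!: exI[of _ "\<lambda>x. f' x * g x + f x * g' x"] derivative_eq_intros)
qed

lemma smooth1_const: "smooth1 k (\<lambda>x. c)"
proof (induction k arbitrary: c)
  case (Suc k)
  then show ?case by (auto intro!: exI[of _ "\<lambda>x. 0"])
qed auto

lemma smooth1_affine: "smooth1 k f \<Longrightarrow> smooth1 k (\<lambda>t. f (a * t + b))"
proof (induction k arbitrary: f)
  case 0
  then show ?case by (auto intro!: continuous_on_compose2[of UNIV f] continuous_intros)
next
  case (Suc k)
  then obtain f' where *: "\<And>x. (f has_real_derivative f' x) (at x)" "smooth1 k f'"
    by auto
  have "smooth1 k (\<lambda>t. f' (a * t + b) * a)"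
    using Suc.IH[OF *(2)] by (intro smooth1_mult smooth1_const)
  moreover have "((\<lambda>t. f (a * t + b)) has_real_derivative f' (a * x + b) * a) (at x)" for x
    by (rule DERIV_chain2[OF *(1)]) (auto intro!: derivative_eq_intros)
  ultimately show ?case unfolding smooth1.simps by (intro exI[of _ "\<lambda>x. f' (a * x + b) * a"]) simp
qed

text \<open>The flat function \<open>exp (- 1 / t)\<close> with powers of \<open>1 / t\<close> in
  front: one differentiation stays within linear combinations of the family, which is what an
  induction on the order of smoothness needs.\<close>

definition exp_flat :: "nat \<Rightarrow> real \<Rightarrow> real" where
  "exp_flat n t = (if 0 < t then (1 / t) ^ n * exp (- (1 / t)) else 0)"

lemma exp_flat_deriv:
  "(exp_flat n has_real_derivative exp_flat (n + 2) t + (- real n) * exp_flat (n + 1) t) (at t)"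
proof (cases t "0 :: real" rule: linorder_cases)
  case less
  have "((\<lambda>_. 0) has_real_derivative 0) (at t)" by simp
  then have "(exp_flat n has_real_derivative 0) (at t)"
    by (rule has_field_derivative_transform_within_open[of _ _ _ "{..<0}"])
      (use less in \<open>auto simp: exp_flat_def\<close>)
  with less show ?thesis by (simp add: exp_flat_def)
next
  case greater
  have "((\<lambda>t. (1 / t) ^ n * exp (- (1 / t))) has_real_derivative
      exp_flat (n + 2) t + (- real n) * exp_flat (n + 1) t) (at t)"
  proof (cases n)
    case 0
    then show ?thesis using greater
      by (auto intro!: derivative_eq_intros simp: exp_flat_def field_simps power2_eq_square)
  next
    case (Suc m)
    have "((\<lambda>t. 1 / t) has_real_derivative - (1 / t\<^sup>2)) (at t)"
      using greater by (auto intro!: derivative_eq_intros simp: field_simps power2_eq_square)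
    note D = DERIV_mult[OF DERIV_power[OF this, of n] DERIV_chain2[OF DERIV_exp DERIV_minus[OF this]]]
    show ?thesis
      by (rule DERIV_cong[OF D])
        (use greater in \<open>simp add: Suc exp_flat_def field_simps power2_eq_square\<close>)
  qed
  then show ?thesis
    by (rule has_field_derivative_transform_within_open[of _ _ _ "{0<..}"])
      (use greater in \<open>auto simp: exp_flat_def\<close>)
next
  case equal
  have "((\<lambda>h. exp_flat n h / h) \<longlongrightarrow> 0) (at_left 0)"
    by (rule tendsto_eventually) (auto simp: exp_flat_def eventually_at_filter)
  \<comment> \<open>From the right the difference quotient is \<open>s ^ (n + 1) * exp (- s)\<close>
    with \<open>s = 1 / h\<close>, and \<open>s\<close> tends to infinity.\<close>
  moreover have "((\<lambda>h. exp_flat n h / h) \<longlongrightarrow> 0) (at_right 0)"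
  proof -
    have "((\<lambda>h::real. (inverse h) ^ (Suc n) / exp (inverse h)) \<longlongrightarrow> 0) (at_right 0)"
      by (rule filterlim_compose[OF tendsto_power_div_exp_0 filterlim_inverse_at_top_right])
    moreover have "\<forall>\<^sub>F h in at_right 0. (inverse h) ^ (Suc n) / exp (inverse h) = exp_flat n h / h"
      by (auto simp: exp_flat_def eventually_at_filter exp_minus field_simps)
    ultimately show ?thesis by (rule Lim_transform_eventually)
  qed
  ultimately have "((\<lambda>h. exp_flat n h / h) \<longlongrightarrow> 0) (at 0)"
    by (simp add: filterlim_split_at)
  then show ?thesis using equal by (simp add: has_field_derivative_iff exp_flat_def)
qed

lemma smooth1_exp_flat: "smooth1 k (exp_flat n)"
proof (induction k arbitrary: n)
  case 0
  show ?case
    using exp_flat_deriv by (auto intro!: continuous_at_imp_continuous_on DERIV_isCont)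
next
  case (Suc k)
  have "smooth1 k (\<lambda>t. exp_flat (n + 2) t + (- real n) * exp_flat (n + 1) t)"
    by (intro smooth1_add smooth1_mult smooth1_const Suc)
  then show ?case unfolding smooth1.simps using exp_flat_deriv
    by (intro exI[of _ "\<lambda>t. exp_flat (n + 2) t + (- real n) * exp_flat (n + 1) t"]) blast
qed

text \<open>Two one-sided flat functions facing each other give a smooth bump supported in
  \<open>[-1, 1]\<close>. The coefficients \<open>1\<close> and \<open>-1\<close> are written out to
  match the affine shape \<open>a * t + b\<close> of \<open>smooth1_affine\<close>.\<close>

definition bump :: "real \<Rightarrow> real" where
  "bump t = exp_flat 0 (1 * t + 1) * exp_flat 0 ((-1) * t + 1)"

lemma smooth1_bump: "smooth1 k bump"
  unfolding bump_def[abs_def] by (intro smooth1_mult smooth1_affine smooth1_exp_flat)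

lemma bump_nonneg: "0 \<le> bump t"
  and bump_pos: "\<bar>t\<bar> < 1 \<Longrightarrow> 0 < bump t"
  and bump_eq_0: "1 \<le> \<bar>t\<bar> \<Longrightarrow> bump t = 0"
  by (auto simp: bump_def exp_flat_def)

lemma smooth1_bump_affine: "smooth1 k (\<lambda>t. bump (a * t + b))"
  using smooth1_affine[where f = bump] smooth1_bump by blast

section \<open>Smooth product functions on space\<close>

definition tensor ::
    "(real \<Rightarrow> real) \<Rightarrow> (real \<Rightarrow> real) \<Rightarrow> (real \<Rightarrow> real) \<Rightarrow> real^3 \<Rightarrow> real" where
  "tensor a b c y = a (y $ 1) * b (y $ 2) * c (y $ 3)"

lemma has_derivative_tensor:
  assumes "\<And>t. (a has_real_derivative a' t) (at t)" "\<And>t. (b has_real_derivative b' t) (at t)"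
    "\<And>t. (c has_real_derivative c' t) (at t)"
  shows "(tensor a b c has_derivative
    (\<lambda>h. tensor a' b c y * h $ 1 + tensor a b' c y * h $ 2 + tensor a b c' y * h $ 3)) (at y)"
proof -
  have *: "((\<lambda>y::real^3. f (y $ j)) has_derivative (\<lambda>h. h $ j * f' (y $ j))) (at y)"
    if "\<And>t. (f has_real_derivative f' t) (at t)" for f f' j
    by (rule DERIV_compose_FDERIV[OF that])
      (rule bounded_linear_imp_has_derivative[OF bounded_linear_vec_nth])
  show ?thesis
    unfolding tensor_def[abs_def]
    by (rule has_derivative_eq_rhs, (rule has_derivative_mult * assms)+)
      (auto simp: algebra_simps)
qed

lemma partial_derivI: "(f has_derivative D) (at x) \<Longrightarrow> partial_deriv j f x = D (axis j 1)"
  by (simp add: partial_deriv_def frechet_derivative_at[symmetric])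

text \<open>A partial derivative of a product of one-variable functions differentiates one factor,
  so the class of such products is closed under partial derivatives and induction on
  \<open>k\<close> applies. This is why test functions are built as products.\<close>

lemma C_diff_tensor:
  assumes "smooth1 k a" "smooth1 k b" "smooth1 k c"
  shows "C_diff k (\<lambda>y. complex_of_real (tensor a b c y))"
  using assms
proof (induction k arbitrary: a b c)
  case 0
  note c = 0[unfolded smooth1.simps, THEN continuous_on_compose2, OF _ subset_UNIV]
  show ?case
    unfolding tensor_def of_real_mult C_diff.simps
    by (intro continuous_on_mult continuous_on_of_real c continuous_on_component continuous_on_id)
next
  case (Suc k)
  obtain a' where a': "\<And>x. (a has_real_derivative a' x) (at x)" "smooth1 k a'"
    using Suc.prems(1) unfolding smooth1.simps by blast
  obtain b' where b': "\<And>x. (b has_real_derivative b' x) (at x)" "smooth1 k b'"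
    using Suc.prems(2) unfolding smooth1.simps by blast
  obtain c' where c': "\<And>x. (c has_real_derivative c' x) (at x)" "smooth1 k c'"
    using Suc.prems(3) unfolding smooth1.simps by blast
  note * = a'(1) b'(1) c'(1) a'(2) b'(2) c'(2)
  note s = Suc.prems[THEN smooth1_Suc_D]
  have D: "((\<lambda>y. complex_of_real (tensor a b c y)) has_derivative
    (\<lambda>h. complex_of_real (tensor a' b c y * h $ 1 + tensor a b' c y * h $ 2 + tensor a b c' y * h $ 3)))
      (at y)" for y
    by (rule has_derivative_of_real[OF has_derivative_tensor[OF *(1-3)]])
  have P: "partial_deriv 1 (\<lambda>y. complex_of_real (tensor a b c y)) = (\<lambda>y. complex_of_real (tensor a' b c y))"
    "partial_deriv 2 (\<lambda>y. complex_of_real (tensor a b c y)) = (\<lambda>y. complex_of_real (tensor a b' c y))"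
    "partial_deriv 3 (\<lambda>y. complex_of_real (tensor a b c y)) = (\<lambda>y. complex_of_real (tensor a b c' y))"
    by (rule ext, subst partial_derivI[OF D], simp add: axis_def)+
  have "C_diff k (partial_deriv j (\<lambda>y. complex_of_real (tensor a b c y)))" for j
    using exhaust_3[of j] Suc.IH[OF *(4) s(2,3)] Suc.IH[OF s(1) *(5) s(3)] Suc.IH[OF s(1,2) *(6)]
    by (elim disjE) (simp_all only: P)
  with D show ?case unfolding C_diff.simps differentiable_def by (intro conjI allI) iprover+
qed

section \<open>The mollifying kernel\<close>

definition bump3 :: "nat \<Rightarrow> real^3 \<Rightarrow> real" where
  "bump3 n = tensor (\<lambda>t. bump (real (Suc n) * t + 0)) (\<lambda>t. bump (real (Suc n) * t + 0))
     (\<lambda>t. bump (real (Suc n) * t + 0))"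

definition kern :: "nat \<Rightarrow> real^3 \<Rightarrow> real" where
  "kern n z = bump3 n z / (\<integral>x. bump3 n x \<partial>lborel)"

lemma bump3_nonneg: "0 \<le> bump3 n z"
  by (simp add: bump3_def tensor_def bump_nonneg)

text \<open>The support is a cube of half side \<open>1 / Suc n\<close>, whose half diagonal is
  \<open>sqrt 3 / Suc n\<close>; the radius \<open>2 / Suc n\<close> is a convenient upper
  bound.\<close>

lemma bump3_eq_0: assumes "2 / real (Suc n) \<le> norm z" shows "bump3 n z = 0"
proof (rule ccontr)
  assume "bump3 n z \<noteq> 0"
  then have "\<bar>real (Suc n) * z $ j\<bar> < 1" for j
    using bump_eq_0[of "real (Suc n) * z $ j"] exhaust_3[of j]
    by (auto simp: bump3_def tensor_def not_less[symmetric] simp del: of_nat_Suc)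
  then have j: "(real (Suc n) * z $ j)\<^sup>2 < 1" for j
    by (metis abs_square_less_1)
  have "(real (Suc n) * norm z)\<^sup>2 = (\<Sum>j\<in>UNIV. (real (Suc n) * z $ j)\<^sup>2)"
    by (simp add: power_mult_distrib norm_vec_def L2_set_def sum_nonneg sum_distrib_left)
  also have "\<dots> < 3" using j[of 1] j[of 2] j[of 3] by (simp add: sum_3)
  finally have "(real (Suc n) * norm z)\<^sup>2 < 2\<^sup>2" by simp
  then have "real (Suc n) * norm z < 2" by (rule power2_less_imp_less) simp
  with assms show False by (simp add: field_simps)
qed

lemma continuous_bump: "continuous_on UNIV bump"
  using smooth1_bump[of 0] by simp

lemma continuous_bump3: "continuous_on S (bump3 n)"
  unfolding bump3_def tensor_def
  by (intro continuous_intros continuous_on_compose2[OF continuous_bump]) auto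

lemma integrable_cpt_supp:
  fixes f :: "'a::euclidean_space \<Rightarrow> 'b::{banach, second_countable_topology}"
  assumes "continuous_on UNIV f" "\<And>z. R \<le> norm z \<Longrightarrow> f z = 0"
  shows "integrable lborel f"
proof -
  have "integrable lborel (\<lambda>x. indicator (cball 0 R) x *\<^sub>R f x)"
    by (rule borel_integrable_compact) (auto intro: continuous_on_subset[OF assms(1)])
  also have "(\<lambda>x. indicator (cball 0 R) x *\<^sub>R f x) = f"
    using assms(2) by (force simp: indicator_def)
  finally show ?thesis .
qed

lemma integrable_bump3: "integrable lborel (bump3 n)"
  by (rule integrable_cpt_supp[OF continuous_bump3 bump3_eq_0])

text \<open>The nonvanishing set is open and contains the origin, so it cannot be a null set; this
  justifies the normalization in \<open>kern\<close>.\<close>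

lemma integral_bump3_pos: "0 < (\<integral>x. bump3 n x \<partial>lborel)"
proof -
  have "(\<integral>x. bump3 n x \<partial>lborel) \<noteq> 0"
  proof
    assume "(\<integral>x. bump3 n x \<partial>lborel) = 0"
    then have "AE x in lborel. bump3 n x = 0"
      using integral_nonneg_eq_0_iff_AE[OF integrable_bump3[of n]] bump3_nonneg by auto
    moreover have [measurable]: "bump3 n \<in> borel_measurable borel"
      by (intro borel_measurable_continuous_onI continuous_bump3)
    ultimately have "{x. bump3 n x \<noteq> 0} \<in> null_sets lborel"
      by (subst AE_iff_null_sets) auto
    then have "negligible {x. bump3 n x \<noteq> 0}"
      by (simp add: negligible_iff_null_sets null_sets_completionI)
    moreover have "open {x. bump3 n x \<noteq> 0}"
      by (rule open_Collect_neq) (auto intro: continuous_bump3)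
    moreover have "bump3 n 0 \<noteq> 0" by (simp add: bump3_def tensor_def bump_pos less_imp_neq[symmetric])
    ultimately show False using open_not_negligible by blast
  qed
  moreover have "0 \<le> (\<integral>x. bump3 n x \<partial>lborel)"
    by (simp add: bump3_nonneg)
  ultimately show ?thesis by simp
qed

lemma kern_nonneg: "0 \<le> kern n z"
  unfolding kern_def using bump3_nonneg less_imp_le[OF integral_bump3_pos] by (rule divide_nonneg_nonneg)

lemma kern_eq_0: "2 / real (Suc n) \<le> norm z \<Longrightarrow> kern n z = 0"
  by (simp add: kern_def bump3_eq_0)

lemma continuous_kern: "continuous_on S (kern n)"
  unfolding kern_def using less_imp_neq[OF integral_bump3_pos[of n], symmetric]
  by (intro continuous_on_divide continuous_bump3 continuous_on_const) blast

lemma integrable_kern: "integrable lborel (kern n)"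
  by (rule integrable_cpt_supp[OF continuous_kern kern_eq_0])

lemma integral_kern: "(\<integral>x. kern n x \<partial>lborel) = 1"
  using less_imp_neq[OF integral_bump3_pos[of n]] unfolding kern_def integral_divide_zero
  by (metis divide_self)

definition kern_deriv :: "nat \<Rightarrow> 3 \<Rightarrow> real^3 \<Rightarrow> real" where
  "kern_deriv n j z = frechet_derivative (kern n) (at z) (axis j 1)"

lemma kern_C1:
  shows has_derivative_kern: "(kern n has_derivative (\<lambda>h. \<Sum>j\<in>UNIV. h $ j * kern_deriv n j z)) (at z)"
    and continuous_kern_deriv: "continuous_on UNIV (kern_deriv n j)"
proof -
  let ?b = "\<lambda>t. bump (real (Suc n) * t + 0)"
  let ?Z = "\<integral>x. bump3 n x \<partial>lborel"
  have "smooth1 1 ?b" by (rule smooth1_bump_affine)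
  then obtain b' where b': "\<And>t. (?b has_real_derivative b' t) (at t)" "continuous_on UNIV b'"
    by auto
  define D :: "real^3 \<Rightarrow> real^3 \<Rightarrow> real" where "D z h = (tensor b' ?b ?b z * h $ 1 + tensor ?b b' ?b z * h $ 2
    + tensor ?b ?b b' z * h $ 3) / ?Z" for z h
  have D: "(kern n has_derivative D z) (at z)" for z
    unfolding kern_def D_def[abs_def] bump3_def divide_inverse
    by (rule has_derivative_mult_left, rule has_derivative_tensor) (rule b')+
  have kd: "kern_deriv n j z = D z (axis j 1)" for j z
    by (simp add: kern_deriv_def frechet_derivative_at[OF D, symmetric])
  have "D z h = (\<Sum>j\<in>UNIV. h $ j * kern_deriv n j z)" for h z
    by (simp add: kd sum_3) (simp add: D_def axis_def field_simps add_divide_distrib)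
  then show "(kern n has_derivative (\<lambda>h. \<Sum>j\<in>UNIV. h $ j * kern_deriv n j z)) (at z)"
    using D[of z] by presburger
  have cb: "continuous_on UNIV ?b" by (rule smooth1_bump_affine[of 0, simplified smooth1.simps])
  then have "continuous_on UNIV (\<lambda>z. D z (axis j 1))"
    unfolding D_def tensor_def divide_inverse
    by (intro continuous_on_mult continuous_on_add continuous_on_const
        continuous_on_compose2[OF cb _ subset_UNIV] continuous_on_compose2[OF b'(2) _ subset_UNIV]
        continuous_on_component continuous_on_id)
  then show "continuous_on UNIV (kern_deriv n j)" unfolding kd .
qed

text \<open>The inequality is strict, unlike the one for \<open>kern\<close> itself, because the
  argument uses that the kernel is zero on a whole neighbourhood of \<open>z\<close>. Later supports
  of \<open>kern_deriv\<close> are therefore given a radius larger by 1.\<close>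

lemma kern_deriv_eq_0:
  assumes "2 / real (Suc n) < norm z" shows "kern_deriv n j z = 0"
proof -
  have "((\<lambda>_. 0) has_derivative (\<lambda>_. 0)) (at z)" by simp
  then have "(kern n has_derivative (\<lambda>_. 0)) (at z)"
    by (rule has_derivative_transform_within_open[of _ _ _ _ "{z. 2 / real (Suc n) < norm z}"])
      (use assms in \<open>auto intro!: open_Collect_less continuous_intros simp: kern_eq_0 simp del: of_nat_Suc\<close>)
  then show ?thesis by (simp add: kern_deriv_def frechet_derivative_at[symmetric])
qed

text \<open>With this, \<open>moll n f x\<close> is the pairing of \<open>f\<close> with an
  admissible test function, so weak identities can be read off pointwise for mollified
  functions.\<close>

lemma kern_test_fun: "(\<lambda>y. complex_of_real (kern n (x - y))) \<in> test_fun"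
proof -
  let ?N = "real (Suc n)"
  let ?Z = "\<integral>x. bump3 n x \<partial>lborel"
  let ?b = "\<lambda>j t. bump ((- ?N) * t + ?N * x $ j)"
  \<comment> \<open>The normalizing constant goes into the first factor of the product, and the
    reflection \<open>x - y\<close> into the affine coefficients.\<close>
  have "C_diff k (\<lambda>y. complex_of_real (tensor (\<lambda>t. inverse ?Z * ?b 1 t) (?b 2) (?b 3) y))" for k
    by (intro C_diff_tensor smooth1_mult smooth1_const smooth1_bump_affine)
  moreover have "tensor (\<lambda>t. inverse ?Z * ?b 1 t) (?b 2) (?b 3) y = kern n (x - y)" for y
    by (simp add: kern_def tensor_def bump3_def field_simps)
  ultimately have "C_diff k (\<lambda>y. complex_of_real (kern n (x - y)))" for k by simp
  moreover have "compact (closure {y. complex_of_real (kern n (x - y)) \<noteq> 0})"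
  proof -
    have "{y. complex_of_real (kern n (x - y)) \<noteq> 0} \<subseteq> cball x (2 / ?N)"
      using kern_eq_0[of n "x - y" for y] by (force simp: dist_norm)
    then show ?thesis
      by (meson bounded_cball bounded_closure bounded_subset closed_closure compact_eq_bounded_closed)
  qed
  ultimately show ?thesis by (simp add: test_fun_def)
qed

section \<open>Square integrable functions\<close>

lemma L2_D: "f \<in> L2_space \<Longrightarrow> f \<in> borel_measurable lborel"
  "f \<in> L2_space \<Longrightarrow> integrable lborel (\<lambda>x. (norm (f x))\<^sup>2)"
  by (auto simp: L2_space_def)

lemma L2_measurable [measurable_dest]: "f \<in> L2_space \<Longrightarrow> f \<in> borel_measurable borel"
  using L2_D(1) by (simp add: measurable_lborel2)

lemma L2_nn:
  fixes f :: "real^3 \<Rightarrow> complex"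
  shows "f \<in> L2_space \<longleftrightarrow> f \<in> borel_measurable borel \<and> (\<integral>\<^sup>+x. ennreal ((norm (f x))\<^sup>2) \<partial>lborel) < \<infinity>"
  by (auto simp: L2_space_def integrable_iff_bounded)

lemma mass_nn: "f \<in> L2_space \<Longrightarrow> ennreal (mass f) = (\<integral>\<^sup>+x. ennreal ((norm (f x))\<^sup>2) \<partial>lborel)"
  by (subst nn_integral_eq_integral) (auto simp: L2_D mass_def)

lemma mass_nonneg: "0 \<le> mass f"
  by (simp add: mass_def)

lemma L2_bound:
  fixes f :: "real^3 \<Rightarrow> complex"
  assumes "f \<in> borel_measurable borel" "integrable lborel g" "\<And>x. (norm (f x))\<^sup>2 \<le> g x"
  shows "f \<in> L2_space" "mass f \<le> (\<integral>x. g x \<partial>lborel)"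
proof -
  note [measurable] = assms(1)
  have "integrable lborel (\<lambda>x. (norm (f x))\<^sup>2)"
    by (rule Bochner_Integration.integrable_bound[OF assms(2)])
      (use assms(3) in \<open>auto intro!: AE_I2 intro: order_trans[OF assms(3) abs_ge_self]\<close>)
  then show "f \<in> L2_space" "mass f \<le> (\<integral>x. g x \<partial>lborel)"
    using assms by (auto simp: L2_space_def mass_def intro!: integral_mono)
qed

lemma norm_add_square_le: "(norm (a + b))\<^sup>2 \<le> 2 * (norm a)\<^sup>2 + 2 * (norm b :: real)\<^sup>2"
proof -
  have "(norm (a + b))\<^sup>2 \<le> (norm a + norm b)\<^sup>2" by (simp add: norm_triangle_ineq power_mono)
  also have "\<dots> \<le> 2 * (norm a)\<^sup>2 + 2 * (norm b)\<^sup>2"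
    using zero_le_power2[of "norm a - norm b"] by (simp add: power2_eq_square algebra_simps)
  finally show ?thesis .
qed

lemma L2_add_aux:
  fixes f g :: "real^3 \<Rightarrow> complex"
  assumes "f \<in> L2_space" "g \<in> L2_space"
  shows "(\<lambda>x. f x + g x) \<in> L2_space" "mass (\<lambda>x. f x + g x) \<le> 2 * mass f + 2 * mass g"
proof -
  note [measurable] = assms
  note L = L2_bound[of "\<lambda>x. f x + g x" "\<lambda>x. 2 * (norm (f x))\<^sup>2 + 2 * (norm (g x))\<^sup>2"]
  show "(\<lambda>x. f x + g x) \<in> L2_space" "mass (\<lambda>x. f x + g x) \<le> 2 * mass f + 2 * mass g"
    using L assms by (simp_all add: L2_D norm_add_square_le mass_def)
qed

lemmas L2_add = L2_add_aux(1) and mass_add_le = L2_add_aux(2)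

lemma L2_cmult: "f \<in> L2_space \<Longrightarrow> (\<lambda>x. c * f x :: complex) \<in> L2_space"
  by (auto simp: L2_space_def norm_mult power_mult_distrib)

lemma mass_cmult: "mass (\<lambda>x. c * f x) = (norm c)\<^sup>2 * mass f"
  by (simp add: mass_def norm_mult power_mult_distrib)

lemma L2_uminus: "f \<in> L2_space \<Longrightarrow> (\<lambda>x. - f x :: complex) \<in> L2_space"
  using L2_cmult[of f "-1"] by simp

lemma L2_diff:
  fixes f g :: "real^3 \<Rightarrow> complex"
  shows "f \<in> L2_space \<Longrightarrow> g \<in> L2_space \<Longrightarrow> (\<lambda>x. f x - g x) \<in> L2_space"
  using L2_add[OF _ L2_uminus, of f g] by simp

lemma cnj_measurable [measurable]: "cnj \<in> borel_measurable borel"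
  by (intro borel_measurable_continuous_onI continuous_intros)

lemma L2_cnj: "f \<in> L2_space \<Longrightarrow> (\<lambda>x. cnj (f x)) \<in> L2_space"
  by (auto simp: L2_space_def)

lemma L2_norm: "f \<in> L2_space \<Longrightarrow> (\<lambda>x. complex_of_real (norm (f x))) \<in> L2_space"
  for f :: "real^3 \<Rightarrow> complex"
  by (auto simp: L2_space_def)

lemma L2_integrable_mult:
  fixes f g :: "real^3 \<Rightarrow> complex"
  assumes "f \<in> L2_space" "g \<in> L2_space"
  shows "integrable lborel (\<lambda>x. f x * g x)"
proof (rule Bochner_Integration.integrable_bound)
  note [measurable] = assms
  show "(\<lambda>x. f x * g x) \<in> borel_measurable lborel" by measurable
  show "integrable lborel (\<lambda>x. (norm (f x))\<^sup>2 + (norm (g x))\<^sup>2)" using assms by (simp add: L2_D)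
  have "a * b \<le> a\<^sup>2 + b\<^sup>2" if "0 \<le> a" "0 \<le> b" for a b :: real
    using mult_nonneg_nonneg[OF that] sum_squares_bound[of a b] by linarith
  then show "AE x in lborel. norm (f x * g x) \<le> norm ((norm (f x))\<^sup>2 + (norm (g x))\<^sup>2)"
    by (simp add: norm_mult)
qed

lemma L2_cauchy_schwarz:
  fixes f g :: "real^3 \<Rightarrow> complex"
  assumes "f \<in> L2_space" "g \<in> L2_space"
  shows "(norm (\<integral>x. f x * g x \<partial>lborel))\<^sup>2 \<le> mass f * mass g"
proof -
  note [measurable] = assms
  have i: "integrable lborel (\<lambda>x. f x * g x)" by (rule L2_integrable_mult[OF assms])
  have "ennreal ((norm (\<integral>x. f x * g x \<partial>lborel))\<^sup>2) \<le> ennreal ((\<integral>x. norm (f x * g x) \<partial>lborel)\<^sup>2)"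
    by (intro ennreal_leI power_mono integral_norm_bound) simp
  also have "\<dots> = (\<integral>\<^sup>+x. ennreal (norm (f x * g x)) \<partial>lborel)\<^sup>2"
    by (subst nn_integral_eq_integral) (auto simp: i ennreal_power)
  also have "\<dots> = (\<integral>\<^sup>+x. ennreal (norm (f x)) * ennreal (norm (g x)) \<partial>lborel)\<^sup>2"
    by (simp add: norm_mult ennreal_mult)
  also have "\<dots> \<le> (\<integral>\<^sup>+x. ennreal (norm (f x)) ^ 2 \<partial>lborel) * (\<integral>\<^sup>+x. ennreal (norm (g x)) ^ 2 \<partial>lborel)"
    by (rule Cauchy_Schwarz_nn_integral) auto
  also have "\<dots> = ennreal (mass f * mass g)"
    by (simp add: ennreal_power mass_nn[OF assms(1)] mass_nn[OF assms(2)] ennreal_mult mass_nonneg)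
  finally show ?thesis
    by (simp add: mass_nonneg)
qed

text \<open>Convergence in the squared norm. Membership in \<open>L2_space\<close> has to be stated
  as well, since \<open>mass\<close> takes the default value 0 on a measurable function that is not
  square integrable.\<close>

definition L2_conv :: "(nat \<Rightarrow> real^3 \<Rightarrow> complex) \<Rightarrow> (real^3 \<Rightarrow> complex) \<Rightarrow> bool" where
  "L2_conv F f \<longleftrightarrow> (\<forall>n. F n \<in> L2_space) \<and> f \<in> L2_space \<and>
     (\<lambda>n. mass (\<lambda>x. F n x - f x)) \<longlonglongrightarrow> 0"

lemma L2_conv_pairing:
  assumes "L2_conv F f" "h \<in> L2_space"
  shows "(\<lambda>n. \<integral>x. F n x * h x \<partial>lborel) \<longlonglongrightarrow> (\<integral>x. f x * h x \<partial>lborel)"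
proof -
  have F: "\<And>n. F n \<in> L2_space" and f: "f \<in> L2_space" using assms by (auto simp: L2_conv_def)
  have *: "(\<integral>x. F n x * h x \<partial>lborel) - (\<integral>x. f x * h x \<partial>lborel) = (\<integral>x. (F n x - f x) * h x \<partial>lborel)" for n
    by (subst Bochner_Integration.integral_diff[symmetric])
      (auto intro!: L2_integrable_mult F f assms simp: algebra_simps)
  have "(\<lambda>n. (norm ((\<integral>x. F n x * h x \<partial>lborel) - (\<integral>x. f x * h x \<partial>lborel)))\<^sup>2) \<longlonglongrightarrow> 0"
  proof (rule tendsto_sandwich[OF _ _ tendsto_const])
    show "(\<lambda>n. mass (\<lambda>x. F n x - f x) * mass h) \<longlonglongrightarrow> 0"
      using assms by (auto simp: L2_conv_def intro: tendsto_mult_left_zero)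
    show "\<forall>\<^sub>F n in sequentially. (norm ((\<integral>x. F n x * h x \<partial>lborel) - (\<integral>x. f x * h x \<partial>lborel)))\<^sup>2
        \<le> mass (\<lambda>x. F n x - f x) * mass h"
      unfolding * by (intro always_eventually allI L2_cauchy_schwarz L2_diff F f assms)
  qed auto
  from tendsto_real_sqrt[OF this]
  have "(\<lambda>n. norm ((\<integral>x. F n x * h x \<partial>lborel) - (\<integral>x. f x * h x \<partial>lborel))) \<longlonglongrightarrow> 0" by simp
  then show ?thesis by (simp add: LIM_zero_iff tendsto_norm_zero_iff)
qed

lemma mass_diff_expand:
  fixes f g :: "real^3 \<Rightarrow> complex"
  assumes "f \<in> L2_space" "g \<in> L2_space"
  shows "mass (\<lambda>x. f x + g x) = mass f + mass g + 2 * Re (\<integral>x. f x * cnj (g x) \<partial>lborel)"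
proof -
  have i: "integrable lborel (\<lambda>x. f x * cnj (g x))"
    by (intro L2_integrable_mult assms L2_cnj)
  have "(norm (f x + g x))\<^sup>2 = (norm (f x))\<^sup>2 + (norm (g x))\<^sup>2 + 2 * Re (f x * cnj (g x))" for x
    unfolding cmod_power2 by (simp add: power2_eq_square algebra_simps)
  then have "mass (\<lambda>x. f x + g x) = (\<integral>x. (norm (f x))\<^sup>2 + (norm (g x))\<^sup>2 + 2 * Re (f x * cnj (g x)) \<partial>lborel)"
    by (simp add: mass_def)
  also have "\<dots> = mass f + mass g + 2 * Re (\<integral>x. f x * cnj (g x) \<partial>lborel)"
    using i assms by (simp add: mass_def L2_D del: times_complex.sel)
  finally show ?thesis .
qed

text \<open>Writing \<open>F n\<close> as \<open>f\<close> plus a difference reduces the claim to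
  the convergence of the mass of the difference and of a pairing with \<open>f\<close>.\<close>

lemma L2_conv_mass:
  assumes "L2_conv F f" shows "(\<lambda>n. mass (F n)) \<longlonglongrightarrow> mass f"
proof -
  have F: "\<And>n. F n \<in> L2_space" and f: "f \<in> L2_space" using assms by (auto simp: L2_conv_def)
  have "mass (F n) = mass (\<lambda>x. F n x - f x) + mass f + 2 * Re (\<integral>x. (F n x - f x) * cnj (f x) \<partial>lborel)" for n
    using mass_diff_expand[OF L2_diff[OF F f] f, of n] by simp
  also have "(\<integral>x. (F n x - f x) * cnj (f x) \<partial>lborel) =
      (\<integral>x. F n x * cnj (f x) \<partial>lborel) - (\<integral>x. f x * cnj (f x) \<partial>lborel)" for n
    by (subst Bochner_Integration.integral_diff[symmetric])
      (auto intro!: L2_integrable_mult F f L2_cnj simp: algebra_simps)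
  finally have *: "mass (F n) = mass (\<lambda>x. F n x - f x) + mass f + 2 * Re ((\<integral>x. F n x * cnj (f x) \<partial>lborel)
      - (\<integral>x. f x * cnj (f x) \<partial>lborel))" for n .
  have "(\<lambda>n. mass (F n)) \<longlonglongrightarrow> 0 + mass f + 2 * Re ((\<integral>x. f x * cnj (f x) \<partial>lborel) - (\<integral>x. f x * cnj (f x) \<partial>lborel))"
    unfolding *
    by (intro tendsto_add tendsto_mult tendsto_const tendsto_Re tendsto_diff
        L2_conv_pairing[OF assms] L2_cnj f) (use assms in \<open>simp add: L2_conv_def\<close>)
  then show ?thesis by simp
qed

section \<open>Translations and reflections of Lebesgue measure\<close>

lemma nn_integral_translate:
  fixes f :: "'a::euclidean_space \<Rightarrow> ennreal"
  assumes [measurable]: "f \<in> borel_measurable borel"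
  shows "(\<integral>\<^sup>+x. f (x + c) \<partial>lborel) = (\<integral>\<^sup>+x. f x \<partial>lborel)"
proof -
  have "(\<integral>\<^sup>+x. f x \<partial>lborel) = (\<integral>\<^sup>+x. f x \<partial>(distr lborel borel ((+) c)))"
    by (simp add: lborel_distr_plus)
  also have "\<dots> = (\<integral>\<^sup>+x. f (x + c) \<partial>lborel)"
    by (subst nn_integral_distr) (auto simp: add.commute)
  finally show ?thesis ..
qed

lemma nn_integral_reflect:
  fixes f :: "'a::euclidean_space \<Rightarrow> ennreal"
  assumes [measurable]: "f \<in> borel_measurable borel"
  shows "(\<integral>\<^sup>+x. f (c - x) \<partial>lborel) = (\<integral>\<^sup>+x. f x \<partial>lborel)"
proof -
  have "(lborel :: 'a measure) = distr lborel borel (\<lambda>x. c - x)"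
    using lborel_affine[of "-1" c] by (simp add: density_1)
  then have "(\<integral>\<^sup>+x. f x \<partial>lborel) = (\<integral>\<^sup>+x. f x \<partial>(distr lborel borel (\<lambda>x. c - x)))"
    by simp
  also have "\<dots> = (\<integral>\<^sup>+x. f (c - x) \<partial>lborel)"
    by (subst nn_integral_distr) auto
  finally show ?thesis ..
qed

section \<open>Mollification\<close>

lemma kern_measurable [measurable]: "kern n \<in> borel_measurable borel"
  by (intro borel_measurable_continuous_onI continuous_kern)

lemma kern_deriv_measurable [measurable]: "kern_deriv n j \<in> borel_measurable borel"
  by (intro borel_measurable_continuous_onI continuous_kern_deriv)

lemma nn_integral_kern: "(\<integral>\<^sup>+x. ennreal (kern n x) \<partial>lborel) = 1"
  by (subst nn_integral_eq_integral) (auto simp: integrable_kern kern_nonneg integral_kern)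

lemma L2_cpt_supp:
  fixes f :: "real^3 \<Rightarrow> complex"
  assumes "continuous_on UNIV f" "\<And>z. R \<le> norm z \<Longrightarrow> f z = 0"
  shows "f \<in> L2_space"
  unfolding L2_space_def using assms
  by (auto intro!: borel_measurable_continuous_onI integrable_cpt_supp[of _ R] continuous_intros)

lemma L2_shifted_cpt_supp:
  fixes f :: "real^3 \<Rightarrow> real"
  assumes c: "continuous_on UNIV f" and "\<And>z. R \<le> norm z \<Longrightarrow> f z = 0"
  shows "(\<lambda>y. complex_of_real (f (x - y))) \<in> L2_space"
proof (rule L2_cpt_supp[of _ "R + norm x"])
  show "continuous_on UNIV (\<lambda>y. complex_of_real (f (x - y)))"
    by (intro continuous_on_of_real continuous_on_compose2[OF c _ subset_UNIV] continuous_intros)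
  show "complex_of_real (f (x - y)) = 0" if "R + norm x \<le> norm y" for y
  proof -
    have "R \<le> norm (x - y)" using that norm_triangle_ineq2[of y x] by (simp add: norm_minus_commute)
    then show ?thesis using assms by simp
  qed
qed

lemma kern_L2: "(\<lambda>y. complex_of_real (kern n (x - y))) \<in> L2_space"
  by (rule L2_shifted_cpt_supp[OF continuous_kern kern_eq_0])

lemma kern_deriv_L2: "(\<lambda>y. complex_of_real (kern_deriv n j (x - y))) \<in> L2_space"
  by (rule L2_shifted_cpt_supp[OF continuous_kern_deriv, of "2 / real (Suc n) + 1"]) (rule kern_deriv_eq_0, linarith)

definition moll :: "nat \<Rightarrow> (real^3 \<Rightarrow> complex) \<Rightarrow> real^3 \<Rightarrow> complex" where
  "moll n f x = (\<integral>y. f y * complex_of_real (kern n (x - y)) \<partial>lborel)"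

lemma moll_integrable: "f \<in> L2_space \<Longrightarrow> integrable lborel (\<lambda>y. f y * complex_of_real (kern n (x - y)))"
  by (intro L2_integrable_mult kern_L2)

lemma moll_diff: "f \<in> L2_space \<Longrightarrow> g \<in> L2_space \<Longrightarrow> moll n (\<lambda>y. f y - g y) x = moll n f x - moll n g x"
  by (simp add: moll_def left_diff_distrib moll_integrable)

text \<open>The kernel is a probability density in \<open>y\<close>, so this is Jensen's inequality
  for the square. It comes from Cauchy-Schwarz after splitting the kernel into two square
  roots.\<close>

lemma moll_jensen:
  assumes "f \<in> L2_space"
  shows "ennreal ((norm (moll n f x))\<^sup>2) \<le> (\<integral>\<^sup>+y. ennreal ((norm (f y))\<^sup>2) * ennreal (kern n (x - y)) \<partial>lborel)"
proof -
  note [measurable] = assms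
  let ?k = "\<lambda>y. kern n (x - y)"
  have i: "integrable lborel (\<lambda>y. f y * complex_of_real (?k y))" by (rule moll_integrable[OF assms])
  have "ennreal ((norm (moll n f x))\<^sup>2) \<le> ennreal ((\<integral>y. norm (f y * complex_of_real (?k y)) \<partial>lborel)\<^sup>2)"
    unfolding moll_def by (intro ennreal_leI power_mono integral_norm_bound) simp
  also have "\<dots> = (\<integral>\<^sup>+y. ennreal (norm (f y * complex_of_real (?k y))) \<partial>lborel)\<^sup>2"
    by (subst nn_integral_eq_integral) (auto simp: integrable_norm[OF i] ennreal_power)
  also have "\<dots> = (\<integral>\<^sup>+y. ennreal (norm (f y) * sqrt (?k y)) * ennreal (sqrt (?k y)) \<partial>lborel)\<^sup>2"
    by (simp add: norm_mult ennreal_mult[symmetric] kern_nonneg mult.assoc)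
  also have "\<dots> \<le> (\<integral>\<^sup>+y. ennreal (norm (f y) * sqrt (?k y)) ^ 2 \<partial>lborel) * (\<integral>\<^sup>+y. ennreal (sqrt (?k y)) ^ 2 \<partial>lborel)"
    by (rule Cauchy_Schwarz_nn_integral) auto
  also have "(\<integral>\<^sup>+y. ennreal (sqrt (?k y)) ^ 2 \<partial>lborel) = 1"
    using nn_integral_reflect[of "\<lambda>z. ennreal (kern n z)" x]
    by (simp add: ennreal_power kern_nonneg nn_integral_kern)
  also have "(\<integral>\<^sup>+y. ennreal (norm (f y) * sqrt (?k y)) ^ 2 \<partial>lborel) =
      (\<integral>\<^sup>+y. ennreal ((norm (f y))\<^sup>2) * ennreal (?k y) \<partial>lborel)"
    by (simp add: ennreal_power power_mult_distrib kern_nonneg ennreal_mult)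
  finally show ?thesis by simp
qed

text \<open>Differentiability of the kernel with an error uniform in \<open>z\<close>: the partial
  derivatives are continuous with bounded support, hence uniformly continuous. This allows
  differentiation under the integral sign against a function that is merely square
  integrable.\<close>

lemma kern_deriv_unif:
  assumes "0 < e"
  shows "\<exists>d>0. d \<le> 1 \<and> (\<forall>z h. norm h < d \<longrightarrow>
    \<bar>kern n (z + h) - kern n z - (\<Sum>j\<in>UNIV. h $ j * kern_deriv n j z)\<bar> \<le> e * norm h)"
proof -
  define R where "R = 2 / real (Suc n) + 1"
  have R: "kern_deriv n j z = 0" if "R - 1 < norm z" for j z
    using kern_deriv_eq_0 that by (simp add: R_def)
  have "\<exists>d>0. \<forall>z w. dist w z < d \<longrightarrow> \<bar>kern_deriv n j w - kern_deriv n j z\<bar> \<le> e / 3" for j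
  proof -
    have "uniformly_continuous_on (cball 0 (R + 1)) (kern_deriv n j)"
      by (intro compact_uniformly_continuous continuous_on_subset[OF continuous_kern_deriv]) auto
    then obtain d where d: "0 < d" "\<And>z w. z \<in> cball 0 (R + 1) \<Longrightarrow> w \<in> cball 0 (R + 1) \<Longrightarrow> dist w z < d
        \<Longrightarrow> dist (kern_deriv n j w) (kern_deriv n j z) < e / 3"
      using \<open>0 < e\<close> unfolding uniformly_continuous_on_def by (metis zero_less_divide_iff zero_less_numeral)
    show ?thesis
    \<comment> \<open>A shift shorter than 1 keeps both points in the larger ball as soon as one of
      them has norm at most \<open>R\<close>; otherwise both derivatives vanish.\<close>
    proof (intro exI[of _ "min d 1"] conjI allI impI)
      fix z w :: "real^3" assume zw: "dist w z < min d 1"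
      have n: "norm z \<le> norm w + 1" "norm w \<le> norm z + 1"
        using zw norm_triangle_ineq2[of w z] norm_triangle_ineq2[of z w]
        by (auto simp: dist_norm norm_minus_commute)
      show "\<bar>kern_deriv n j w - kern_deriv n j z\<bar> \<le> e / 3"
      proof (cases "norm z \<le> R \<or> norm w \<le> R")
        case True
        then show ?thesis using d(2)[of z w] zw n by (auto simp: dist_real_def)
      next
        case False
        then show ?thesis using R[of z] R[of w] \<open>0 < e\<close> by auto
      qed
    qed (use d in auto)
  qed
  then obtain d where d: "\<And>j. 0 < d j"
    "\<And>j z w. dist w z < d j \<Longrightarrow> \<bar>kern_deriv n j w - kern_deriv n j z\<bar> \<le> e / 3" by metis
  define D where "D = min 1 (min (d 1) (min (d 2) (d 3)))"
  have Dj: "D \<le> d j" for j using exhaust_3[of j] by (auto simp: D_def)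
  show ?thesis
  proof (intro exI[of _ D] conjI allI impI)
    show "0 < D" "D \<le> 1" using d(1) by (auto simp: D_def)
    fix z h :: "real^3" assume h: "norm h < D"
    have "((\<lambda>t. kern n (z + t *\<^sub>R h)) has_derivative (\<lambda>s. \<Sum>j\<in>UNIV. (s *\<^sub>R h) $ j * kern_deriv n j (z + t *\<^sub>R h)))
        (at t within {0..1})" for t :: real
      by (rule has_derivative_compose[OF _ has_derivative_kern]) (auto intro!: derivative_eq_intros)
    from mvt_simple[OF zero_less_one this] obtain t where t: "t \<in> {0<..<1}"
      "kern n (z + h) - kern n z = (\<Sum>j\<in>UNIV. h $ j * kern_deriv n j (z + t *\<^sub>R h))"
      by auto
    have th: "dist (z + t *\<^sub>R h) z < d j" for j
    proof -
      have "norm (t *\<^sub>R h) \<le> norm h" using t by (simp add: mult_left_le_one_le)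
      then show ?thesis using h Dj[of j] by (simp add: dist_norm)
    qed
    have "kern n (z + h) - kern n z - (\<Sum>j\<in>UNIV. h $ j * kern_deriv n j z) =
       (\<Sum>j\<in>UNIV. h $ j * (kern_deriv n j (z + t *\<^sub>R h) - kern_deriv n j z))"
      by (simp add: t sum_subtractf right_diff_distrib)
    also have "\<bar>\<dots>\<bar> \<le> (\<Sum>j\<in>UNIV. \<bar>h $ j * (kern_deriv n j (z + t *\<^sub>R h) - kern_deriv n j z)\<bar>)"
      by (rule sum_abs)
    also have "\<dots> \<le> (\<Sum>j\<in>(UNIV::3 set). norm h * (e / 3))"
      unfolding abs_mult by (intro sum_mono mult_mono d(2)[OF th] component_le_norm_cart) auto
    also have "\<dots> = e * norm h" by simp
    finally show "\<bar>kern n (z + h) - kern n z - (\<Sum>j\<in>UNIV. h $ j * kern_deriv n j z)\<bar> \<le> e * norm h" .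
  qed
qed

lemma moll_has_derivative:
  assumes f: "f \<in> L2_space"
  shows "(moll n f has_derivative
    (\<lambda>h. \<Sum>j\<in>UNIV. h $ j *\<^sub>R (\<integral>y. f y * complex_of_real (kern_deriv n j (x - y)) \<partial>lborel))) (at x)"
  unfolding has_derivative_at_alt
proof (intro conjI allI impI)
  note [measurable] = f
  let ?D = "\<lambda>j. \<integral>y. f y * complex_of_real (kern_deriv n j (x - y)) \<partial>lborel"
  show "bounded_linear (\<lambda>h::real^3. \<Sum>j\<in>UNIV. h $ j *\<^sub>R ?D j)"
    by (intro bounded_linear_sum bounded_linear_scaleR_left[THEN bounded_linear_compose] bounded_linear_vec_nth)
  fix e :: real assume "0 < e"
  define R where "R = 2 / real (Suc n) + 1"
  have fi: "integrable lborel (\<lambda>y. norm (f y) * indicator (cball x (R + 1)) y)"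
  proof -
    have "(\<lambda>y. complex_of_real (indicator (cball x (R + 1)) y)) \<in> L2_space"
    proof -
      have "integrable lborel (indicator (cball x (R + 1)) :: real^3 \<Rightarrow> real)"
        using emeasure_bounded_finite[OF bounded_cball] by (auto simp: integrable_indicator_iff)
      moreover have "(norm (complex_of_real (indicator (cball x (R + 1)) y)))\<^sup>2 = indicator (cball x (R + 1)) y" for y
        by (simp split: split_indicator)
      ultimately show ?thesis by (simp add: L2_space_def)
    qed
    from integrable_norm[OF L2_integrable_mult[OF f this]] show ?thesis by (simp add: norm_mult)
  qed
  \<comment> \<open>Square integrability gives integrability over balls; that suffices because the
    remainder \<open>r\<close> below vanishes outside radius \<open>R + 1\<close>. Dividing by
    \<open>M + 1\<close> covers the case \<open>M = 0\<close>.\<close>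
  define M where "M = (\<integral>y. norm (f y) * indicator (cball x (R + 1)) y \<partial>lborel)"
  have M: "0 \<le> M" unfolding M_def by (intro Bochner_Integration.integral_nonneg) auto
  have "0 < e / (M + 1)" using M \<open>0 < e\<close> by simp
  from kern_deriv_unif[OF this, of n] obtain d where d: "0 < d" "d \<le> 1"
    "\<And>z h. norm h < d \<Longrightarrow> \<bar>kern n (z + h) - kern n z - (\<Sum>j\<in>UNIV. h $ j * kern_deriv n j z)\<bar> \<le> e / (M + 1) * norm h"
    by blast
  show "\<exists>d>0. \<forall>y. norm (y - x) < d \<longrightarrow>
      norm (moll n f y - moll n f x - (\<Sum>j\<in>UNIV. (y - x) $ j *\<^sub>R ?D j)) \<le> e * norm (y - x)"
  proof (intro exI[of _ d] conjI allI impI)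
    fix x' assume x': "norm (x' - x) < d"
    define h where "h = x' - x"
    have h: "norm h < d" "x' = x + h" using x' by (auto simp: h_def)
    define r where "r z = kern n (z + h) - kern n z - (\<Sum>j\<in>UNIV. h $ j * kern_deriv n j z)" for z
    have r0: "r z = 0" if "R + 1 < norm z" for z
    proof -
      have "norm z \<le> norm (z + h) + 1" using h d(2) norm_triangle_ineq4[of "z + h" h] by simp
      then have "kern n (z + h) = 0" using that by (intro kern_eq_0) (simp add: R_def)
      moreover have "kern n z = 0" using that by (intro kern_eq_0) (simp add: R_def)
      moreover have "kern_deriv n j z = 0" for j using that by (intro kern_deriv_eq_0) (simp add: R_def)
      ultimately show ?thesis by (simp add: r_def)
    qed
    have i: "integrable lborel (\<lambda>y. f y * complex_of_real (kern_deriv n j (x - y)))" for j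
      by (intro L2_integrable_mult f kern_deriv_L2)
    have "moll n f x' - moll n f x - (\<Sum>j\<in>UNIV. h $ j *\<^sub>R ?D j) =
      (\<integral>y. f y * complex_of_real (kern n (x' - y)) - f y * complex_of_real (kern n (x - y)) -
         (\<Sum>j\<in>UNIV. h $ j *\<^sub>R (f y * complex_of_real (kern_deriv n j (x - y)))) \<partial>lborel)"
      by (simp add: moll_def moll_integrable[OF f] i)
    also have "\<dots> = (\<integral>y. f y * complex_of_real (r (x - y)) \<partial>lborel)"
      by (rule Bochner_Integration.integral_cong)
        (auto simp: r_def h(2) algebra_simps sum_distrib_left scaleR_conv_of_real)
    also have "norm \<dots> \<le> (\<integral>y. norm (f y) * indicator (cball x (R + 1)) y * (e / (M + 1) * norm h) \<partial>lborel)"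
    proof (rule order_trans[OF integral_norm_bound integral_mono'])
      show "integrable lborel (\<lambda>y. norm (f y) * indicator (cball x (R + 1)) y * (e / (M + 1) * norm h))"
        by (intro integrable_mult_left fi)
      have bd: "norm (f y * complex_of_real (r (x - y))) \<le> norm (f y) * indicator (cball x (R + 1)) y * (e / (M + 1) * norm h)" for y
      proof (cases "y \<in> cball x (R + 1)")
        case True
        have "\<bar>r (x - y)\<bar> \<le> e / (M + 1) * norm h" unfolding r_def by (rule d(3)[OF h(1)])
        from mult_left_mono[OF this norm_ge_zero[of "f y"]] show ?thesis
          using True by (simp add: norm_mult mult.assoc)
      next
        case False
        then show ?thesis using r0[of "x - y"] by (simp add: dist_norm)
      qed
      then show "norm (f y * complex_of_real (r (x - y))) \<le> norm (f y) * indicator (cball x (R + 1)) y * (e / (M + 1) * norm h)" for y .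
      show "0 \<le> norm (f y) * indicator (cball x (R + 1)) y * (e / (M + 1) * norm h)" for y
        by (intro mult_nonneg_nonneg norm_ge_zero less_imp_le[OF \<open>0 < e / (M + 1)\<close>]) simp
    qed
    also have "\<dots> = M * (e / (M + 1) * norm h)" by (simp add: M_def)
    also have "\<dots> \<le> e * norm h"
    proof -
      have "M * (e / (M + 1)) \<le> e" using M \<open>0 < e\<close> by (simp add: field_simps)
      from mult_right_mono[OF this, of "norm h"] show ?thesis by (simp add: mult.assoc)
    qed
    finally show "norm (moll n f x' - moll n f x - (\<Sum>j\<in>UNIV. (x' - x) $ j *\<^sub>R ?D j)) \<le> e * norm (x' - x)"
      by (simp add: h_def)
  qed (rule d)
qed

lemma continuous_moll: "f \<in> L2_space \<Longrightarrow> continuous_on S (moll n f)"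
  by (intro continuous_at_imp_continuous_on ballI has_derivative_continuous[OF moll_has_derivative])

lemma moll_measurable: "f \<in> L2_space \<Longrightarrow> moll n f \<in> borel_measurable borel"
  by (intro borel_measurable_continuous_onI continuous_moll)

text \<open>Integrating \<open>moll_jensen\<close> in \<open>x\<close> and exchanging the integrals
  leaves the unit mass of the kernel: Young's inequality for an \<open>L^1\<close> kernel.\<close>

lemma moll_contraction:
  assumes "f \<in> L2_space"
  shows "moll n f \<in> L2_space" "mass (moll n f) \<le> mass f"
proof -
  note [measurable] = assms moll_measurable[OF assms]
  have "(\<integral>\<^sup>+x. ennreal ((norm (moll n f x))\<^sup>2) \<partial>lborel) \<le>
      (\<integral>\<^sup>+x. \<integral>\<^sup>+y. ennreal ((norm (f y))\<^sup>2) * ennreal (kern n (x - y)) \<partial>lborel \<partial>lborel)"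
    by (intro nn_integral_mono moll_jensen assms)
  also have "\<dots> = (\<integral>\<^sup>+y. \<integral>\<^sup>+x. ennreal ((norm (f y))\<^sup>2) * ennreal (kern n (x - y)) \<partial>lborel \<partial>lborel)"
  proof (rule lborel_pair.Fubini')
    have [measurable]: "(\<lambda>p::(real^3) \<times> (real^3). kern n (snd p - fst p)) \<in> borel_measurable borel"
      by (intro borel_measurable_continuous_onI continuous_on_compose2[OF continuous_kern _ subset_UNIV]
          continuous_intros)
    have [measurable]: "(\<lambda>p::(real^3) \<times> (real^3). f (fst p)) \<in> borel_measurable borel"
      by (rule measurable_compose[OF _ L2_measurable[OF assms]])
        (intro borel_measurable_continuous_onI continuous_intros)
    show "(\<lambda>(x, y). ennreal ((cmod (f x))\<^sup>2) * ennreal (kern n (y - x))) \<in> borel_measurable (lborel \<Otimes>\<^sub>M lborel)"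
      unfolding lborel_prod split_beta' measurable_lborel2 by measurable
  qed
  also have "\<dots> = (\<integral>\<^sup>+y. ennreal ((norm (f y))\<^sup>2) \<partial>lborel)"
    using nn_integral_translate[of "\<lambda>x. ennreal (kern n x)" "- y" for y]
    by (simp add: nn_integral_cmult nn_integral_kern)
  finally have *: "(\<integral>\<^sup>+x. ennreal ((norm (moll n f x))\<^sup>2) \<partial>lborel) \<le> (\<integral>\<^sup>+y. ennreal ((norm (f y))\<^sup>2) \<partial>lborel)" .
  then show 1: "moll n f \<in> L2_space"
    using assms unfolding L2_nn by (auto intro: order.strict_trans1)
  show "mass (moll n f) \<le> mass f"
    using * mass_nonneg[of f] by (simp add: mass_nn[OF 1, symmetric] mass_nn[OF assms, symmetric])
qed

section \<open>Mean square convergence of mollifications\<close>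

lemma norm_diff_square_le3:
  "(norm (a - d))\<^sup>2 \<le> 3 * (norm (a - b))\<^sup>2 + 3 * (norm (b - c))\<^sup>2 + 3 * (norm (c - d :: complex))\<^sup>2"
proof -
  have "norm (a - d) \<le> norm (a - b) + norm (b - c) + norm (c - d)"
    using norm_triangle_ineq[of "a - b" "b - c"] norm_triangle_ineq[of "a - c" "c - d"] by simp
  then have "(norm (a - d))\<^sup>2 \<le> (norm (a - b) + norm (b - c) + norm (c - d))\<^sup>2"
    by (simp add: power_mono)
  also have "(x + y + z)\<^sup>2 \<le> 3 * x\<^sup>2 + 3 * y\<^sup>2 + 3 * z\<^sup>2" for x y z :: real
    using zero_le_power2[of "x - y"] zero_le_power2[of "y - z"] zero_le_power2[of "x - z"]
    by (simp add: power2_eq_square algebra_simps)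
  finally show ?thesis .
qed

lemma mass_triangle3:
  assumes "a \<in> L2_space" "b \<in> L2_space" "c \<in> L2_space" "d \<in> L2_space"
  shows "mass (\<lambda>x. a x - d x) \<le>
    3 * mass (\<lambda>x. a x - b x) + 3 * mass (\<lambda>x. b x - c x) + 3 * mass (\<lambda>x. c x - d x)"
proof -
  have "mass (\<lambda>x. a x - d x) \<le> (\<integral>x. 3 * (norm (a x - b x))\<^sup>2 + 3 * (norm (b x - c x))\<^sup>2 + 3 * (norm (c x - d x))\<^sup>2 \<partial>lborel)"
    unfolding mass_def
    by (intro integral_mono norm_diff_square_le3 Bochner_Integration.integrable_add integrable_mult_right
        L2_D(2)[OF L2_diff] assms)
  also have "\<dots> = 3 * mass (\<lambda>x. a x - b x) + 3 * mass (\<lambda>x. b x - c x) + 3 * mass (\<lambda>x. c x - d x)"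
    using L2_D(2)[OF L2_diff] assms by (simp add: mass_def)
  finally show ?thesis .
qed

lemma L2_approx_bounded:
  assumes f: "f \<in> L2_space" and "0 < e"
  shows "\<exists>k. mass (\<lambda>x. f x - (if norm x \<le> real k \<and> norm (f x) \<le> real k then f x else 0)) < e"
proof -
  note [measurable] = L2_measurable[OF f]
  let ?g = "\<lambda>k x. if norm x \<le> real k \<and> norm (f x) \<le> real k then f x else 0"
  have "(\<lambda>k. \<integral>x. (norm (f x - ?g k x))\<^sup>2 \<partial>lborel) \<longlonglongrightarrow> (\<integral>x. 0 \<partial>(lborel :: (real^3) measure))"
  proof (rule integral_dominated_convergence[where w = "\<lambda>x. (norm (f x))\<^sup>2"])
    show "AE x in lborel. (\<lambda>k. (norm (f x - ?g k x))\<^sup>2) \<longlonglongrightarrow> 0"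
    proof (rule AE_I2, rule tendsto_eventually)
      fix x
      obtain N where "max (norm x) (norm (f x)) \<le> real N" using real_arch_simple by blast
      then show "\<forall>\<^sub>F k in sequentially. (norm (f x - ?g k x))\<^sup>2 = 0"
        by (auto simp: eventually_sequentially intro!: exI[of _ N])
    qed
  qed (auto simp: L2_D[OF f])
  then have "(\<lambda>k. mass (\<lambda>x. f x - ?g k x)) \<longlonglongrightarrow> 0" by (simp add: mass_def)
  from order_tendstoD(2)[OF this \<open>0 < e\<close>] show ?thesis
    by (auto simp: eventually_sequentially)
qed

text \<open>A measurable function is an almost everywhere limit of continuous ones, but with no
  control of their size or support. Composing with the radial retraction \<open>clip\<close> onto
  the ball of radius \<open>k\<close> and multiplying by the cutoff \<open>chi\<close> supplies a
  dominating function and leaves the limit \<open>f\<close> unchanged.\<close>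

lemma L2_approx_continuous_bounded:
  fixes f :: "real^3 \<Rightarrow> complex"
  assumes [measurable]: "f \<in> borel_measurable borel" and "0 < k" "0 < e"
    and f: "\<And>x. norm (f x) \<le> k" "\<And>x. k < norm x \<Longrightarrow> f x = 0"
  shows "\<exists>g. continuous_on UNIV g \<and> (\<forall>x. k + 1 \<le> norm x \<longrightarrow> g x = 0) \<and> mass (\<lambda>x. f x - g x) < e"
proof -
  have "f measurable_on UNIV"
    by (rule lebesgue_measurable_imp_measurable_on) (auto intro: measurable_completion)
  then obtain N G where N: "negligible N" and G: "\<And>n. continuous_on UNIV (G n)"
    and lim: "\<And>x. x \<notin> N \<Longrightarrow> (\<lambda>n. G n x) \<longlonglongrightarrow> f x"
    by (auto simp: measurable_on_def)
  define clip where "clip z = (k / max k (norm z)) *\<^sub>R (z::complex)" for z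
  define chi where "chi x = max 0 (min 1 (k + 1 - norm x))" for x :: "real^3"
  define H where "H n x = chi x *\<^sub>R clip (G n x)" for n x
  have clip: "continuous_on UNIV clip" unfolding clip_def using \<open>0 < k\<close>
    by (intro continuous_intros) (auto simp: max_def)
  have clip_le: "norm (clip z) \<le> k" for z
    using \<open>0 < k\<close> by (auto simp: clip_def max_def field_simps)
  have clip_id: "norm z \<le> k \<Longrightarrow> clip z = z" for z using \<open>0 < k\<close> by (simp add: clip_def)
  have H: "continuous_on UNIV (H n)" for n
    unfolding H_def chi_def
    by (intro continuous_on_scaleR continuous_on_compose2[OF clip G subset_UNIV] continuous_intros)
  have H0: "H n x = 0" if "k + 1 \<le> norm x" for n x
    using that by (simp add: H_def chi_def)
  have [measurable]: "H n \<in> borel_measurable borel" for n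
    by (rule borel_measurable_continuous_onI[OF H])
  have fchi: "chi x *\<^sub>R f x = f x" for x
    using f(2)[of x] by (cases "k < norm x") (auto simp: chi_def)
  have "(\<lambda>n. \<integral>x. (norm (f x - H n x))\<^sup>2 \<partial>lborel) \<longlonglongrightarrow> (\<integral>x. 0 \<partial>(lborel :: (real^3) measure))"
  proof (rule integral_dominated_convergence[where w = "\<lambda>x. (2 * k)\<^sup>2 * indicator (cball 0 (k + 1)) x"])
    show "AE x in lborel. (\<lambda>n. (norm (f x - H n x))\<^sup>2) \<longlonglongrightarrow> 0"
    proof (rule AE_mp)
      have "AE x in lebesgue. x \<notin> N"
        using N by (auto simp: negligible_iff_null_sets intro: AE_not_in)
      then show "AE x in lborel. x \<notin> N" by (simp add: AE_completion_iff)
      have "(\<lambda>n. (norm (f x - H n x))\<^sup>2) \<longlonglongrightarrow> 0" if "x \<notin> N" for x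
      proof -
        have "(\<lambda>n. clip (G n x)) \<longlonglongrightarrow> clip (f x)"
          by (rule continuous_on_tendsto_compose[OF clip lim[OF that]]) auto
        then have "(\<lambda>n. H n x) \<longlonglongrightarrow> chi x *\<^sub>R f x"
          unfolding H_def clip_id[OF f(1)] by (intro tendsto_intros)
        then have "(\<lambda>n. (norm (f x - H n x))\<^sup>2) \<longlonglongrightarrow> (norm (f x - f x))\<^sup>2"
          unfolding fchi by (intro tendsto_intros)
        then show ?thesis by simp
      qed
      then show "AE x in lborel. x \<notin> N \<longrightarrow> (\<lambda>n. (norm (f x - H n x))\<^sup>2) \<longlonglongrightarrow> 0" by simp
    qed
    show "integrable lborel (\<lambda>x::real^3. (2 * k)\<^sup>2 * indicator (cball 0 (k + 1)) x)"
      using emeasure_bounded_finite[OF bounded_cball, of "0::real^3" "k + 1"]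
      by (intro integrable_mult_right) (auto simp: integrable_indicator_iff)
    show "AE x in lborel. norm ((norm (f x - H n x))\<^sup>2) \<le> (2 * k)\<^sup>2 * indicator (cball 0 (k + 1)) x" for n
    proof (rule AE_I2)
      fix x :: "real^3"
      have "norm (H n x) \<le> k"
      proof -
        have "\<bar>chi x\<bar> \<le> 1" by (auto simp: chi_def)
        from mult_mono[OF this clip_le] \<open>0 < k\<close> show ?thesis by (simp add: H_def)
      qed
      then have "norm (f x - H n x) \<le> 2 * k" using f(1)[of x] norm_triangle_ineq4[of "f x" "H n x"] by simp
      then have "(norm (f x - H n x))\<^sup>2 \<le> (2 * k)\<^sup>2" by (intro power_mono) auto
      moreover have "f x - H n x = 0" if "k + 1 < norm x" using that f(2)[of x] H0[of x n] by simp
      ultimately show "norm ((norm (f x - H n x))\<^sup>2) \<le> (2 * k)\<^sup>2 * indicator (cball 0 (k + 1)) x"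
        by (cases "k + 1 < norm x") auto
    qed
  qed auto
  then have "(\<lambda>n. mass (\<lambda>x. f x - H n x)) \<longlonglongrightarrow> 0" by (simp add: mass_def)
  from order_tendstoD(2)[OF this \<open>0 < e\<close>] obtain n where "mass (\<lambda>x. f x - H n x) < e"
    by (auto simp: eventually_sequentially)
  with H H0 show ?thesis by blast
qed

lemma L2_dense:
  assumes f: "f \<in> L2_space" and "0 < e"
  shows "\<exists>g R. continuous_on UNIV g \<and> (\<forall>x. R \<le> norm x \<longrightarrow> g x = 0) \<and> g \<in> L2_space \<and>
    mass (\<lambda>x. f x - g x) < e"
proof -
  note [measurable] = L2_measurable[OF f]
  obtain k where k: "mass (\<lambda>x. f x - (if norm x \<le> real k \<and> norm (f x) \<le> real k then f x else 0)) < e / 4"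
    using L2_approx_bounded[OF f, of "e / 4"] \<open>0 < e\<close> by auto
  define h where "h x = (if norm x \<le> real k \<and> norm (f x) \<le> real k then f x else 0)" for x
  have hm: "h \<in> borel_measurable borel" unfolding h_def by measurable
  have hL: "h \<in> L2_space"
    by (rule L2_bound(1)[OF hm L2_D(2)[OF f]]) (simp add: h_def)
  \<comment> \<open>The bound \<open>real k + 1\<close> stays positive when \<open>k = 0\<close>.
    The thresholds \<open>e / 4\<close> allow for the factor 2 on each term of
    \<open>mass_add_le\<close>.\<close>
  have h: "norm (h x) \<le> real k + 1" "real k + 1 < norm x \<Longrightarrow> h x = 0" for x
    by (auto simp: h_def)
  obtain g where g: "continuous_on UNIV g" "\<And>x. real k + 1 + 1 \<le> norm x \<Longrightarrow> g x = 0" "mass (\<lambda>x. h x - g x) < e / 4"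
    using L2_approx_continuous_bounded[OF hm _ _ h, of "e / 4"] \<open>0 < e\<close>
    by auto
  have gL: "g \<in> L2_space" by (rule L2_cpt_supp[OF g(1,2)])
  have "mass (\<lambda>x. f x - g x) \<le> 2 * mass (\<lambda>x. f x - h x) + 2 * mass (\<lambda>x. h x - g x)"
    using mass_add_le[OF L2_diff[OF f hL] L2_diff[OF hL gL]] by simp
  also have "\<dots> < e" using k g(3) unfolding h_def by linarith
  finally show ?thesis using g(1,2) gL by blast
qed

lemma moll_const_diff:
  assumes "f \<in> L2_space"
  shows "moll n f x - c = (\<integral>y. (f y - c) * complex_of_real (kern n (x - y)) \<partial>lborel)"
proof -
  have i: "integrable lborel (\<lambda>y. kern n (x - y))"
    using nn_integral_reflect[of "\<lambda>z. ennreal (kern n z)" x]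
    by (simp add: integrable_iff_bounded kern_nonneg nn_integral_kern)
  have "(\<integral>y. kern n (x - y) \<partial>lborel) = 1"
    using nn_integral_reflect[of "\<lambda>z. ennreal (kern n z)" x]
    by (simp add: integral_eq_nn_integral kern_nonneg nn_integral_kern)
  then have "(\<integral>y. c * complex_of_real (kern n (x - y)) \<partial>lborel) = c"
    using i by simp
  moreover have "integrable lborel (\<lambda>y. c * complex_of_real (kern n (x - y)))" using i by simp
  ultimately show ?thesis
    by (simp add: moll_def left_diff_distrib moll_integrable[OF assms])
qed

text \<open>The kernel at \<open>x\<close> is a probability density living within distance
  \<open>2 / Suc n\<close>, so averaging cannot leave a ball around \<open>c\<close> that contains
  all nearby values of \<open>f\<close>.\<close>

lemma moll_local_bound:
  assumes f: "f \<in> L2_space" and "0 \<le> e"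
    and loc: "\<And>y. norm (x - y) < 2 / real (Suc n) \<Longrightarrow> norm (f y - c) \<le> e"
  shows "norm (moll n f x - c) \<le> e"
proof -
  have i: "integrable lborel (\<lambda>y. kern n (x - y))"
    using nn_integral_reflect[of "\<lambda>z. ennreal (kern n z)" x]
    by (simp add: integrable_iff_bounded kern_nonneg nn_integral_kern)
  have "norm (moll n f x - c) \<le> (\<integral>y. e * kern n (x - y) \<partial>lborel)"
    unfolding moll_const_diff[OF f]
  proof (rule order_trans[OF integral_norm_bound integral_mono'])
    show "norm ((f y - c) * complex_of_real (kern n (x - y))) \<le> e * kern n (x - y)" for y
    proof (cases "norm (x - y) < 2 / real (Suc n)")
      case True
      then show ?thesis using mult_right_mono[OF loc kern_nonneg] by (simp add: norm_mult kern_nonneg)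
    next
      case False
      then show ?thesis using kern_eq_0[of n "x - y"] by simp
    qed
  qed (use i \<open>0 \<le> e\<close> in \<open>auto simp: kern_nonneg\<close>)
  also have "\<dots> = e"
    using nn_integral_reflect[of "\<lambda>z. ennreal (kern n z)" x]
    by (simp add: integral_eq_nn_integral kern_nonneg nn_integral_kern)
  finally show ?thesis .
qed

lemma L2_conv_moll_continuous:
  fixes g :: "real^3 \<Rightarrow> complex"
  assumes g: "continuous_on UNIV g" and g0: "\<And>x. R \<le> norm x \<Longrightarrow> g x = 0"
  shows "(\<lambda>n. mass (\<lambda>x. moll n g x - g x)) \<longlonglongrightarrow> 0"
proof -
  have gL: "g \<in> L2_space" by (rule L2_cpt_supp[OF g g0])
  define B where "B = cball (0::real^3) (R + 2)"
  define vol where "vol = measure lborel B"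
  have Bi: "integrable lborel (indicator B :: real^3 \<Rightarrow> real)"
    using emeasure_bounded_finite[OF bounded_cball] by (auto simp: B_def integrable_indicator_iff)
  show ?thesis
  proof (rule tendstoI)
    fix e :: real assume "0 < e"
    \<comment> \<open>Makes \<open>s\<^sup>2 * vol\<close> less than \<open>e / 2\<close>; the
      summand 1 covers a ball of volume zero.\<close>
    define s where "s = sqrt (e / (2 * (vol + 1)))"
    have v: "0 \<le> vol" by (simp add: vol_def)
    have s: "0 < s" "s\<^sup>2 * vol < e"
    proof -
      show "0 < s" using \<open>0 < e\<close> v by (simp add: s_def)
      have "s\<^sup>2 = e / (2 * (vol + 1))" using \<open>0 < e\<close> v by (simp add: s_def)
      then have "e = 2 * s\<^sup>2 + 2 * (s\<^sup>2 * vol)" using v by (simp add: field_simps)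
      moreover have "0 \<le> s\<^sup>2 * vol" using v by simp
      ultimately show "s\<^sup>2 * vol < e" using \<open>0 < e\<close> zero_le_power2[of s] by linarith
    qed
    have "uniformly_continuous_on (cball 0 (R + 4)) g"
      by (intro compact_uniformly_continuous continuous_on_subset[OF g]) auto
    then obtain d where d: "0 < d" "\<And>z w. z \<in> cball 0 (R + 4) \<Longrightarrow> w \<in> cball 0 (R + 4) \<Longrightarrow> dist w z < d
        \<Longrightarrow> dist (g w) (g z) < s"
      using s(1) unfolding uniformly_continuous_on_def by metis
    have "\<forall>\<^sub>F n in sequentially. 2 / real (Suc n) < d"
      using order_tendstoD(2)[OF tendsto_mult_right_zero[OF LIMSEQ_inverse_real_of_nat, of 2] d(1)]
      by (simp add: divide_inverse)
    then show "\<forall>\<^sub>F n in sequentially. dist (mass (\<lambda>x. moll n g x - g x)) 0 < e"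
    proof eventually_elim
      case (elim n)
      have n2: "2 / real (Suc n) \<le> 2" by (simp add: divide_le_eq)
      have bd: "(norm (moll n g x - g x))\<^sup>2 \<le> s\<^sup>2 * indicator B x" for x
      proof (cases "x \<in> B")
        case True
        have "norm (moll n g x - g x) \<le> s"
        proof (rule moll_local_bound[OF gL])
          fix y assume y: "norm (x - y) < 2 / real (Suc n)"
          then have "norm y \<le> norm x + 2" using n2 norm_triangle_ineq2[of y x] by (simp add: norm_minus_commute)
          then show "norm (g y - g x) \<le> s"
            using d(2)[of x y] True y elim by (simp add: B_def dist_norm norm_minus_commute)
        qed (use s in simp)
        then show ?thesis using True by (simp add: power_mono)
      next
        case False
        then have x: "R + 2 < norm x" by (simp add: B_def)
        \<comment> \<open>The averaging window has radius at most 2, so from outside radius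
          \<open>R + 2\<close> it only sees points where \<open>g\<close> vanishes.\<close>
        have "norm (moll n g x - 0) \<le> 0"
        proof (rule moll_local_bound[OF gL])
          fix y assume y: "norm (x - y) < 2 / real (Suc n)"
          then have "R \<le> norm y" using x n2 norm_triangle_ineq2[of x y] by linarith
          then show "norm (g y - 0) \<le> 0" using g0 by simp
        qed simp
        moreover have "g x = 0" using x g0 by simp
        ultimately show ?thesis using False by simp
      qed
      have m: "(\<lambda>x. moll n g x - g x) \<in> borel_measurable borel"
        using L2_measurable[OF L2_diff[OF moll_contraction(1)[OF gL] gL]] .
      have "mass (\<lambda>x. moll n g x - g x) \<le> (\<integral>x. s\<^sup>2 * indicator B x \<partial>lborel)"
        by (rule L2_bound(2)[OF m _ bd]) (simp add: Bi)
      also have "\<dots> < e" using s(2) Bi by (simp add: vol_def B_def)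
      finally show ?case using mass_nonneg[of "\<lambda>x. moll n g x - g x"] by simp
    qed
  qed
qed

text \<open>Density plus contraction: replacing \<open>f\<close> by a continuous \<open>g\<close>
  costs at most the mass of \<open>f - g\<close> both before and after mollification, uniformly in
  \<open>n\<close>.\<close>

theorem L2_conv_moll:
  assumes f: "f \<in> L2_space"
  shows "L2_conv (\<lambda>n. moll n f) f"
  unfolding L2_conv_def
proof (intro conjI allI moll_contraction f)
  show "(\<lambda>n. mass (\<lambda>x. moll n f x - f x)) \<longlonglongrightarrow> 0"
  proof (rule tendstoI)
    fix e :: real assume "0 < e"
    \<comment> \<open>\<open>mass_triangle3\<close> puts a factor 3 on three terms, so thresholds
      \<open>e / 12\<close> add up to \<open>3 / 4 * e\<close>.\<close>
    then obtain g R where g: "continuous_on UNIV g" "\<And>x. R \<le> norm x \<Longrightarrow> g x = 0" "g \<in> L2_space"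
      "mass (\<lambda>x. f x - g x) < e / 12" using L2_dense[OF f, of "e / 12"] by auto
    have "(\<lambda>n. mass (\<lambda>x. moll n g x - g x)) \<longlonglongrightarrow> 0"
      by (rule L2_conv_moll_continuous[OF g(1,2)])
    from order_tendstoD(2)[OF this, of "e / 12"] \<open>0 < e\<close>
    have "\<forall>\<^sub>F n in sequentially. mass (\<lambda>x. moll n g x - g x) < e / 12" by simp
    then show "\<forall>\<^sub>F n in sequentially. dist (mass (\<lambda>x. moll n f x - f x)) 0 < e"
    proof eventually_elim
      case (elim n)
      have "mass (\<lambda>x. moll n f x - moll n g x) \<le> mass (\<lambda>x. f x - g x)"
        using moll_contraction(2)[OF L2_diff[OF f g(3)], of n]
        by (simp add: moll_diff[OF f g(3), symmetric])
      moreover have "mass (\<lambda>x. g x - f x) = mass (\<lambda>x. f x - g x)"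
        by (simp add: mass_def norm_minus_commute)
      ultimately have "mass (\<lambda>x. moll n f x - f x) < e"
        using mass_triangle3[OF moll_contraction(1)[OF f] moll_contraction(1)[OF g(3)] g(3) f, of n n]
          elim g(4) \<open>0 < e\<close> by linarith
      then show ?case using mass_nonneg by (simp add: dist_real_def)
    qed
  qed
qed

lemma L2_mass_0: "f \<in> L2_space \<Longrightarrow> mass f = 0 \<Longrightarrow> AE x in lborel. f x = (0::complex)"
  using integral_nonneg_eq_0_iff_AE[of lborel "\<lambda>x. (norm (f x))\<^sup>2"] by (simp add: mass_def L2_D)

text \<open>The fundamental lemma of the calculus of variations: the kernels are test functions, so
  every mollification of \<open>f\<close> vanishes identically, and \<open>f\<close> is their mean
  square limit.\<close>

lemma L2_vanishing:
  assumes f: "f \<in> L2_space" and "\<And>\<phi>. \<phi> \<in> test_fun \<Longrightarrow> (\<integral>x. f x * \<phi> x \<partial>lborel) = 0"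
  shows "AE x in lborel. f x = 0"
proof -
  have "moll n f x = 0" for n x
    unfolding moll_def by (rule assms(2)[OF kern_test_fun])
  then have "(\<lambda>n. mass (\<lambda>x. - f x)) \<longlonglongrightarrow> 0" using L2_conv_moll[OF f] by (simp add: L2_conv_def)
  then have "mass f = 0" by (simp add: mass_def LIMSEQ_const_iff)
  with f show ?thesis by (rule L2_mass_0)
qed

text \<open>Multiplication by a coordinate does not commute with mollification, but the commutator
  has the kernel \<open>(x_j - y_j) * kern n (x - y)\<close>. On its support the first factor is at
  most \<open>2 / Suc n\<close>, so the commutator is dominated by \<open>2 / Suc n\<close> times
  the mollification of \<open>|f|\<close> and disappears in the limit.\<close>

lemma L2_conv_moll_weight:
  assumes f: "f \<in> L2_space" and xf: "(\<lambda>x. complex_of_real (x $ j) * f x) \<in> L2_space"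
  shows "L2_conv (\<lambda>n x. complex_of_real (x $ j) * moll n f x) (\<lambda>x. complex_of_real (x $ j) * f x)"
proof -
  let ?w = "\<lambda>x. complex_of_real (x $ j) * f x"
  let ?a = "\<lambda>x. complex_of_real (norm (f x))"
  let ?D = "\<lambda>n x. complex_of_real (x $ j) * moll n f x - moll n ?w x"
  have aL: "?a \<in> L2_space" by (rule L2_norm[OF f])
  have aint: "moll n ?a x = complex_of_real (\<integral>y. norm (f y) * kern n (x - y) \<partial>lborel)" for n x
    by (simp add: moll_def integral_complex_of_real[symmetric])
  have D: "(norm (?D n x))\<^sup>2 \<le> (2 / real (Suc n))\<^sup>2 * (norm (moll n ?a x))\<^sup>2" for n x
  proof -
    have "?D n x = (\<integral>y. complex_of_real (x $ j) * (f y * complex_of_real (kern n (x - y))) - ?w y * complex_of_real (kern n (x - y)) \<partial>lborel)"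
      by (simp add: moll_def moll_integrable[OF f] moll_integrable[OF xf])
    also have "norm \<dots> \<le> (\<integral>y. 2 / real (Suc n) * (norm (f y) * kern n (x - y)) \<partial>lborel)"
    proof (rule order_trans[OF integral_norm_bound integral_mono'])
      show "norm (complex_of_real (x $ j) * (f y * complex_of_real (kern n (x - y))) - ?w y * complex_of_real (kern n (x - y)))
          \<le> 2 / real (Suc n) * (norm (f y) * kern n (x - y))" for y
      proof (cases "norm (x - y) < 2 / real (Suc n)")
        case True
        have "complex_of_real (x $ j) * (f y * complex_of_real (kern n (x - y))) - ?w y * complex_of_real (kern n (x - y))
          = complex_of_real ((x - y) $ j) * (f y * complex_of_real (kern n (x - y)))"
          by (simp add: algebra_simps)
        moreover have "\<bar>(x - y) $ j\<bar> \<le> 2 / real (Suc n)"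
          using True component_le_norm_cart[of "x - y" j] by simp
        ultimately show ?thesis
          by (simp only: norm_mult norm_of_real)
            (intro mult_mono, auto simp: kern_nonneg)
      next
        case False
        then show ?thesis using kern_eq_0[of n "x - y"] by simp
      qed
      show "integrable lborel (\<lambda>y. 2 / real (Suc n) * (norm (f y) * kern n (x - y)))"
        using integrable_norm[OF moll_integrable[OF f, of n x]] by (simp add: norm_mult kern_nonneg)
    qed (simp add: kern_nonneg)
    also have "\<dots> = 2 / real (Suc n) * norm (moll n ?a x)"
      unfolding aint norm_of_real by (simp add: kern_nonneg)
    finally have "(norm (?D n x))\<^sup>2 \<le> (2 / real (Suc n) * norm (moll n ?a x))\<^sup>2"
      by (rule power_mono) simp
    then show ?thesis by (simp only: power_mult_distrib)
  qed
  have m1: "(\<lambda>x. complex_of_real (x $ j) * moll n f x) \<in> borel_measurable borel" for n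
  proof -
    note [measurable] = moll_measurable[OF f]
    show ?thesis by measurable
  qed
  note mw = moll_contraction(1)[OF xf]
  have DL: "?D n \<in> L2_space" "mass (?D n) \<le> (2 / real (Suc n))\<^sup>2 * mass f" for n
  proof -
    have "?D n \<in> borel_measurable borel"
      by (intro borel_measurable_diff m1 moll_measurable[OF xf])
    note L = L2_bound[OF this _ D]
    have i: "integrable lborel (\<lambda>x. (2 / real (Suc n))\<^sup>2 * (norm (moll n ?a x))\<^sup>2)"
      by (intro integrable_mult_right L2_D(2) moll_contraction aL)
    show "?D n \<in> L2_space" by (rule L(1)[OF i])
    have "mass (?D n) \<le> (2 / real (Suc n))\<^sup>2 * mass (moll n ?a)"
      using L(2)[OF i] by (simp only: mass_def integral_mult_right_zero)
    also have "\<dots> \<le> (2 / real (Suc n))\<^sup>2 * mass ?a"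
      by (intro mult_left_mono moll_contraction aL) simp
    also have "mass ?a = mass f" by (simp add: mass_def)
    finally show "mass (?D n) \<le> (2 / real (Suc n))\<^sup>2 * mass f" .
  qed
  have xm: "(\<lambda>x. complex_of_real (x $ j) * moll n f x) \<in> L2_space" for n
    using L2_add[OF DL(1) mw, of n n] by simp
  show ?thesis
    unfolding L2_conv_def
  proof (intro conjI allI xm xf)
    have "(\<lambda>n. 2 * ((2 / real (Suc n))\<^sup>2 * mass f) + 2 * mass (\<lambda>x. moll n ?w x - ?w x)) \<longlonglongrightarrow> 2 * (0\<^sup>2 * mass f) + 2 * 0"
      using L2_conv_moll[OF xf] tendsto_mult_right_zero[OF LIMSEQ_inverse_real_of_nat, of 2]
      by (intro tendsto_intros) (auto simp: L2_conv_def divide_inverse)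
    then have lim: "(\<lambda>n. 2 * ((2 / real (Suc n))\<^sup>2 * mass f) + 2 * mass (\<lambda>x. moll n ?w x - ?w x)) \<longlonglongrightarrow> 0"
      by simp
    have le: "mass (\<lambda>x. complex_of_real (x $ j) * moll n f x - ?w x)
        \<le> 2 * ((2 / real (Suc n))\<^sup>2 * mass f) + 2 * mass (\<lambda>x. moll n ?w x - ?w x)" for n
      using mass_add_le[OF DL(1) L2_diff[OF mw xf], of n n] DL(2)[of n] by simp
    show "(\<lambda>n. mass (\<lambda>x. complex_of_real (x $ j) * moll n f x - ?w x)) \<longlonglongrightarrow> 0"
      by (rule tendsto_sandwich[OF _ _ tendsto_const lim])
        (use le in \<open>auto simp: mass_nonneg intro: always_eventually\<close>)
  qed
qed

section \<open>Weak derivatives\<close>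

definition weak_partial :: "3 \<Rightarrow> (real^3 \<Rightarrow> complex) \<Rightarrow> (real^3 \<Rightarrow> complex) \<Rightarrow> bool" where
  "weak_partial j u p \<longleftrightarrow> u \<in> L2_space \<and> p \<in> L2_space \<and>
     (\<forall>\<phi>\<in>test_fun. (\<integral>x. p x * \<phi> x \<partial>lborel) = - (\<integral>x. u x * partial_deriv j \<phi> x \<partial>lborel))"

text \<open>The derivative of \<open>moll n u\<close> falls on the kernel as a function of
  \<open>x\<close>. As a function of \<open>y\<close> the kernel has the opposite derivative, which
  cancels the sign in the definition of a weak derivative.\<close>

lemma moll_weak_partial:
  assumes "\<And>j. weak_partial j u (p j)"
  shows "(moll n u has_derivative (\<lambda>h. \<Sum>j\<in>UNIV. h $ j *\<^sub>R moll n (p j) x)) (at x)"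
proof -
  have u: "u \<in> L2_space" using assms by (auto simp: weak_partial_def)
  have "moll n (p j) x = (\<integral>y. u y * complex_of_real (kern_deriv n j (x - y)) \<partial>lborel)" for j
  proof -
    have "((\<lambda>y. complex_of_real (kern n (x - y))) has_derivative
        (\<lambda>h. complex_of_real (\<Sum>j\<in>UNIV. (- h) $ j * kern_deriv n j (x - y)))) (at y)" for y
      by (intro has_derivative_of_real has_derivative_compose[OF _ has_derivative_kern])
        (auto intro!: derivative_eq_intros)
    from partial_derivI[OF this, of j]
    have "partial_deriv j (\<lambda>y. complex_of_real (kern n (x - y))) = (\<lambda>y. - complex_of_real (kern_deriv n j (x - y)))"
      by (auto simp: axis_def fun_eq_iff if_distrib if_distribR sum.If_cases cong: if_cong)
    then show ?thesis
      using assms[of j] kern_test_fun[of n x] unfolding weak_partial_def moll_def by fastforce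
  qed
  then show ?thesis using moll_has_derivative[OF u] by simp
qed

section \<open>Integration by parts\<close>

lemma translate_lborel:
  fixes f :: "'a::euclidean_space \<Rightarrow> 'b::{banach, second_countable_topology}"
  assumes "f \<in> borel_measurable borel"
  shows "integrable lborel (\<lambda>x. f (x + c)) \<longleftrightarrow> integrable lborel f"
    "(\<integral>x. f (x + c) \<partial>lborel) = (\<integral>x. f x \<partial>lborel)"
proof -
  note [measurable] = assms
  have "integrable lborel f \<longleftrightarrow> integrable (distr lborel borel ((+) c)) f"
    "(\<integral>x. f x \<partial>lborel) = (\<integral>x. f x \<partial>(distr lborel borel ((+) c)))"
    by (simp_all add: lborel_distr_plus)
  then show "integrable lborel (\<lambda>x. f (x + c)) \<longleftrightarrow> integrable lborel f"
    "(\<integral>x. f (x + c) \<partial>lborel) = (\<integral>x. f x \<partial>lborel)"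
    by (simp_all add: integrable_distr_eq integral_distr add.commute)
qed

text \<open>Continuous differentiability with the gradient carried as data. The total derivative is
  demanded, not merely the partial ones, so that a function can be differentiated along arbitrary
  curves.\<close>

definition has_grad :: "(real^3 \<Rightarrow> complex) \<Rightarrow> (3 \<Rightarrow> real^3 \<Rightarrow> complex) \<Rightarrow> bool" where
  "has_grad u p \<longleftrightarrow> (\<forall>x. (u has_derivative (\<lambda>h. \<Sum>j\<in>UNIV. h $ j *\<^sub>R p j x)) (at x)) \<and>
     (\<forall>j. continuous_on UNIV (p j))"

lemma has_grad_continuous: "has_grad u p \<Longrightarrow> continuous_on UNIV u"
  unfolding has_grad_def by (meson continuous_at_imp_continuous_on has_derivative_continuous)

lemma has_grad_measurable:
  assumes "has_grad u p"
  shows "u \<in> borel_measurable borel" "p j \<in> borel_measurable borel"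
  using has_grad_continuous[OF assms] assms
  by (auto simp: has_grad_def intro!: borel_measurable_continuous_onI)

lemma has_grad_moll:
  assumes "\<And>j. weak_partial j u (p j)"
  shows "has_grad (moll n u) (\<lambda>j. moll n (p j))"
  using moll_weak_partial[OF assms] assms unfolding has_grad_def
  by (auto simp: weak_partial_def intro: continuous_moll)

lemma has_grad_mult:
  assumes "has_grad u p" "has_grad v q"
  shows "has_grad (\<lambda>x. u x * v x) (\<lambda>j x. u x * q j x + p j x * v x)"
  unfolding has_grad_def
proof (intro conjI allI)
  fix x
  have "((\<lambda>x. u x * v x) has_derivative (\<lambda>h. u x * (\<Sum>j\<in>UNIV. h $ j *\<^sub>R q j x) + (\<Sum>j\<in>UNIV. h $ j *\<^sub>R p j x) * v x)) (at x)"
    using assms by (intro has_derivative_mult) (auto simp: has_grad_def)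
  then show "((\<lambda>x. u x * v x) has_derivative (\<lambda>h. \<Sum>j\<in>UNIV. h $ j *\<^sub>R (u x * q j x + p j x * v x))) (at x)"
    by (rule has_derivative_eq_rhs)
      (auto simp: sum_distrib_left sum_distrib_right sum.distrib algebra_simps scaleR_conv_of_real)
next
  fix j show "continuous_on UNIV (\<lambda>x. u x * q j x + p j x * v x)"
    using assms has_grad_continuous[OF assms(1)] has_grad_continuous[OF assms(2)]
    by (intro continuous_intros) (auto simp: has_grad_def)
qed

lemma has_grad_cnj:
  assumes "has_grad u p"
  shows "has_grad (\<lambda>x. cnj (u x)) (\<lambda>j x. cnj (p j x))"
  unfolding has_grad_def
proof (intro conjI allI)
  fix x
  have "((\<lambda>x. cnj (u x)) has_derivative (\<lambda>h. cnj (\<Sum>j\<in>UNIV. h $ j *\<^sub>R p j x))) (at x)"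
    using assms by (intro has_derivative_cnj) (auto simp: has_grad_def)
  then show "((\<lambda>x. cnj (u x)) has_derivative (\<lambda>h. \<Sum>j\<in>UNIV. h $ j *\<^sub>R cnj (p j x))) (at x)"
    by (simp add: scaleR_conv_of_real)
next
  fix j show "continuous_on UNIV (\<lambda>x. cnj (p j x))"
    using assms by (intro continuous_intros) (auto simp: has_grad_def)
qed

lemma has_grad_coord:
  "has_grad (\<lambda>x. complex_of_real (x $ k)) (\<lambda>j x. if j = k then 1 else 0)"
  unfolding has_grad_def
proof (intro conjI allI)
  fix x :: "real^3"
  have "((\<lambda>x::real^3. complex_of_real (x $ k)) has_derivative (\<lambda>h. complex_of_real (h $ k))) (at x)"
    by (intro has_derivative_of_real bounded_linear_imp_has_derivative bounded_linear_vec_nth)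
  then show "((\<lambda>x::real^3. complex_of_real (x $ k)) has_derivative (\<lambda>h. \<Sum>j\<in>UNIV. h $ j *\<^sub>R (if j = k then 1 else 0))) (at x)"
    by (simp add: if_distrib cong: if_cong) (simp add: scaleR_conv_of_real)
qed auto

text \<open>No decay at infinity enters: the unit difference \<open>u (x + e) - u x\<close> is the
  integral of \<open>p j\<close> along a segment. Integrated over \<open>x\<close>, it gives zero by
  translation invariance, while the segment integrals give the integral of \<open>p j\<close> by
  Fubini.\<close>

lemma integral_grad_zero:
  assumes g: "has_grad u p" and iu: "integrable lborel u" and ip: "integrable lborel (p j)"
  shows "(\<integral>x. p j x \<partial>lborel) = 0"
proof -
  let ?e = "axis j (1::real) :: real^3"
  have D: "(u has_derivative (\<lambda>h. \<Sum>j\<in>UNIV. h $ j *\<^sub>R p j x)) (at x)" for x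
    using g by (simp add: has_grad_def)
  have cp: "continuous_on UNIV (p j)" using g by (simp add: has_grad_def)
  note [measurable] = has_grad_measurable[OF g]
  have vd: "((\<lambda>t. u (x + t *\<^sub>R ?e)) has_vector_derivative p j (x + t *\<^sub>R ?e)) (at t within S)" for x t S
  proof -
    have "((\<lambda>t. u (x + t *\<^sub>R ?e)) has_derivative (\<lambda>s. \<Sum>i\<in>UNIV. (s *\<^sub>R ?e) $ i *\<^sub>R p i (x + t *\<^sub>R ?e))) (at t within S)"
      by (rule has_derivative_compose[OF _ D]) (auto intro!: derivative_eq_intros)
    also have "(\<lambda>s. \<Sum>i\<in>UNIV. (s *\<^sub>R ?e) $ i *\<^sub>R p i (x + t *\<^sub>R ?e)) = (\<lambda>s. s *\<^sub>R p j (x + t *\<^sub>R ?e))"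
      by (auto simp: axis_def if_distrib if_distribR sum.If_cases cong: if_cong)
    finally show ?thesis by (simp add: has_vector_derivative_def)
  qed
  let ?f = "\<lambda>t x. indicator {0..1::real} t *\<^sub>R p j (x + t *\<^sub>R ?e)"
  have ftc: "u (x + ?e) - u x = (\<integral>t. ?f t x \<partial>lborel)" for x
  proof -
    have "continuous_on {0..1} (\<lambda>t::real. p j (x + t *\<^sub>R ?e))"
      by (intro continuous_on_compose2[OF cp _ subset_UNIV] continuous_intros)
    from integral_FTC_Icc[OF zero_le_one vd this] show ?thesis by simp
  qed
  have tr: "integrable lborel (\<lambda>x. p j (x + c))" "(\<integral>x. p j (x + c) \<partial>lborel) = (\<integral>x. p j x \<partial>lborel)"
    "(\<integral>x. norm (p j (x + c)) \<partial>lborel) = (\<integral>x. norm (p j x) \<partial>lborel)" for c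
    using translate_lborel[of "p j" c] translate_lborel[of "\<lambda>x. norm (p j x)" c] ip by simp_all
  have i01: "integrable lborel (indicator {0..1::real} :: real \<Rightarrow> real)" by simp
  have "integrable (lborel \<Otimes>\<^sub>M lborel) (\<lambda>(t, x). ?f t x)"
  proof (rule lborel_pair.Fubini_integrable)
    have [measurable]: "(\<lambda>z::real \<times> (real^3). p j (snd z + fst z *\<^sub>R ?e)) \<in> borel_measurable borel"
      by (intro borel_measurable_continuous_onI continuous_on_compose2[OF cp _ subset_UNIV] continuous_intros)
    have [measurable]: "(\<lambda>z::real \<times> (real^3). indicator {0..1::real} (fst z) :: real) \<in> borel_measurable borel"
      by (rule measurable_compose[of fst borel borel])
        (auto intro!: borel_measurable_continuous_onI continuous_intros)
    show "(\<lambda>(t, x). ?f t x) \<in> borel_measurable (lborel \<Otimes>\<^sub>M lborel)"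
      unfolding lborel_prod split_beta' measurable_lborel2 by measurable
    have "(\<integral>x. norm (?f t x) \<partial>lborel) = indicator {0..1} t * (\<integral>x. norm (p j x) \<partial>lborel)" for t
      using tr(3)[of "t *\<^sub>R ?e"] by simp
    then show "integrable lborel (\<lambda>t. \<integral>x. norm (case (t, x) of (t, x) \<Rightarrow> ?f t x) \<partial>lborel)"
      unfolding prod.case by (simp only: integrable_mult_left[OF i01])
    show "AE t in lborel. integrable lborel (\<lambda>x. case (t, x) of (t, x) \<Rightarrow> ?f t x)"
      using tr(1) by simp
  qed
  from lborel_pair.Fubini_integral[OF this]
  have "(\<integral>x. \<integral>t. ?f t x \<partial>lborel \<partial>lborel) = (\<integral>t. \<integral>x. ?f t x \<partial>lborel \<partial>lborel)" by simp
  also have "\<dots> = (\<integral>t. indicator {0..1::real} t *\<^sub>R (\<integral>x. p j x \<partial>lborel) \<partial>lborel)"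
    using tr(2) by simp
  also have "\<dots> = (\<integral>x. p j x \<partial>lborel)" by simp
  finally have "(\<integral>x. p j x \<partial>lborel) = (\<integral>x. u (x + ?e) - u x \<partial>lborel)" by (simp add: ftc)
  also have "\<dots> = 0"
    using translate_lborel[of u ?e] iu by simp
  finally show ?thesis .
qed

text \<open>Mollifying \<open>u\<close> is enough, since \<open>h\<close> is \<open>C^1\<close>: the
  product rule and \<open>integral_grad_zero\<close> give the identity for \<open>moll n u\<close>,
  and both sides pass to the limit as pairings.\<close>

lemma integration_by_parts:
  assumes u: "\<And>j. weak_partial j u (p j)" and h: "has_grad h q" "h \<in> L2_space" "q j \<in> L2_space"
  shows "(\<integral>x. p j x * h x \<partial>lborel) = - (\<integral>x. u x * q j x \<partial>lborel)"
proof -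
  have uL: "u \<in> L2_space" and pL: "p j \<in> L2_space" for j using u by (auto simp: weak_partial_def)
  have z: "(\<integral>x. moll n u x * q j x \<partial>lborel) + (\<integral>x. moll n (p j) x * h x \<partial>lborel) = 0" for n
    using integral_grad_zero[OF has_grad_mult[OF has_grad_moll[OF u] h(1)], of n j]
      L2_integrable_mult[OF moll_contraction(1)[OF uL, of n] h(2)]
      L2_integrable_mult[OF moll_contraction(1)[OF uL, of n] h(3)]
      L2_integrable_mult[OF moll_contraction(1)[OF pL[of j], of n] h(2)]
    by simp
  have "(\<lambda>n. (\<integral>x. moll n u x * q j x \<partial>lborel) + (\<integral>x. moll n (p j) x * h x \<partial>lborel)) \<longlonglongrightarrow>
      (\<integral>x. u x * q j x \<partial>lborel) + (\<integral>x. p j x * h x \<partial>lborel)"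
    by (intro tendsto_add L2_conv_pairing L2_conv_moll uL pL h)
  then have "(\<integral>x. u x * q j x \<partial>lborel) + (\<integral>x. p j x * h x \<partial>lborel) = 0"
    unfolding z by (simp add: LIMSEQ_const_iff)
  then show ?thesis by (simp add: add_eq_0_iff)
qed

lemma test_fun_grad:
  assumes "\<phi> \<in> test_fun"
  shows "has_grad \<phi> (\<lambda>j. partial_deriv j \<phi>)" "\<phi> \<in> L2_space" "partial_deriv j \<phi> \<in> L2_space"
proof -
  have C: "C_diff k \<phi>" for k using assms by (simp add: test_fun_def)
  have D: "(\<phi> has_derivative frechet_derivative \<phi> (at x)) (at x)" for x
    using C[of 1] by (simp add: frechet_derivative_works)
  have c: "continuous_on UNIV (partial_deriv j \<phi>)" for j
    using C[of 2] by (auto simp: numeral_2_eq_2 intro!: continuous_at_imp_continuous_on differentiable_imp_continuous_within)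
  have "frechet_derivative \<phi> (at x) h = (\<Sum>j\<in>UNIV. h $ j *\<^sub>R partial_deriv j \<phi> x)" for x h
  proof -
    interpret linear "frechet_derivative \<phi> (at x)"
      by (rule has_derivative_linear[OF D])
    have "h = (\<Sum>j\<in>UNIV. h $ j *\<^sub>R axis j 1)"
      by (simp add: vec_eq_iff axis_def if_distrib cong: if_cong)
    then have "frechet_derivative \<phi> (at x) h = frechet_derivative \<phi> (at x) (\<Sum>j\<in>UNIV. h $ j *\<^sub>R axis j 1)"
      by simp
    also have "\<dots> = (\<Sum>j\<in>UNIV. h $ j *\<^sub>R partial_deriv j \<phi> x)"
      by (simp add: sum scale partial_deriv_def)
    finally show ?thesis .
  qed
  then have "(\<phi> has_derivative (\<lambda>h. \<Sum>j\<in>UNIV. h $ j *\<^sub>R partial_deriv j \<phi> x)) (at x)" for x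
    using D[of x] by presburger
  with c show g: "has_grad \<phi> (\<lambda>j. partial_deriv j \<phi>)" by (simp add: has_grad_def)
  obtain R where R: "\<And>x. x \<in> closure {x. \<phi> x \<noteq> 0} \<Longrightarrow> norm x \<le> R"
  proof -
    have "compact (closure {x. \<phi> x \<noteq> 0})" using assms by (simp add: test_fun_def)
    then have "bounded (closure {x. \<phi> x \<noteq> 0})" by (rule compact_imp_bounded)
    then show ?thesis using that unfolding bounded_iff by blast
  qed
  have 0: "x \<notin> closure {x. \<phi> x \<noteq> 0}" if "R + 1 \<le> norm x" for x
    using R[of x] that by linarith
  have phi0: "\<phi> x = 0" if "x \<notin> closure {x. \<phi> x \<noteq> 0}" for x
    using that closure_subset[of "{x. \<phi> x \<noteq> 0}"] by auto
  show "\<phi> \<in> L2_space"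
    by (rule L2_cpt_supp[OF has_grad_continuous[OF g], of "R + 1"]) (use 0 phi0 in blast)
  have "partial_deriv j \<phi> x = 0" if "x \<notin> closure {x. \<phi> x \<noteq> 0}" for x
  proof -
    have "((\<lambda>_. 0) has_derivative (\<lambda>_. 0)) (at x)" by simp
    then have "(\<phi> has_derivative (\<lambda>_. 0)) (at x)"
    proof (rule has_derivative_transform_within_open)
      show "open (- closure {x. \<phi> x \<noteq> 0})" by (rule open_Compl[OF closed_closure])
      show "x \<in> - closure {x. \<phi> x \<noteq> 0}" unfolding Compl_iff by (rule that)
      show "0 = \<phi> y" if "y \<in> - closure {x. \<phi> x \<noteq> 0}" for y
        using phi0[OF ComplD[OF that]] by (rule sym)
    qed
    then show ?thesis by (rule partial_derivI)
  qed
  then show "partial_deriv j \<phi> \<in> L2_space"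
    by (intro L2_cpt_supp[OF c, of "R + 1"]) (use 0 in blast)
qed

lemma weak_partial_has_grad:
  assumes h: "has_grad h q" "h \<in> L2_space" "q j \<in> L2_space"
  shows "weak_partial j h (q j)"
  unfolding weak_partial_def
proof (intro conjI h ballI)
  fix \<phi> assume "\<phi> \<in> test_fun"
  note t = test_fun_grad[OF this]
  have "(\<integral>x. h x * partial_deriv j \<phi> x + q j x * \<phi> x \<partial>lborel) = 0"
    by (rule integral_grad_zero[OF has_grad_mult[OF h(1) t(1)], of j])
      (intro L2_integrable_mult Bochner_Integration.integrable_add h t)+
  then show "(\<integral>x. q j x * \<phi> x \<partial>lborel) = - (\<integral>x. h x * partial_deriv j \<phi> x \<partial>lborel)"
    using L2_integrable_mult[OF h(2) t(3)[of j]] L2_integrable_mult[OF h(3) t(2)]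
    by (simp add: add_eq_0_iff)
qed

section \<open>The Gaussian\<close>

lemma norm_vec3_sq: "(norm (x :: real^3))\<^sup>2 = (\<Sum>j\<in>UNIV. (x $ j)\<^sup>2)"
  by (simp add: norm_vec_def L2_set_def sum_nonneg)

lemma has_grad_gauss: "has_grad gauss (\<lambda>j x. - (complex_of_real (x $ j) * gauss x))"
proof -
  have "(gauss has_derivative (\<lambda>h. complex_of_real (exp (- (x \<bullet> x) / 2) * (- (x \<bullet> h))))) (at x)" for x
    unfolding gauss_def power2_norm_eq_inner
    by (intro has_derivative_of_real)
      (auto intro!: derivative_eq_intros simp: inner_commute algebra_simps)
  also have "(\<lambda>h. complex_of_real (exp (- (x \<bullet> x) / 2) * (- (x \<bullet> h)))) =
      (\<lambda>h. \<Sum>j\<in>UNIV. h $ j *\<^sub>R (- (complex_of_real (x $ j) * gauss x)))" for x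
    by (auto simp: gauss_def power2_norm_eq_inner inner_vec_def sum_negf sum_distrib_left
        scaleR_conv_of_real fun_eq_iff intro!: sum.cong)
  finally have D: "(gauss has_derivative (\<lambda>h. \<Sum>j\<in>UNIV. h $ j *\<^sub>R (- (complex_of_real (x $ j) * gauss x)))) (at x)" for x .
  then have "continuous_on UNIV gauss"
    by (meson continuous_at_imp_continuous_on has_derivative_continuous)
  with D show ?thesis unfolding has_grad_def by (auto intro!: continuous_intros)
qed

lemma gauss_integral:
  shows gauss_sq_integrable: "integrable lborel (\<lambda>x::real^3. exp (- (norm x)\<^sup>2))"
    and gauss_sq_integral: "(\<integral>x. exp (- (norm x)\<^sup>2) \<partial>(lborel :: (real^3) measure)) = pi powr (3/2)"
proof -
  have h: "has_bochner_integral lborel (\<lambda>t::real. exp (- t\<^sup>2)) (sqrt pi)"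
    using has_bochner_integral_even_function[OF gaussian_moment_0] by simp
  then have 1: "(\<integral>\<^sup>+t. ennreal (exp (- t\<^sup>2)) \<partial>(lborel :: (real) measure)) = ennreal (sqrt pi)"
    by (subst nn_integral_eq_integral) (auto simp: has_bochner_integral_iff)
  have e: "(\<Prod>b\<in>Basis. ennreal (exp (- (x \<bullet> b)\<^sup>2))) = ennreal (exp (- (norm x)\<^sup>2))" for x :: "real^3"
    unfolding power2_norm_eq_inner euclidean_inner[of x x]
    by (simp add: prod_ennreal exp_sum[symmetric] sum_negf power2_eq_square)
  have 2: "(\<integral>\<^sup>+x. ennreal (exp (- (norm x)\<^sup>2)) \<partial>(lborel :: (real^3) measure)) = ennreal (sqrt pi ^ 3)"
    using nn_integral_lborel_prod[of "\<lambda>(b::real^3) t. ennreal (exp (- t\<^sup>2))"]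
    by (simp add: e 1 ennreal_power)
  have 3: "sqrt pi ^ 3 = pi powr (3/2)"
    by (simp add: powr_half_sqrt[symmetric] powr_powr flip: powr_realpow)
  show "integrable lborel (\<lambda>x::real^3. exp (- (norm x)\<^sup>2))"
    using 2 by (auto simp: integrable_iff_bounded)
  then show "(\<integral>x. exp (- (norm x)\<^sup>2) \<partial>(lborel :: (real^3) measure)) = pi powr (3/2)"
    using 2 by (simp add: nn_integral_eq_integral 3)
qed

text \<open>A majorant for polynomially weighted Gaussians; the one-dimensional factor is the
  standard normal density up to a constant.\<close>

lemma half_gauss_integrable: "integrable lborel (\<lambda>x::real^3. exp (- (norm x)\<^sup>2 / 2))"
proof -
  have "integrable lborel (\<lambda>t::real. sqrt (2 * pi) * std_normal_density t)"
    by (intro integrable_mult_right) auto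
  then have "integrable lborel (\<lambda>t::real. exp (- t\<^sup>2 / 2))"
    by (simp add: std_normal_density_def)
  then have 1: "(\<integral>\<^sup>+t. ennreal (exp (- t\<^sup>2 / 2)) \<partial>(lborel :: (real) measure)) < \<infinity>"
    by (simp add: integrable_iff_bounded)
  have e: "(\<Prod>b\<in>Basis. ennreal (exp (- (x \<bullet> b)\<^sup>2 / 2))) = ennreal (exp (- (norm x)\<^sup>2 / 2))" for x :: "real^3"
    unfolding power2_norm_eq_inner euclidean_inner[of x x]
    by (simp add: prod_ennreal exp_sum[symmetric] sum_negf power2_eq_square sum_divide_distrib)
  have "(\<integral>\<^sup>+x. ennreal (exp (- (norm x)\<^sup>2 / 2)) \<partial>(lborel :: (real^3) measure)) = (\<integral>\<^sup>+t. ennreal (exp (- t\<^sup>2 / 2)) \<partial>(lborel :: (real) measure)) ^ 3"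
    unfolding e[symmetric] by (subst nn_integral_lborel_prod) auto
  also have "\<dots> < \<infinity>" using 1 by (simp add: power_less_top_ennreal)
  finally show ?thesis by (simp add: integrable_iff_bounded)
qed

lemma gauss_norm: "norm (gauss x) = exp (- (norm x)\<^sup>2 / 2)" "(norm (gauss x))\<^sup>2 = exp (- (norm x)\<^sup>2)"
  by (auto simp: gauss_def exp_double[symmetric])

lemma gauss_measurable [measurable]: "gauss \<in> borel_measurable borel"
  by (rule has_grad_measurable(1)[OF has_grad_gauss])

lemma gauss_L2: "gauss \<in> L2_space"
  and mass_gauss: "mass gauss = pi powr (3/2)"
  using gauss_integral by (auto simp: L2_space_def mass_def gauss_norm(2))

text \<open>The square of a quadratic factor is absorbed by half of the Gaussian exponent, through
  \<open>s \<le> 4 * exp (s / 4)\<close>; what remains is the integrable majorant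
  \<open>exp (- |x|^2 / 2)\<close>.\<close>

lemma gauss_poly_L2:
  assumes [measurable]: "f \<in> borel_measurable borel" and "\<And>x. norm (f x) \<le> 1 + (norm x)\<^sup>2"
  shows "(\<lambda>x. f x * gauss x) \<in> L2_space"
proof (rule L2_bound(1))
  show "integrable lborel (\<lambda>x::real^3. 16 * exp (1 / 2) * exp (- (norm x)\<^sup>2 / 2))"
    by (intro integrable_mult_right half_gauss_integrable)
  fix x :: "real^3"
  define s where "s = 1 + (norm x)\<^sup>2"
  have "s \<le> 4 * exp (s / 4)" using exp_ge_add_one_self[of "s / 4"] by linarith
  then have "s\<^sup>2 \<le> (4 * exp (s / 4))\<^sup>2" by (intro power_mono) (auto simp: s_def)
  also have "\<dots> = 16 * exp (s / 2)" by (simp add: power_mult_distrib exp_double[symmetric])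
  finally have s: "s\<^sup>2 \<le> 16 * exp (s / 2)" .
  have "(norm (f x * gauss x))\<^sup>2 = (norm (f x))\<^sup>2 * exp (- (norm x)\<^sup>2)"
    by (simp only: norm_mult power_mult_distrib gauss_norm(2))
  also have "\<dots> \<le> s\<^sup>2 * exp (- (norm x)\<^sup>2)"
    using assms(2)[of x] by (intro mult_right_mono power_mono) (auto simp: s_def)
  also have "\<dots> \<le> 16 * exp (s / 2) * exp (- (norm x)\<^sup>2)"
    using s by (intro mult_right_mono) auto
  also have "\<dots> = 16 * exp (1 / 2) * exp (- (norm x)\<^sup>2 / 2)"
    by (simp add: s_def mult_exp_exp mult.assoc add_divide_distrib)
  finally show "(norm (f x * gauss x))\<^sup>2 \<le> 16 * exp (1 / 2) * exp (- (norm x)\<^sup>2 / 2)" .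
qed measurable

lemma coord_measurable [measurable]: "(\<lambda>x::real^3. x $ j) \<in> borel_measurable borel"
  by (intro borel_measurable_continuous_onI continuous_intros)

lemma coord_gauss_L2:
  shows "(\<lambda>x. complex_of_real (x $ j) * gauss x) \<in> L2_space"
    "(\<lambda>x. complex_of_real (x $ j) * (complex_of_real (x $ k) * gauss x)) \<in> L2_space"
proof -
  have a: "a \<le> 1 + a\<^sup>2" for a :: real
  proof (cases "a \<le> 0")
    case False
    then show ?thesis using sum_squares_bound[of a 1] by simp
  next
    case True
    then show ?thesis using zero_le_power2[of a] by linarith
  qed
  show "(\<lambda>x. complex_of_real (x $ j) * gauss x) \<in> L2_space"
  proof (rule gauss_poly_L2)
    fix x :: "real^3"
    show "norm (complex_of_real (x $ j)) \<le> 1 + (norm x)\<^sup>2"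
      using component_le_norm_cart[of x j] a[of "norm x"] by simp
  qed measurable
  have "(\<lambda>x. (complex_of_real (x $ j) * complex_of_real (x $ k)) * gauss x) \<in> L2_space"
  proof (rule gauss_poly_L2)
    fix x :: "real^3"
    have "\<bar>x $ j\<bar> * \<bar>x $ k\<bar> \<le> norm x * norm x"
      by (intro mult_mono component_le_norm_cart) auto
    then show "norm (complex_of_real (x $ j) * complex_of_real (x $ k)) \<le> 1 + (norm x)\<^sup>2"
      by (simp add: norm_mult power2_eq_square)
  qed measurable
  then show "(\<lambda>x. complex_of_real (x $ j) * (complex_of_real (x $ k) * gauss x)) \<in> L2_space"
    by (simp add: mult.assoc)
qed

lemma has_grad_coord_gauss:
  "has_grad (\<lambda>x. complex_of_real (x $ k) * gauss x)
     (\<lambda>j x. (if j = k then gauss x else 0) - complex_of_real (x $ k) * (complex_of_real (x $ j) * gauss x))"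
  using has_grad_mult[OF has_grad_coord[of k] has_grad_gauss]
  by (rule back_subst[of "has_grad _"]) (auto simp: fun_eq_iff)

lemma coord_gauss_deriv_L2:
  "(\<lambda>x. (if j = k then gauss x else 0) - complex_of_real (x $ k) * (complex_of_real (x $ j) * gauss x)) \<in> L2_space"
  using gauss_L2 by (intro L2_diff coord_gauss_L2) (cases "j = k", auto simp: L2_space_def)

lemma gauss_weak_partial: "weak_partial j gauss (\<lambda>x. - (complex_of_real (x $ j) * gauss x))"
  by (rule weak_partial_has_grad[OF has_grad_gauss gauss_L2]) (intro L2_uminus coord_gauss_L2)

text \<open>Let \<open>m\<close> be the mass in question and \<open>G\<close> that of
  \<open>gauss\<close>. The \<open>j\<close>-th derivative of \<open>gauss\<close> is
  \<open>- x_j * gauss\<close>, so integrating it by parts against \<open>x_j * gauss\<close> gives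
  \<open>- m = - (G - m)\<close>, that is \<open>2 * m = G\<close>.\<close>

lemma mass_coord_gauss: "mass (\<lambda>x. complex_of_real (x $ j) * gauss x) = pi powr (3/2) / 2"
proof -
  have "(\<integral>x. - (complex_of_real (x $ j) * gauss x) * (complex_of_real (x $ j) * gauss x) \<partial>lborel) =
     - (\<integral>x. gauss x * ((if j = j then gauss x else 0) - complex_of_real (x $ j) * (complex_of_real (x $ j) * gauss x)) \<partial>lborel)"
    by (rule integration_by_parts[OF gauss_weak_partial has_grad_coord_gauss coord_gauss_L2(1) coord_gauss_deriv_L2])
  moreover have "- (complex_of_real (x $ j) * gauss x) * (complex_of_real (x $ j) * gauss x) =
      - complex_of_real ((norm (complex_of_real (x $ j) * gauss x))\<^sup>2)"
    "gauss x * ((if j = j then gauss x else 0) - complex_of_real (x $ j) * (complex_of_real (x $ j) * gauss x)) =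
      complex_of_real ((norm (gauss x))\<^sup>2) - complex_of_real ((norm (complex_of_real (x $ j) * gauss x))\<^sup>2)" for x
  proof -
    have sq: "complex_of_real s * complex_of_real s = complex_of_real ((norm (complex_of_real s))\<^sup>2)" for s
      by (simp add: power2_eq_square)
    let ?c = "complex_of_real (x $ j)"
    have 1: "gauss x * gauss x = complex_of_real ((norm (gauss x))\<^sup>2)"
      unfolding gauss_def by (rule sq)
    have 2: "(?c * gauss x) * (?c * gauss x) = complex_of_real ((norm (?c * gauss x))\<^sup>2)"
      using sq[of "x $ j * exp (- (norm x)\<^sup>2 / 2)"] by (simp only: gauss_def of_real_mult)
    show "- (?c * gauss x) * (?c * gauss x) = - complex_of_real ((norm (?c * gauss x))\<^sup>2)"
      unfolding 2[symmetric] by simp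
    have "gauss x * ((if j = j then gauss x else 0) - ?c * (?c * gauss x)) = gauss x * gauss x - (?c * gauss x) * (?c * gauss x)"
      by (simp add: algebra_simps)
    then show "gauss x * ((if j = j then gauss x else 0) - ?c * (?c * gauss x)) =
      complex_of_real ((norm (gauss x))\<^sup>2) - complex_of_real ((norm (?c * gauss x))\<^sup>2)"
      unfolding 1 2 .
  qed
  ultimately have "(\<integral>x. - complex_of_real ((norm (complex_of_real (x $ j) * gauss x))\<^sup>2) \<partial>lborel) =
    - (\<integral>x. complex_of_real ((norm (gauss x))\<^sup>2) - complex_of_real ((norm (complex_of_real (x $ j) * gauss x))\<^sup>2) \<partial>lborel)"
    by (simp only:)
  then have "(\<integral>x. - ((norm (complex_of_real (x $ j) * gauss x))\<^sup>2) \<partial>lborel) =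
    - (\<integral>x. (norm (gauss x))\<^sup>2 - (norm (complex_of_real (x $ j) * gauss x))\<^sup>2 \<partial>lborel)"
    unfolding of_real_diff[symmetric] of_real_minus[symmetric] integral_complex_of_real of_real_eq_iff .
  then have "2 * mass (\<lambda>x. complex_of_real (x $ j) * gauss x) = mass gauss"
    using L2_D(2)[OF gauss_L2] L2_D(2)[OF coord_gauss_L2(1)[of j]]
    by (simp add: mass_def)
  then show ?thesis by (simp add: mass_gauss)
qed

section \<open>A Gagliardo--Nirenberg type inequality\<close>

text \<open>A point of the plane and a height, because the quartic estimate slices space by the
  planes \<open>x $ 3 = c\<close> and treats the third direction separately.\<close>

definition of_coords :: "(real \<times> real) \<Rightarrow> real \<Rightarrow> real^3" where
  "of_coords z c = fst z *\<^sub>R axis 1 1 + snd z *\<^sub>R axis 2 1 + c *\<^sub>R axis 3 1"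

lemma of_coords_nth [simp]:
  "of_coords z c $ 1 = fst z" "of_coords z c $ 2 = snd z" "of_coords z c $ 3 = c"
  by (simp_all add: of_coords_def axis_def)

lemma continuous_of_coords [continuous_intros]:
  "continuous_on S f \<Longrightarrow> continuous_on S g \<Longrightarrow> continuous_on S (\<lambda>x. of_coords (f x) (g x))"
  unfolding of_coords_def by (intro continuous_intros)

lemma of_coords_measurable:
  "(\<lambda>z. of_coords (snd z) (fst z)) \<in> borel_measurable borel"
  by (intro borel_measurable_continuous_onI continuous_intros)

text \<open>Lebesgue measure is determined by its values on boxes, and the preimage of a box is a
  product of intervals.\<close>

lemma lborel_of_coords: "distr lborel borel (\<lambda>z. of_coords (snd z) (fst z)) = lborel"
proof (rule lborel_eqI[symmetric])
  note [measurable] = of_coords_measurable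
  fix l u :: "real^3" assume le: "\<And>b. b \<in> Basis \<Longrightarrow> l \<bullet> b \<le> u \<bullet> b"
  have lu: "l $ j \<le> u $ j" for j
    using le[of "axis j 1"] by (simp add: inner_axis)
  have "(\<lambda>z. of_coords (snd z) (fst z)) -` box l u =
      {l $ 3<..<u $ 3} \<times> ({l $ 1<..<u $ 1} \<times> {l $ 2<..<u $ 2})"
    by (auto simp: mem_box_cart forall_3)
  then have "emeasure (distr lborel borel (\<lambda>z. of_coords (snd z) (fst z))) (box l u) =
      emeasure (lborel \<Otimes>\<^sub>M (lborel \<Otimes>\<^sub>M lborel)) ({l $ 3<..<u $ 3} \<times> ({l $ 1<..<u $ 1} \<times> {l $ 2<..<u $ 2}))"
    by (subst emeasure_distr) (auto simp: lborel_prod)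
  also have "\<dots> = ennreal ((u $ 3 - l $ 3) * ((u $ 1 - l $ 1) * (u $ 2 - l $ 2)))"
    using lu by (subst lborel_prod, subst lborel.emeasure_pair_measure_Times)
      (auto simp: lborel.emeasure_pair_measure_Times lborel_prod[symmetric] ennreal_mult borel_prod[symmetric])
  also have "(u $ 3 - l $ 3) * ((u $ 1 - l $ 1) * (u $ 2 - l $ 2)) = (\<Prod>j\<in>UNIV. (u - l) $ j)"
    unfolding UNIV_3 by simp
  also have "\<dots> = (\<Prod>b\<in>Basis. (u - l) \<bullet> b)"
  proof -
    have B: "(Basis :: (real^3) set) = range (\<lambda>j. axis j 1)" by (auto simp: Basis_vec_def)
    have inj: "inj (\<lambda>j::3. axis j (1::real))" by (auto simp: inj_on_def axis_eq_axis)
    show ?thesis unfolding B prod.reindex[OF inj] by (simp add: inner_axis)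
  qed
  finally show "emeasure (distr lborel borel (\<lambda>z. of_coords (snd z) (fst z))) (box l u) =
      ennreal (\<Prod>b\<in>Basis. (u - l) \<bullet> b)" .
qed simp

lemma coords_measurable:
  fixes F :: "real^3 \<Rightarrow> ennreal"
  assumes "F \<in> borel_measurable borel"
  shows "(\<lambda>(z, c). F (of_coords z c)) \<in> borel_measurable (lborel \<Otimes>\<^sub>M lborel)"
    "(\<lambda>(c, z). F (of_coords z c)) \<in> borel_measurable (lborel \<Otimes>\<^sub>M lborel)"
    "(\<lambda>z. F (of_coords z c)) \<in> borel_measurable borel"
    "(\<lambda>c. F (of_coords w c)) \<in> borel_measurable borel"
    "(\<lambda>a. F (of_coords (a, b) c)) \<in> borel_measurable borel"
    "(\<lambda>b. F (of_coords (a, b) c)) \<in> borel_measurable borel"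
  unfolding lborel_prod split_beta' measurable_lborel2
  by (rule measurable_compose[OF _ assms], intro borel_measurable_continuous_onI continuous_intros)+

lemma nn_integral_coords:
  fixes F :: "real^3 \<Rightarrow> ennreal"
  assumes F: "F \<in> borel_measurable borel"
  shows "(\<integral>\<^sup>+x. F x \<partial>lborel) = (\<integral>\<^sup>+c. \<integral>\<^sup>+z. F (of_coords z c) \<partial>lborel \<partial>lborel)"
    "(\<integral>\<^sup>+x. F x \<partial>lborel) = (\<integral>\<^sup>+z. \<integral>\<^sup>+c. F (of_coords z c) \<partial>lborel \<partial>lborel)"
proof -
  have "(\<integral>\<^sup>+x. F x \<partial>lborel) = (\<integral>\<^sup>+z. F (of_coords (snd z) (fst z)) \<partial>(lborel \<Otimes>\<^sub>M lborel))"
    unfolding lborel_prod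
    by (subst lborel_of_coords[symmetric], subst nn_integral_distr) (auto simp: of_coords_measurable F)
  also have "\<dots> = (\<integral>\<^sup>+c. \<integral>\<^sup>+z. F (of_coords z c) \<partial>lborel \<partial>lborel)"
    using lborel.nn_integral_fst[of "\<lambda>z. F (of_coords (snd z) (fst z))" lborel] coords_measurable(2)[OF F]
    by (simp add: split_beta')
  finally show 1: "(\<integral>\<^sup>+x. F x \<partial>lborel) = (\<integral>\<^sup>+c. \<integral>\<^sup>+z. F (of_coords z c) \<partial>lborel \<partial>lborel)" .
  show "(\<integral>\<^sup>+x. F x \<partial>lborel) = (\<integral>\<^sup>+z. \<integral>\<^sup>+c. F (of_coords z c) \<partial>lborel \<partial>lborel)"
    unfolding 1 by (rule lborel_pair.Fubini'[OF coords_measurable(1)[OF F]])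
qed

lemma nn_integral_real_pair:
  fixes F :: "real \<times> real \<Rightarrow> ennreal"
  assumes [measurable]: "F \<in> borel_measurable borel"
  shows "(\<integral>\<^sup>+z. F z \<partial>lborel) = (\<integral>\<^sup>+a. \<integral>\<^sup>+b. F (a, b) \<partial>lborel \<partial>lborel)"
    "(\<integral>\<^sup>+z. F z \<partial>lborel) = (\<integral>\<^sup>+b. \<integral>\<^sup>+a. F (a, b) \<partial>lborel \<partial>lborel)"
proof -
  have m: "F \<in> borel_measurable (lborel \<Otimes>\<^sub>M lborel)" by (simp add: lborel_prod)
  show 1: "(\<integral>\<^sup>+z. F z \<partial>lborel) = (\<integral>\<^sup>+a. \<integral>\<^sup>+b. F (a, b) \<partial>lborel \<partial>lborel)"
    by (subst lborel.nn_integral_fst[OF m]) (simp add: lborel_prod)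
  show "(\<integral>\<^sup>+z. F z \<partial>lborel) = (\<integral>\<^sup>+b. \<integral>\<^sup>+a. F (a, b) \<partial>lborel \<partial>lborel)"
    unfolding 1 by (rule lborel_pair.Fubini'[symmetric]) (use m in simp)
qed

text \<open>Averaging the starting point of the line integral over an interval of length one
  replaces the decay at infinity that the homogeneous inequality would need.\<close>

lemma line_bound:
  fixes v v' :: "real \<Rightarrow> complex"
  assumes v: "\<And>t. (v has_vector_derivative v' t) (at t)" and c': "continuous_on UNIV v'"
  shows "ennreal ((norm (v s))\<^sup>2) \<le> (\<integral>\<^sup>+t. ennreal (norm (v t) * (2 * norm (v' t) + norm (v t))) \<partial>lborel)"
proof -
  have c: "continuous_on UNIV v"
    by (meson continuous_at_imp_continuous_on has_vector_derivative_continuous v)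
  note [measurable] = borel_measurable_continuous_onI[OF c] borel_measurable_continuous_onI[OF c']
  define I where "I = (\<integral>\<^sup>+t. ennreal (2 * norm (v t) * norm (v' t)) \<partial>lborel)"
  have step: "ennreal ((norm (v s))\<^sup>2) \<le> ennreal ((norm (v t))\<^sup>2) + I" if t: "t \<le> s" for t
  proof -
    have d: "((\<lambda>t. v t \<bullet> v t) has_vector_derivative 2 * (v x \<bullet> v' x)) (at x within {t..s})" for x
    proof -
      have "(v has_derivative (\<lambda>h. h *\<^sub>R v' x)) (at x within {t..s})"
        using v[of x] by (simp add: has_vector_derivative_def has_derivative_at_withinI)
      from has_derivative_inner[OF this this] show ?thesis
        unfolding has_vector_derivative_def
        by (rule has_derivative_eq_rhs) (auto simp: inner_commute)
    qed
    have cd: "continuous_on {t..s} (\<lambda>x. 2 * (v x \<bullet> v' x))"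
      by (intro continuous_intros continuous_on_subset[OF c] continuous_on_subset[OF c']) auto
    have i: "integrable lborel (\<lambda>x. indicator {t..s} x *\<^sub>R (2 * norm (v x) * norm (v' x)))"
      by (intro borel_integrable_compact continuous_intros continuous_on_subset[OF c] continuous_on_subset[OF c']) auto
    have "v s \<bullet> v s - v t \<bullet> v t = (\<integral>x. indicator {t..s} x *\<^sub>R (2 * (v x \<bullet> v' x)) \<partial>lborel)"
      by (rule integral_FTC_Icc[OF t d cd, symmetric])
    also have "\<dots> \<le> (\<integral>x. indicator {t..s} x *\<^sub>R (2 * norm (v x) * norm (v' x)) \<partial>lborel)"
    proof (rule integral_mono'[OF i])
      fix x show "indicator {t..s} x *\<^sub>R (2 * (v x \<bullet> v' x)) \<le> indicator {t..s} x *\<^sub>R (2 * norm (v x) * norm (v' x))"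
        using norm_cauchy_schwarz[of "v x" "v' x"] by (simp split: split_indicator)
    qed simp
    finally have "(norm (v s))\<^sup>2 \<le> (norm (v t))\<^sup>2 + (\<integral>x. indicator {t..s} x *\<^sub>R (2 * norm (v x) * norm (v' x)) \<partial>lborel)"
      by (simp add: power2_norm_eq_inner)
    then have "ennreal ((norm (v s))\<^sup>2) \<le> ennreal ((norm (v t))\<^sup>2) + ennreal (\<integral>x. indicator {t..s} x *\<^sub>R (2 * norm (v x) * norm (v' x)) \<partial>lborel)"
      by (simp add: ennreal_plus[symmetric] del: ennreal_plus)
    also have "ennreal (\<integral>x. indicator {t..s} x *\<^sub>R (2 * norm (v x) * norm (v' x)) \<partial>lborel) =
        (\<integral>\<^sup>+x. ennreal (indicator {t..s} x *\<^sub>R (2 * norm (v x) * norm (v' x))) \<partial>lborel)"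
      by (rule nn_integral_eq_integral[symmetric, OF i]) simp
    also have "\<dots> \<le> I"
      unfolding I_def by (intro nn_integral_mono) (simp split: split_indicator)
    finally show ?thesis by (simp add: add_left_mono)
  qed
  have "ennreal ((norm (v s))\<^sup>2) = (\<integral>\<^sup>+t. ennreal ((norm (v s))\<^sup>2) * indicator {s-1..s} t \<partial>lborel)"
    by (simp add: nn_integral_cmult_indicator)
  also have "\<dots> \<le> (\<integral>\<^sup>+t. ennreal ((norm (v t))\<^sup>2) + I * indicator {s-1..s} t \<partial>lborel)"
    using step by (intro nn_integral_mono) (simp split: split_indicator)
  also have "\<dots> = (\<integral>\<^sup>+t. ennreal ((norm (v t))\<^sup>2) \<partial>lborel) + I"
    by (simp add: nn_integral_add nn_integral_cmult_indicator)
  also have "\<dots> = (\<integral>\<^sup>+t. ennreal ((norm (v t))\<^sup>2) + ennreal (2 * norm (v t) * norm (v' t)) \<partial>lborel)"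
    unfolding I_def by (rule nn_integral_add[symmetric]) auto
  also have "\<dots> = (\<integral>\<^sup>+t. ennreal (norm (v t) * (2 * norm (v' t) + norm (v t))) \<partial>lborel)"
    by (intro nn_integral_cong)
      (simp add: ennreal_plus[symmetric] power2_eq_square algebra_simps del: ennreal_plus)
  finally show ?thesis .
qed

lemma has_grad_line:
  assumes "has_grad u p"
  shows "((\<lambda>t. u (x + t *\<^sub>R axis j 1)) has_vector_derivative p j (x + t *\<^sub>R axis j 1)) (at t)"
    "continuous_on UNIV (\<lambda>t. p j (x + t *\<^sub>R axis j 1))"
proof -
  have "((\<lambda>t. u (x + t *\<^sub>R axis j 1)) has_derivative (\<lambda>s. \<Sum>i\<in>UNIV. (s *\<^sub>R axis j 1) $ i *\<^sub>R p i (x + t *\<^sub>R axis j 1))) (at t)"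
    by (rule has_derivative_compose[of "\<lambda>t. x + t *\<^sub>R axis j 1" _ _ _ u])
      (use assms in \<open>auto intro!: derivative_eq_intros simp: has_grad_def\<close>)
  also have "(\<lambda>s. \<Sum>i\<in>UNIV. (s *\<^sub>R axis j 1) $ i *\<^sub>R p i (x + t *\<^sub>R axis j 1)) = (\<lambda>s. s *\<^sub>R p j (x + t *\<^sub>R axis j 1))"
    by (auto simp: axis_def if_distrib if_distribR sum.If_cases cong: if_cong)
  finally show "((\<lambda>t. u (x + t *\<^sub>R axis j 1)) has_vector_derivative p j (x + t *\<^sub>R axis j 1)) (at t)"
    by (simp add: has_vector_derivative_def)
  have "continuous_on UNIV (p j)" using assms by (simp add: has_grad_def)
  then show "continuous_on UNIV (\<lambda>t. p j (x + t *\<^sub>R axis j 1))"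
    by (rule continuous_on_compose2[OF _ _ subset_UNIV]) (intro continuous_intros)
qed

lemma ennreal_two_mult_le: "2 * (a * b) \<le> a\<^sup>2 + (b::ennreal)\<^sup>2"
proof (cases a; cases b)
  fix x y assume xy: "a = ennreal x" "0 \<le> x" "b = ennreal y" "0 \<le> y"
  have "ennreal (2 * (x * y)) \<le> ennreal (x\<^sup>2 + y\<^sup>2)"
    by (intro ennreal_leI) (use sum_squares_bound[of x y] in simp)
  then show ?thesis
    using xy by (simp add: ennreal_mult ennreal_power del: ennreal_leI)
qed (auto simp: power2_eq_square ennreal_top_mult)

text \<open>Ladyzhenskaya's scheme. On a plane \<open>x $ 3 = c\<close>, line integrals in the first
  two directions bound \<open>|u|^2\<close> twice, each time independently of one variable, so the
  slice integral of \<open>|u|^4\<close> is at most \<open>S (w 1) c * S (w 2) c\<close>.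
  Cauchy-Schwarz brings in the slice mass \<open>S U c\<close>, and the third direction bounds that
  mass uniformly in \<open>c\<close>. The squared form avoids square roots in
  \<open>ennreal\<close>.\<close>

lemma L4_smooth:
  assumes g: "has_grad u p"
  defines "k \<equiv> \<lambda>j x. ennreal ((2 * norm (p j x) + norm (u x))\<^sup>2)"
  shows "(2 * (\<integral>\<^sup>+x. ennreal ((norm (u x))^4) \<partial>lborel))\<^sup>2 \<le>
    (\<integral>\<^sup>+x. ennreal ((norm (u x))\<^sup>2) \<partial>lborel) * (\<integral>\<^sup>+x. k 3 x \<partial>lborel) *
    ((\<integral>\<^sup>+x. k 1 x \<partial>lborel) + (\<integral>\<^sup>+x. k 2 x \<partial>lborel))\<^sup>2"
proof -
  note m[measurable] = has_grad_measurable[OF g]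
  define w where "w j x = ennreal (norm (u x) * (2 * norm (p j x) + norm (u x)))" for j x
  define U where "U x = ennreal ((norm (u x))\<^sup>2)" for x
  have wm[measurable]: "w j \<in> borel_measurable borel" for j unfolding w_def by measurable
  have km[measurable]: "k j \<in> borel_measurable borel" for j unfolding k_def by measurable
  have Um[measurable]: "U \<in> borel_measurable borel" unfolding U_def by measurable
  have ax: "of_coords (a, b) c = of_coords (0, b) c + a *\<^sub>R axis 1 1"
    "of_coords (a, b) c = of_coords (a, 0) c + b *\<^sub>R axis 2 1"
    "of_coords (a, b) c = of_coords (a, b) 0 + c *\<^sub>R axis 3 1" for a b c
    by (simp_all add: vec_eq_iff forall_3 axis_def)
  have W1: "U (of_coords (a, b) c) \<le> (\<integral>\<^sup>+a. w 1 (of_coords (a, b) c) \<partial>lborel)" for a b c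
    using line_bound[OF has_grad_line[OF g, where x = "of_coords (0, b) c" and j = 1], of a]
    unfolding U_def w_def ax(1)[symmetric] .
  have W2: "U (of_coords (a, b) c) \<le> (\<integral>\<^sup>+b. w 2 (of_coords (a, b) c) \<partial>lborel)" for a b c
    using line_bound[OF has_grad_line[OF g, where x = "of_coords (a, 0) c" and j = 2], of b]
    unfolding U_def w_def ax(2)[symmetric] .
  have W3: "U (of_coords z c) \<le> (\<integral>\<^sup>+c. w 3 (of_coords z c) \<partial>lborel)" for z c
  proof -
    have "of_coords z 0 + c *\<^sub>R axis 3 1 = of_coords z c" for c
      by (simp add: vec_eq_iff forall_3 axis_def)
    then show ?thesis
      using line_bound[OF has_grad_line[OF g, where x = "of_coords z 0" and j = 3], of c]
      unfolding U_def w_def by simp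
  qed
  define S where "S F c = (\<integral>\<^sup>+z. F (of_coords z c) \<partial>lborel)" for F :: "real^3 \<Rightarrow> ennreal" and c
  have Sm[measurable]: "S F \<in> borel_measurable borel" if F: "F \<in> borel_measurable borel" for F
    using lborel.borel_measurable_nn_integral_fst[OF coords_measurable(2)[OF F]]
    unfolding S_def by (simp add: measurable_lborel2)
  have Swm[measurable]: "S (w j) \<in> borel_measurable borel" "S (k j) \<in> borel_measurable borel" for j
    by (rule Sm, measurable)+
  have slice: "S (\<lambda>x. U x * U x) c \<le> S (w 1) c * S (w 2) c" for c
  proof -
    have m1: "(\<lambda>z::real\<times>real. w j (of_coords z c)) \<in> borel_measurable borel" for j
      by (rule coords_measurable(3)[OF wm])
    have pm: "(\<lambda>(a, b). w j (of_coords (a, b) c)) \<in> borel_measurable (lborel \<Otimes>\<^sub>M lborel)"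
      "(\<lambda>(b, a). w j (of_coords (a, b) c)) \<in> borel_measurable (lborel \<Otimes>\<^sub>M lborel)" for j
      unfolding lborel_prod split_beta' measurable_lborel2
      by (rule measurable_compose[OF _ wm], intro borel_measurable_continuous_onI continuous_intros)+
    have m2: "(\<lambda>b. \<integral>\<^sup>+a. w j (of_coords (a, b) c) \<partial>lborel) \<in> borel_measurable borel"
      "(\<lambda>a. \<integral>\<^sup>+b. w j (of_coords (a, b) c) \<partial>lborel) \<in> borel_measurable borel" for j
      using lborel.borel_measurable_nn_integral_fst[OF pm(1)[of j]] lborel.borel_measurable_nn_integral_fst[OF pm(2)[of j]]
      by (simp_all add: measurable_lborel2)
    have "S (\<lambda>x. U x * U x) c = (\<integral>\<^sup>+a. \<integral>\<^sup>+b. U (of_coords (a, b) c) * U (of_coords (a, b) c) \<partial>lborel \<partial>lborel)"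
      unfolding S_def by (rule nn_integral_real_pair(1)) (rule coords_measurable(3), measurable)
    also have "\<dots> \<le> (\<integral>\<^sup>+a. \<integral>\<^sup>+b. (\<integral>\<^sup>+a'. w 1 (of_coords (a', b) c) \<partial>lborel) * (\<integral>\<^sup>+b'. w 2 (of_coords (a, b') c) \<partial>lborel) \<partial>lborel \<partial>lborel)"
      by (intro nn_integral_mono mult_mono W1 W2) auto
    also have "\<dots> = (\<integral>\<^sup>+a. (\<integral>\<^sup>+b. \<integral>\<^sup>+a'. w 1 (of_coords (a', b) c) \<partial>lborel \<partial>lborel) * (\<integral>\<^sup>+b'. w 2 (of_coords (a, b') c) \<partial>lborel) \<partial>lborel)"
      by (intro nn_integral_cong nn_integral_multc) (simp add: m2 measurable_lborel2)
    also have "\<dots> = (\<integral>\<^sup>+b. \<integral>\<^sup>+a'. w 1 (of_coords (a', b) c) \<partial>lborel \<partial>lborel) * (\<integral>\<^sup>+a. \<integral>\<^sup>+b'. w 2 (of_coords (a, b') c) \<partial>lborel \<partial>lborel)"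
      by (intro nn_integral_cmult) (simp add: m2 measurable_lborel2)
    also have "\<dots> = S (w 1) c * S (w 2) c"
      unfolding S_def nn_integral_real_pair(2)[OF m1[of 1]] nn_integral_real_pair(1)[OF m1[of 2]] ..
    finally show ?thesis .
  qed
  have w_split: "w j x = ennreal (norm (u x)) * ennreal (2 * norm (p j x) + norm (u x))" for j x
    by (simp add: w_def ennreal_mult)
  have sq: "ennreal (norm (u x)) ^ 2 = U x" "ennreal (2 * norm (p j x) + norm (u x)) ^ 2 = k j x" for j x
    by (simp_all add: U_def k_def ennreal_power del: ennreal_plus)
  have CS: "(S (w j) c)\<^sup>2 \<le> S U c * S (k j) c" for j c
    unfolding S_def w_split sq[symmetric]
    by (rule Cauchy_Schwarz_nn_integral; simp only: measurable_lborel2; rule coords_measurable(3); measurable)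
  \<comment> \<open>The line bound in the third direction, integrated over the plane: the right side
    no longer depends on \<open>c\<close>.\<close>
  have U3: "S U c \<le> (\<integral>\<^sup>+x. w 3 x \<partial>lborel)" for c
    unfolding S_def nn_integral_coords(2)[OF wm] by (intro nn_integral_mono W3)
  have prod: "2 * (S (w 1) c * S (w 2) c) \<le> (\<integral>\<^sup>+x. w 3 x \<partial>lborel) * (S (k 1) c + S (k 2) c)" for c
  proof -
    have "2 * (S (w 1) c * S (w 2) c) \<le> (S (w 1) c)\<^sup>2 + (S (w 2) c)\<^sup>2" by (rule ennreal_two_mult_le)
    also have "\<dots> \<le> S U c * S (k 1) c + S U c * S (k 2) c" by (intro add_mono CS)
    also have "\<dots> = S U c * (S (k 1) c + S (k 2) c)" by (simp add: distrib_left)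
    also have "\<dots> \<le> (\<integral>\<^sup>+x. w 3 x \<partial>lborel) * (S (k 1) c + S (k 2) c)" by (intro mult_right_mono U3) simp
    finally show ?thesis .
  qed
  have tot: "(\<integral>\<^sup>+x. F x \<partial>lborel) = (\<integral>\<^sup>+c. S F c \<partial>lborel)" if "F \<in> borel_measurable borel" for F
    unfolding S_def by (rule nn_integral_coords(1)[OF that])
  have "(\<integral>\<^sup>+x. ennreal ((norm (u x))^4) \<partial>lborel) = (\<integral>\<^sup>+x. U x * U x \<partial>lborel)"
    by (simp add: U_def ennreal_mult[symmetric] power_add[symmetric])
  also have "\<dots> = (\<integral>\<^sup>+c. S (\<lambda>x. U x * U x) c \<partial>lborel)" by (rule tot) measurable
  finally have "2 * (\<integral>\<^sup>+x. ennreal ((norm (u x))^4) \<partial>lborel) = (\<integral>\<^sup>+c. 2 * S (\<lambda>x. U x * U x) c \<partial>lborel)"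
    by (subst nn_integral_cmult) (auto simp: measurable_lborel2 intro!: Sm)
  also have "\<dots> \<le> (\<integral>\<^sup>+c. (\<integral>\<^sup>+x. w 3 x \<partial>lborel) * (S (k 1) c + S (k 2) c) \<partial>lborel)"
    by (intro nn_integral_mono order_trans[OF mult_left_mono[OF slice] prod]) simp
  also have "\<dots> = (\<integral>\<^sup>+x. w 3 x \<partial>lborel) * ((\<integral>\<^sup>+x. k 1 x \<partial>lborel) + (\<integral>\<^sup>+x. k 2 x \<partial>lborel))"
    unfolding tot[OF km] by (subst nn_integral_cmult) (simp_all add: nn_integral_add measurable_lborel2 Swm)
  finally have "(2 * (\<integral>\<^sup>+x. ennreal ((norm (u x))^4) \<partial>lborel))\<^sup>2 \<le>
      ((\<integral>\<^sup>+x. w 3 x \<partial>lborel) * ((\<integral>\<^sup>+x. k 1 x \<partial>lborel) + (\<integral>\<^sup>+x. k 2 x \<partial>lborel)))\<^sup>2"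
    by (rule power_mono) simp
  also have "\<dots> = (\<integral>\<^sup>+x. w 3 x \<partial>lborel)\<^sup>2 * ((\<integral>\<^sup>+x. k 1 x \<partial>lborel) + (\<integral>\<^sup>+x. k 2 x \<partial>lborel))\<^sup>2"
    by (rule power_mult_distrib)
  also have "(\<integral>\<^sup>+x. w 3 x \<partial>lborel)\<^sup>2 \<le> (\<integral>\<^sup>+x. U x \<partial>lborel) * (\<integral>\<^sup>+x. k 3 x \<partial>lborel)"
    unfolding w_split sq[symmetric] by (rule Cauchy_Schwarz_nn_integral) auto
  finally show ?thesis unfolding U_def by (simp add: mult_right_mono)
qed

lemma L4_smooth_L2:
  assumes g: "has_grad u p" and u: "u \<in> L2_space" and p: "\<And>j. p j \<in> L2_space"
  shows "(\<integral>\<^sup>+x. ennreal ((norm (u x))^4) \<partial>lborel) \<le>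
    ennreal (sqrt (16 * mass u * (2 * (\<Sum>j\<in>UNIV. mass (p j)) + mass u) ^ 3))"
proof -
  define P where "P = (\<Sum>j\<in>UNIV. mass (p j))"
  have P: "P = mass (p 1) + mass (p 2) + mass (p 3)" by (simp add: P_def sum_3)
  let ?k = "\<lambda>j. \<integral>\<^sup>+x. ennreal ((2 * norm (p j x) + norm (u x))\<^sup>2) \<partial>lborel"
  let ?M = "mass u"
  have nn: "0 \<le> ?M" "0 \<le> mass (p j)" for j by (simp_all add: mass_nonneg)
  note [measurable] = has_grad_measurable[OF g]
  have k: "?k j \<le> ennreal (8 * mass (p j) + 2 * ?M)" for j
  proof -
    have "?k j \<le> (\<integral>\<^sup>+x. ennreal (8 * (norm (p j x))\<^sup>2 + 2 * (norm (u x))\<^sup>2) \<partial>lborel)"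
    proof (intro nn_integral_mono ennreal_leI)
      fix x show "(2 * norm (p j x) + norm (u x))\<^sup>2 \<le> 8 * (norm (p j x))\<^sup>2 + 2 * (norm (u x))\<^sup>2"
        using zero_le_power2[of "2 * norm (p j x) - norm (u x)"] by (simp add: power2_eq_square algebra_simps)
    qed
    also have "\<dots> = ennreal (\<integral>x. 8 * (norm (p j x))\<^sup>2 + 2 * (norm (u x))\<^sup>2 \<partial>lborel)"
      by (rule nn_integral_eq_integral) (auto simp: L2_D[OF u] L2_D[OF p])
    also have "(\<integral>x. 8 * (norm (p j x))\<^sup>2 + 2 * (norm (u x))\<^sup>2 \<partial>lborel) = 8 * mass (p j) + 2 * ?M"
      by (simp add: L2_D[OF u] L2_D[OF p] mass_def)
    finally show ?thesis .
  qed
  let ?F = "\<integral>\<^sup>+x. ennreal ((norm (u x))^4) \<partial>lborel"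
  have "(2 * ?F)\<^sup>2 \<le> ennreal ?M * ?k 3 * (?k 1 + ?k 2)\<^sup>2"
    using L4_smooth[OF g] by (simp add: mass_nn[OF u])
  also have "\<dots> \<le> ennreal ?M * ennreal (8 * mass (p 3) + 2 * ?M) * (ennreal (8 * mass (p 1) + 2 * ?M) + ennreal (8 * mass (p 2) + 2 * ?M))\<^sup>2"
    by (intro mult_mono power_mono add_mono k order_refl) auto
  also have "\<dots> = ennreal (?M * (8 * mass (p 3) + 2 * ?M) * (8 * (mass (p 1) + mass (p 2)) + 4 * ?M)\<^sup>2)"
  proof -
    have "ennreal (8 * mass (p 1) + 2 * ?M) + ennreal (8 * mass (p 2) + 2 * ?M) = ennreal (8 * (mass (p 1) + mass (p 2)) + 4 * ?M)"
      using nn(1) nn(2)[of 1] nn(2)[of 2] by (subst ennreal_plus[symmetric]) (auto simp: algebra_simps)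
    moreover have "0 \<le> 8 * mass (p 3) + 2 * ?M" "0 \<le> 8 * (mass (p 1) + mass (p 2)) + 4 * ?M"
      using nn(1) nn(2)[of 1] nn(2)[of 2] nn(2)[of 3] by auto
    moreover have "ennreal A * ennreal B * (ennreal C)\<^sup>2 = ennreal (A * B * C\<^sup>2)"
      if "0 \<le> A" "0 \<le> B" "0 \<le> C" for A B C
      using that by (simp add: ennreal_mult ennreal_power)
    ultimately show ?thesis using nn(1) by simp
  qed
  also have "\<dots> \<le> ennreal (?M * (8 * P + 4 * ?M) * (8 * P + 4 * ?M)\<^sup>2)"
    using nn(1) nn(2)[of 1] nn(2)[of 2] nn(2)[of 3]
    by (intro ennreal_leI mult_mono power_mono order_refl) (auto simp: P)
  \<comment> \<open>Each of the three equal factors is 4 times the factor in the target; of the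
    resulting 64, a 4 is kept aside to cancel the square of the 2 on the left.\<close>
  also have "\<dots> = ennreal (4 * (16 * ?M * (2 * P + ?M) ^ 3))"
    by (simp add: power2_eq_square power3_eq_cube algebra_simps)
  finally have F: "(2 * ?F)\<^sup>2 \<le> ennreal (4 * (16 * ?M * (2 * P + ?M) ^ 3))" .
  have nnP: "0 \<le> 16 * ?M * (2 * P + ?M) ^ 3" using nn by (simp add: P_def sum_nonneg)
  show ?thesis
  proof (cases ?F)
    case (real f)
    then have "ennreal ((2 * f)\<^sup>2) \<le> ennreal (4 * (16 * ?M * (2 * P + ?M) ^ 3))"
      using F by (simp add: ennreal_power[symmetric] ennreal_mult)
    then have "f\<^sup>2 \<le> 16 * ?M * (2 * P + ?M) ^ 3"
      using nnP by (simp add: power_mult_distrib)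
    then have "f \<le> sqrt (16 * ?M * (2 * P + ?M) ^ 3)" by (rule real_le_rsqrt)
    then show ?thesis using real by (simp add: P_def ennreal_leI)
  next
    case top
    then show ?thesis using F by (simp add: ennreal_mult_top power2_eq_square top_unique)
  qed
qed

text \<open>The bound for mollifications is uniform because mollifying does not increase any mass.
  Fourth powers are not known to converge in mean, so the limit is taken by Fatou along an almost
  everywhere convergent subsequence.\<close>

theorem L4_bound:
  assumes u: "\<And>j. weak_partial j u (p j)"
  shows "integrable lborel (\<lambda>x. (norm (u x))^4)"
    "(\<integral>x. (norm (u x))^4 \<partial>lborel) \<le> sqrt (16 * mass u * (2 * (\<Sum>j\<in>UNIV. mass (p j)) + mass u) ^ 3)"
proof -
  have uL: "u \<in> L2_space" and pL: "\<And>j. p j \<in> L2_space" using u by (auto simp: weak_partial_def)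
  let ?B = "sqrt (16 * mass u * (2 * (\<Sum>j\<in>UNIV. mass (p j)) + mass u) ^ 3)"
  note [measurable] = L2_measurable[OF uL] moll_measurable[OF uL]
  note mc = L2_conv_moll[OF uL, unfolded L2_conv_def]
  have le: "(\<integral>\<^sup>+x. ennreal ((norm (moll n u x))^4) \<partial>lborel) \<le> ennreal ?B" for n
  proof -
    have "(\<Sum>j\<in>UNIV. mass (moll n (p j))) \<le> (\<Sum>j\<in>UNIV. mass (p j))"
      by (intro sum_mono moll_contraction pL)
    then have "sqrt (16 * mass (moll n u) * (2 * (\<Sum>j\<in>UNIV. mass (moll n (p j))) + mass (moll n u)) ^ 3) \<le> ?B"
      using moll_contraction(2)[OF uL, of n]
      by (intro real_sqrt_le_mono mult_mono power_mono add_mono order_refl)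
        (auto simp: mass_nonneg sum_nonneg)
    then show ?thesis
      using L4_smooth_L2[OF has_grad_moll[OF u] moll_contraction(1)[OF uL] moll_contraction(1)[OF pL], of n]
      by (meson ennreal_leI order_trans)
  qed
  have "\<exists>r::nat\<Rightarrow>nat. strict_mono r \<and> (AE x in lborel. (\<lambda>n. (norm (moll (r n) u x - u x))\<^sup>2) \<longlonglongrightarrow> 0)"
  proof (rule tendsto_L1_AE_subseq)
    show "integrable lborel (\<lambda>x. (norm (moll n u x - u x))\<^sup>2)" for n
      by (intro L2_D(2) L2_diff moll_contraction uL)
    show "(\<lambda>n. \<integral>x. norm ((norm (moll n u x - u x))\<^sup>2) \<partial>lborel) \<longlonglongrightarrow> 0"
      using mc by (simp add: mass_def)
  qed
  then obtain r :: "nat \<Rightarrow> nat" where "AE x in lborel. (\<lambda>n. (norm (moll (r n) u x - u x))\<^sup>2) \<longlonglongrightarrow> 0"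
    by blast
  then have "AE x in lborel. ennreal ((norm (u x))^4) = liminf (\<lambda>n. ennreal ((norm (moll (r n) u x))^4))"
  proof eventually_elim
    case (elim x)
    from tendsto_real_sqrt[OF this] have "(\<lambda>n. moll (r n) u x) \<longlonglongrightarrow> u x"
      by (simp add: tendsto_norm_zero_iff LIM_zero_iff)
    then have "(\<lambda>n. ennreal ((norm (moll (r n) u x))^4)) \<longlonglongrightarrow> ennreal ((norm (u x))^4)"
      by (intro tendsto_ennrealI tendsto_intros)
    then show ?case by (rule lim_imp_Liminf[OF trivial_limit_sequentially, symmetric])
  qed
  then have "(\<integral>\<^sup>+x. ennreal ((norm (u x))^4) \<partial>lborel) = (\<integral>\<^sup>+x. liminf (\<lambda>n. ennreal ((norm (moll (r n) u x))^4)) \<partial>lborel)"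
    by (rule nn_integral_cong_AE)
  also have "\<dots> \<le> liminf (\<lambda>n. \<integral>\<^sup>+x. ennreal ((norm (moll (r n) u x))^4) \<partial>lborel)"
    by (rule nn_integral_liminf) auto
  also have "\<dots> \<le> liminf (\<lambda>n. ennreal ?B)"
    by (rule Liminf_mono) (simp add: le)
  also have "\<dots> = ennreal ?B" by (rule Liminf_const) simp
  finally have F: "(\<integral>\<^sup>+x. ennreal ((norm (u x))^4) \<partial>lborel) \<le> ennreal ?B" .
  then show i: "integrable lborel (\<lambda>x. (norm (u x))^4)"
    by (auto simp: integrable_iff_bounded intro: order.strict_trans1)
  have "0 \<le> ?B" by (simp add: mass_nonneg sum_nonneg)
  then show "(\<integral>x. (norm (u x))^4 \<partial>lborel) \<le> ?B"
    using F by (subst (asm) nn_integral_eq_integral[OF i]) auto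
qed

section \<open>Gaussian Poincare inequality\<close>

lemma nn_integral_pair:
  fixes F :: "(real^3) \<times> (real^3) \<Rightarrow> ennreal"
  assumes [measurable]: "F \<in> borel_measurable borel"
  shows "(\<integral>\<^sup>+z. F z \<partial>lborel) = (\<integral>\<^sup>+x. \<integral>\<^sup>+y. F (x, y) \<partial>lborel \<partial>lborel)"
    "(\<integral>\<^sup>+z. F z \<partial>lborel) = (\<integral>\<^sup>+y. \<integral>\<^sup>+x. F (x, y) \<partial>lborel \<partial>lborel)"
proof -
  have m: "F \<in> borel_measurable (lborel \<Otimes>\<^sub>M lborel)" by (simp add: lborel_prod)
  show 1: "(\<integral>\<^sup>+z. F z \<partial>lborel) = (\<integral>\<^sup>+x. \<integral>\<^sup>+y. F (x, y) \<partial>lborel \<partial>lborel)"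
    by (subst lborel.nn_integral_fst[OF m]) (simp add: lborel_prod)
  show "(\<integral>\<^sup>+z. F z \<partial>lborel) = (\<integral>\<^sup>+y. \<integral>\<^sup>+x. F (x, y) \<partial>lborel \<partial>lborel)"
    unfolding 1 by (rule lborel_pair.Fubini'[symmetric]) (use m in simp)
qed

lemma shear_measurable:
  fixes F :: "(real^3) \<times> (real^3) \<Rightarrow> ennreal"
  assumes "F \<in> borel_measurable borel"
  shows "(\<lambda>z. F (a *\<^sub>R fst z + b *\<^sub>R snd z, c *\<^sub>R fst z + d *\<^sub>R snd z)) \<in> borel_measurable borel"
  by (rule measurable_compose[OF _ assms], intro borel_measurable_continuous_onI continuous_intros)

text \<open>With one variable frozen, a shear is a translation of the other; Tonelli does the
  rest.\<close>

lemma nn_integral_shear: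
  fixes F :: "(real^3) \<times> (real^3) \<Rightarrow> ennreal"
  assumes F: "F \<in> borel_measurable borel"
  shows "(\<integral>\<^sup>+z. F (fst z + t *\<^sub>R snd z, snd z) \<partial>lborel) = (\<integral>\<^sup>+z. F z \<partial>lborel)"
    "(\<integral>\<^sup>+z. F (fst z, snd z + t *\<^sub>R fst z) \<partial>lborel) = (\<integral>\<^sup>+z. F z \<partial>lborel)"
proof -
  have m: "(\<lambda>x. F (x, y)) \<in> borel_measurable borel" "(\<lambda>y. F (x, y)) \<in> borel_measurable borel" for x y
    by (rule measurable_compose[OF _ F], intro borel_measurable_continuous_onI continuous_intros)+
  show "(\<integral>\<^sup>+z. F (fst z + t *\<^sub>R snd z, snd z) \<partial>lborel) = (\<integral>\<^sup>+z. F z \<partial>lborel)"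
    using shear_measurable[OF F, of 1 t 0 1] nn_integral_translate[OF m(1)]
    by (simp add: nn_integral_pair(2)[OF F] nn_integral_pair(2))
  show "(\<integral>\<^sup>+z. F (fst z, snd z + t *\<^sub>R fst z) \<partial>lborel) = (\<integral>\<^sup>+z. F z \<partial>lborel)"
  proof -
    have "(\<lambda>z. F (fst z, snd z + t *\<^sub>R fst z)) \<in> borel_measurable borel"
      using shear_measurable[OF F, of 1 0 t 1] by (simp add: add.commute)
    then show ?thesis
      using nn_integral_translate[OF m(2)] by (simp add: nn_integral_pair(1)[OF F] nn_integral_pair(1))
  qed
qed

text \<open>A plane rotation is a product of three shears.\<close>

lemma nn_integral_rotation:
  fixes F :: "(real^3) \<times> (real^3) \<Rightarrow> ennreal"
  assumes F: "F \<in> borel_measurable borel" and cs: "c\<^sup>2 + s\<^sup>2 = 1" "c \<noteq> -1"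
  shows "(\<integral>\<^sup>+z. F (c *\<^sub>R fst z + s *\<^sub>R snd z, (- s) *\<^sub>R fst z + c *\<^sub>R snd z) \<partial>lborel) = (\<integral>\<^sup>+z. F z \<partial>lborel)"
proof -
  \<comment> \<open>The tangent of half the rotation angle. The three shears have parameters
    \<open>t\<close>, \<open>- s\<close>, \<open>t\<close>, and only the half turn
    \<open>c = -1\<close> is out of reach.\<close>
  define t where "t = s / (1 + c)"
  have c1: "1 + c \<noteq> 0" using cs(2) by (simp add: add_eq_0_iff)
  have st: "1 - s * t = c" and tc: "t + t * c = s"
  proof -
    have "s * s = (1 - c) * (1 + c)" using cs(1) by (simp add: power2_eq_square algebra_simps)
    then show "1 - s * t = c" using c1 by (simp add: t_def)
    have "t * (1 + c) = s" using c1 by (simp add: t_def)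
    then show "t + t * c = s" by (simp add: algebra_simps)
  qed
  define F1 where "F1 z = F (fst z + t *\<^sub>R snd z, snd z)" for z
  define F2 where "F2 z = F1 (fst z, snd z + (- s) *\<^sub>R fst z)" for z
  have m1: "F1 \<in> borel_measurable borel"
    using shear_measurable[OF F, of 1 t 0 1] by (simp add: F1_def[abs_def])
  have m2: "F2 \<in> borel_measurable borel"
    using shear_measurable[OF m1, of 1 0 "- s" 1] by (simp add: F2_def[abs_def] add.commute)
  have "F2 (fst z + t *\<^sub>R snd z, snd z) = F (c *\<^sub>R fst z + s *\<^sub>R snd z, (- s) *\<^sub>R fst z + c *\<^sub>R snd z)" for z
  proof -
    have y: "snd z + (- s) *\<^sub>R (fst z + t *\<^sub>R snd z) = (- s) *\<^sub>R fst z + (1 - s * t) *\<^sub>R snd z"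
      by (simp add: algebra_simps)
    have x: "fst z + t *\<^sub>R snd z + t *\<^sub>R ((- s) *\<^sub>R fst z + c *\<^sub>R snd z) = (1 - s * t) *\<^sub>R fst z + (t + t * c) *\<^sub>R snd z"
      by (simp add: algebra_simps)
    show ?thesis unfolding F2_def F1_def fst_conv snd_conv y x[unfolded st tc] st
      using x[unfolded st tc] by simp
  qed
  then have "(\<integral>\<^sup>+z. F (c *\<^sub>R fst z + s *\<^sub>R snd z, (- s) *\<^sub>R fst z + c *\<^sub>R snd z) \<partial>lborel) =
      (\<integral>\<^sup>+z. F2 (fst z + t *\<^sub>R snd z, snd z) \<partial>lborel)"
    by simp
  also have "\<dots> = (\<integral>\<^sup>+z. F2 z \<partial>lborel)" by (rule nn_integral_shear(1)[OF m2])
  also have "\<dots> = (\<integral>\<^sup>+z. F1 z \<partial>lborel)" unfolding F2_def by (rule nn_integral_shear(2)[OF m1])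
  also have "\<dots> = (\<integral>\<^sup>+z. F z \<partial>lborel)" unfolding F1_def by (rule nn_integral_shear(1)[OF F])
  finally show ?thesis .
qed

section \<open>The rotation argument of Maurey and Pisier\<close>

lemma norm_sum_scaleR_le:
  "(norm (\<Sum>j\<in>UNIV. (h::real^3) $ j *\<^sub>R (q j :: complex)))\<^sup>2 \<le> (norm h)\<^sup>2 * (\<Sum>j\<in>UNIV. (norm (q j))\<^sup>2)"
proof -
  have "norm (\<Sum>j\<in>UNIV. h $ j *\<^sub>R q j) \<le> (\<Sum>j\<in>UNIV. \<bar>h $ j\<bar> * norm (q j))"
    by (rule order_trans[OF norm_sum]) simp
  then have "(norm (\<Sum>j\<in>UNIV. h $ j *\<^sub>R q j))\<^sup>2 \<le> (\<Sum>j\<in>UNIV. \<bar>h $ j\<bar> * norm (q j))\<^sup>2"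
    by (intro power_mono) auto
  also have "\<dots> \<le> (\<Sum>j\<in>UNIV. \<bar>h $ j\<bar>\<^sup>2) * (\<Sum>j\<in>UNIV. (norm (q j))\<^sup>2)"
    by (rule Cauchy_Schwarz_ineq_sum)
  finally show ?thesis by (simp add: norm_vec3_sq)
qed

text \<open>The quarter turn \<open>cos t *\<^sub>R x + sin t *\<^sub>R y\<close> runs from
  \<open>x\<close> to \<open>y\<close>. The fundamental theorem of calculus along it, followed by
  Cauchy-Schwarz in \<open>t\<close>, gives the factor \<open>pi / 2\<close>, the length of the
  parameter interval.\<close>

lemma rotation_path_bound:
  assumes f: "has_grad f q"
  shows "ennreal ((norm (f x - f y))\<^sup>2) \<le> ennreal (pi / 2) *
    (\<integral>\<^sup>+t. ennreal ((norm ((- sin t) *\<^sub>R x + cos t *\<^sub>R y))\<^sup>2 * (\<Sum>j\<in>UNIV. (norm (q j (cos t *\<^sub>R x + sin t *\<^sub>R y)))\<^sup>2)) *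
      indicator {0..pi/2} t \<partial>lborel)"
proof -
  let ?g = "\<lambda>t. cos t *\<^sub>R x + sin t *\<^sub>R y"
  let ?g' = "\<lambda>t. (- sin t) *\<^sub>R x + cos t *\<^sub>R y"
  let ?w = "\<lambda>t. \<Sum>j\<in>UNIV. ?g' t $ j *\<^sub>R q j (?g t)"
  let ?I = "indicator {0..pi/2} :: real \<Rightarrow> real"
  have qc: "continuous_on UNIV (q j)" for j using f by (simp add: has_grad_def)
  have wc: "continuous_on UNIV ?w"
    by (intro continuous_intros continuous_on_compose2[OF qc _ subset_UNIV])
  have wm: "?w \<in> borel_measurable borel" by (rule borel_measurable_continuous_onI[OF wc])
  have d: "((\<lambda>t. f (?g t)) has_vector_derivative ?w t) (at t within S)" for t S
  proof -
    have D: "(f has_derivative (\<lambda>h. \<Sum>j\<in>UNIV. h $ j *\<^sub>R q j z)) (at z)" for z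
      using f by (simp add: has_grad_def)
    have "((\<lambda>t. f (?g t)) has_derivative (\<lambda>s. \<Sum>j\<in>UNIV. (s *\<^sub>R ?g' t) $ j *\<^sub>R q j (?g t))) (at t within S)"
      by (rule has_derivative_compose[OF _ D])
        (auto intro!: derivative_eq_intros simp: algebra_simps)
    then show ?thesis
      unfolding has_vector_derivative_def
      by (rule has_derivative_eq_rhs) (simp add: scaleR_sum_right)
  qed
  have i: "integrable lborel (\<lambda>t. ?I t *\<^sub>R ?w t)"
    by (intro borel_integrable_compact continuous_on_subset[OF wc]) auto
  have "f (?g (pi/2)) - f (?g 0) = (\<integral>t. ?I t *\<^sub>R ?w t \<partial>lborel)"
    by (rule integral_FTC_Icc[OF _ d continuous_on_subset[OF wc subset_UNIV], symmetric]) simp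
  then have A: "f y - f x = (\<integral>t. ?I t *\<^sub>R ?w t \<partial>lborel)" by simp
  have "norm (f x - f y) = norm (\<integral>t. ?I t *\<^sub>R ?w t \<partial>lborel)"
    unfolding A[symmetric] by (rule norm_minus_commute)
  also have "\<dots> \<le> (\<integral>t. norm (?I t *\<^sub>R ?w t) \<partial>lborel)" by (rule integral_norm_bound)
  finally have "ennreal (norm (f x - f y)) \<le> (\<integral>\<^sup>+t. ennreal (norm (?I t *\<^sub>R ?w t)) \<partial>lborel)"
    using integrable_norm[OF i] by (subst nn_integral_eq_integral) (auto intro: ennreal_leI)
  then have "(ennreal (norm (f x - f y)))\<^sup>2 \<le> (\<integral>\<^sup>+t. ennreal (norm (?I t *\<^sub>R ?w t)) \<partial>lborel)\<^sup>2"
    by (intro power_mono) auto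
  also have "\<dots> = (\<integral>\<^sup>+t. ennreal (?I t) * ennreal (?I t * norm (?w t)) \<partial>lborel)\<^sup>2"
    by (intro arg_cong[where f = "\<lambda>a. a\<^sup>2"] nn_integral_cong) (simp split: split_indicator)
  also have "\<dots> \<le> (\<integral>\<^sup>+t. (ennreal (?I t))\<^sup>2 \<partial>lborel) * (\<integral>\<^sup>+t. (ennreal (?I t * norm (?w t)))\<^sup>2 \<partial>lborel)"
    using wm by (intro Cauchy_Schwarz_nn_integral) auto
  also have "(\<integral>\<^sup>+t. (ennreal (?I t))\<^sup>2 \<partial>lborel) = (\<integral>\<^sup>+t. indicator {0..pi/2} t \<partial>lborel)"
    by (intro nn_integral_cong) (simp split: split_indicator)
  also have "\<dots> = ennreal (pi / 2)" by simp
  also have "(\<integral>\<^sup>+t. (ennreal (?I t * norm (?w t)))\<^sup>2 \<partial>lborel) \<le>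
      (\<integral>\<^sup>+t. ennreal ((norm (?g' t))\<^sup>2 * (\<Sum>j\<in>UNIV. (norm (q j (?g t)))\<^sup>2)) * indicator {0..pi/2} t \<partial>lborel)"
  proof (rule nn_integral_mono)
    fix t
    have "(norm (?w t))\<^sup>2 \<le> (norm (?g' t))\<^sup>2 * (\<Sum>j\<in>UNIV. (norm (q j (?g t)))\<^sup>2)"
      by (rule norm_sum_scaleR_le)
    from ennreal_leI[OF this]
    show "(ennreal (?I t * norm (?w t)))\<^sup>2 \<le>
        ennreal ((norm (?g' t))\<^sup>2 * (\<Sum>j\<in>UNIV. (norm (q j (?g t)))\<^sup>2)) * indicator {0..pi/2} t"
    proof (cases "t \<in> {0..pi/2}")
      case True
      with \<open>ennreal _ \<le> ennreal _\<close> show ?thesis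
        by (simp only: indicator_simps ennreal_power norm_ge_zero mult_1_left mult_1_right)
    next
      case False
      then have "?I t = 0" by simp
      then show ?thesis by simp
    qed
  qed
  finally show ?thesis by (simp add: ennreal_power mult_left_mono)
qed

text \<open>Three coordinate moments, each equal to \<open>pi powr (3/2) / 2\<close>.\<close>

lemma second_moment_gauss:
  "(\<integral>\<^sup>+y. ennreal ((norm y)\<^sup>2 * exp (- (norm y)\<^sup>2)) \<partial>(lborel :: (real^3) measure)) = ennreal (3 / 2 * pi powr (3/2))"
proof -
  have e: "(norm y)\<^sup>2 * exp (- (norm y)\<^sup>2) = (\<Sum>j\<in>UNIV. (norm (complex_of_real (y $ j) * gauss y))\<^sup>2)" for y :: "real^3"
    by (simp add: norm_mult power_mult_distrib gauss_norm(2) norm_vec3_sq[of y] sum_distrib_right del: norm_of_real)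
      (simp add: gauss_norm(2)[unfolded norm_vec3_sq])
  have "(\<integral>\<^sup>+y. ennreal ((norm y)\<^sup>2 * exp (- (norm y)\<^sup>2)) \<partial>(lborel :: (real^3) measure)) =
      ennreal (\<integral>y. (\<Sum>j\<in>UNIV. (norm (complex_of_real (y $ j) * gauss y))\<^sup>2) \<partial>lborel)"
    unfolding e by (rule nn_integral_eq_integral) (auto intro!: Bochner_Integration.integrable_sum L2_D(2) coord_gauss_L2 sum_nonneg)
  also have "(\<integral>y. (\<Sum>j\<in>UNIV. (norm (complex_of_real (y $ j) * gauss y))\<^sup>2) \<partial>lborel) = (\<Sum>j\<in>(UNIV::3 set). pi powr (3/2) / 2)"
    by (subst Bochner_Integration.integral_sum, intro L2_D(2) coord_gauss_L2)
      (simp only: mass_coord_gauss[unfolded mass_def])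
  finally show ?thesis by simp
qed

text \<open>For fixed \<open>t\<close>, position and velocity on the path are the image of
  \<open>(x, y)\<close> under a rotation, which preserves both Lebesgue measure and the weight
  \<open>e\<close>; hence they decouple. The velocity contributes the second moment
  \<open>3 / 2 * pi powr (3/2)\<close>, and \<open>pi / 2\<close> enters twice, from Cauchy-Schwarz
  and from the range of \<open>t\<close>.\<close>

lemma gauss_variance_bound:
  assumes f: "has_grad f q"
  shows "(\<integral>\<^sup>+x. \<integral>\<^sup>+y. ennreal ((norm (f x - f y))\<^sup>2 * (exp (- (norm x)\<^sup>2) * exp (- (norm y)\<^sup>2))) \<partial>lborel \<partial>lborel)
    \<le> ennreal (3 * pi\<^sup>2 / 8 * pi powr (3/2)) *
      (\<integral>\<^sup>+x. ennreal ((\<Sum>j\<in>UNIV. (norm (q j x))\<^sup>2) * exp (- (norm x)\<^sup>2)) \<partial>lborel)"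
proof -
  have qc: "continuous_on UNIV (q j)" for j using f by (simp add: has_grad_def)
  have fc: "continuous_on UNIV f" by (rule has_grad_continuous[OF f])
  note [measurable] = has_grad_measurable[OF f]
  define e where "e z = exp (- (norm (fst z))\<^sup>2) * exp (- (norm (snd z))\<^sup>2)" for z :: "(real^3) \<times> (real^3)"
  define s where "s x = (\<Sum>j\<in>UNIV. (norm (q j x))\<^sup>2)" for x
  have sc: "continuous_on UNIV s" unfolding s_def by (intro continuous_intros qc)
  have ec: "continuous_on UNIV e" unfolding e_def by (intro continuous_intros)
  define H where "H z = ennreal ((norm (snd z))\<^sup>2 * s (fst z) * e z)" for z
  have Hm: "H \<in> borel_measurable borel"
    unfolding H_def
    by (intro measurable_compose[OF _ measurable_ennreal] borel_measurable_continuous_onI continuous_intros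
        continuous_on_compose2[OF sc _ subset_UNIV] ec)
  let ?R = "\<lambda>t z. (cos t *\<^sub>R fst z + sin t *\<^sub>R snd z, (- sin t) *\<^sub>R fst z + cos t *\<^sub>R snd z) :: (real^3) \<times> (real^3)"
  have eR: "e (?R t z) = e z" for t z
  proof -
    have "(norm (c *\<^sub>R x + s *\<^sub>R y))\<^sup>2 + (norm ((- s) *\<^sub>R x + c *\<^sub>R y))\<^sup>2 =
        (c\<^sup>2 + s\<^sup>2) * (norm x)\<^sup>2 + (c\<^sup>2 + s\<^sup>2) * (norm y)\<^sup>2" for x y :: "real^3" and c s :: real
      unfolding power2_norm_eq_inner
      by (simp add: inner_add_left inner_add_right inner_diff_left inner_diff_right inner_commute power2_eq_square algebra_simps)
    from this[of "cos t" "fst z" "sin t" "snd z"]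
    show ?thesis by (simp add: e_def mult_exp_exp)
  qed
  have fm: "(\<lambda>z. ennreal ((norm (f (fst z) - f (snd z)))\<^sup>2 * e z)) \<in> borel_measurable borel"
    by (intro measurable_compose[OF _ measurable_ennreal] borel_measurable_continuous_onI continuous_intros
        continuous_on_compose2[OF fc _ subset_UNIV] ec)
  have jm: "(\<lambda>(z, t). H (?R t z) * indicator {0..pi/2} t) \<in> borel_measurable (lborel \<Otimes>\<^sub>M lborel)"
  proof -
    have [measurable]: "(\<lambda>w::((real^3) \<times> (real^3)) \<times> real. H (?R (snd w) (fst w))) \<in> borel_measurable borel"
      by (rule measurable_compose[OF _ Hm], intro borel_measurable_continuous_onI continuous_intros)
    have [measurable]: "(\<lambda>w::((real^3) \<times> (real^3)) \<times> real. indicator {0..pi/2} (snd w) :: ennreal) \<in> borel_measurable borel"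
      by (rule measurable_compose[of snd borel borel])
        (auto intro!: borel_measurable_continuous_onI continuous_intros)
    show ?thesis unfolding lborel_prod split_beta' measurable_lborel2 by measurable
  qed
  have Rm: "(\<lambda>z. H (?R t z)) \<in> borel_measurable borel" for t
    by (rule shear_measurable[OF Hm])
  have pt: "ennreal ((norm (f (fst z) - f (snd z)))\<^sup>2 * e z) \<le>
      ennreal (pi / 2) * (\<integral>\<^sup>+t. H (?R t z) * indicator {0..pi/2} t \<partial>lborel)" for z
  proof -
    let ?k = "\<lambda>t. (norm ((- sin t) *\<^sub>R fst z + cos t *\<^sub>R snd z))\<^sup>2 * s (cos t *\<^sub>R fst z + sin t *\<^sub>R snd z)"
    have e0: "0 \<le> e z" by (simp add: e_def)
    have km: "(\<lambda>t. ennreal (?k t) * indicator {0..pi/2} t) \<in> borel_measurable borel"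
    proof -
      have [measurable]: "?k \<in> borel_measurable borel"
        by (intro borel_measurable_continuous_onI continuous_intros continuous_on_compose2[OF sc _ subset_UNIV])
      show ?thesis by measurable
    qed
    have "ennreal ((norm (f (fst z) - f (snd z)))\<^sup>2 * e z) = ennreal (e z) * ennreal ((norm (f (fst z) - f (snd z)))\<^sup>2)"
      by (simp add: e0 ennreal_mult mult.commute)
    also have "\<dots> \<le> ennreal (e z) * (ennreal (pi / 2) * (\<integral>\<^sup>+t. ennreal (?k t) * indicator {0..pi/2} t \<partial>lborel))"
      unfolding s_def by (intro mult_left_mono rotation_path_bound[OF f]) simp
    also have "\<dots> = ennreal (pi / 2) * (\<integral>\<^sup>+t. ennreal (e z) * (ennreal (?k t) * indicator {0..pi/2} t) \<partial>lborel)"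
      using km by (subst nn_integral_cmult) (auto simp: measurable_lborel2 mult_ac)
    also have "(\<integral>\<^sup>+t. ennreal (e z) * (ennreal (?k t) * indicator {0..pi/2} t) \<partial>lborel) = (\<integral>\<^sup>+t. H (?R t z) * indicator {0..pi/2} t \<partial>lborel)"
    proof (rule nn_integral_cong)
      fix t
      have "ennreal (e z) * ennreal (?k t) = H (?R t z)"
        unfolding H_def eR by (simp add: e0 ennreal_mult[symmetric] mult.commute s_def sum_nonneg)
      then show "ennreal (e z) * (ennreal (?k t) * indicator {0..pi/2} t) = H (?R t z) * indicator {0..pi/2} t"
        by (simp only: mult.assoc[symmetric])
    qed
    finally show ?thesis .
  qed
  have "(\<integral>\<^sup>+x. \<integral>\<^sup>+y. ennreal ((norm (f x - f y))\<^sup>2 * (exp (- (norm x)\<^sup>2) * exp (- (norm y)\<^sup>2))) \<partial>lborel \<partial>lborel)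
      = (\<integral>\<^sup>+z. ennreal ((norm (f (fst z) - f (snd z)))\<^sup>2 * e z) \<partial>lborel)"
    unfolding nn_integral_pair(1)[OF fm] by (simp add: e_def)
  also have "\<dots> \<le> (\<integral>\<^sup>+z. ennreal (pi / 2) * (\<integral>\<^sup>+t. H (?R t z) * indicator {0..pi/2} t \<partial>lborel) \<partial>lborel)"
    by (intro nn_integral_mono pt)
  also have "\<dots> = ennreal (pi / 2) * (\<integral>\<^sup>+z. \<integral>\<^sup>+t. H (?R t z) * indicator {0..pi/2} t \<partial>lborel \<partial>lborel)"
    using lborel.borel_measurable_nn_integral_fst[OF jm] by (intro nn_integral_cmult) simp
  also have "(\<integral>\<^sup>+z. \<integral>\<^sup>+t. H (?R t z) * indicator {0..pi/2} t \<partial>lborel \<partial>lborel) =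
      (\<integral>\<^sup>+t. \<integral>\<^sup>+z. H (?R t z) * indicator {0..pi/2} t \<partial>lborel \<partial>lborel)"
    by (rule lborel_pair.Fubini'[OF jm, symmetric])
  also have "\<dots> = (\<integral>\<^sup>+t. (\<integral>\<^sup>+z. H z \<partial>lborel) * indicator {0..pi/2} t \<partial>lborel)"
  proof (rule nn_integral_cong)
    fix t
    have "(\<integral>\<^sup>+z. H (?R t z) * indicator {0..pi/2} t \<partial>lborel) = (\<integral>\<^sup>+z. H (?R t z) \<partial>lborel) * indicator {0..pi/2} t"
      by (rule nn_integral_multc) (unfold measurable_lborel2, rule Rm)
    also have "\<dots> = (\<integral>\<^sup>+z. H z \<partial>lborel) * indicator {0..pi/2} t"
    proof (cases "t \<in> {0..pi/2}")
      case True
      \<comment> \<open>A nonnegative cosine keeps clear of the half turn that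
        \<open>nn_integral_rotation\<close> excludes.\<close>
      then have "0 \<le> cos t" by (auto intro!: cos_ge_zero)
      then have "(\<integral>\<^sup>+z. H (?R t z) \<partial>lborel) = (\<integral>\<^sup>+z. H z \<partial>lborel)"
        by (intro nn_integral_rotation[OF Hm]) auto
      then show ?thesis by simp
    qed simp
    finally show "(\<integral>\<^sup>+z. H (?R t z) * indicator {0..pi/2} t \<partial>lborel) = (\<integral>\<^sup>+z. H z \<partial>lborel) * indicator {0..pi/2} t" .
  qed
  also have "\<dots> = (\<integral>\<^sup>+z. H z \<partial>lborel) * ennreal (pi / 2)"
    by (simp add: nn_integral_cmult_indicator)
  also have "(\<integral>\<^sup>+z. H z \<partial>lborel) = (\<integral>\<^sup>+x. \<integral>\<^sup>+y. ennreal (s x * exp (- (norm x)\<^sup>2)) * ennreal ((norm y)\<^sup>2 * exp (- (norm y)\<^sup>2)) \<partial>(lborel :: (real^3) measure) \<partial>lborel)"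
    unfolding nn_integral_pair(1)[OF Hm]
  proof (intro nn_integral_cong)
    fix x y :: "real^3"
    have "0 \<le> s x" by (simp add: s_def sum_nonneg)
    then have "ennreal (s x * exp (- (norm x)\<^sup>2)) * ennreal ((norm y)\<^sup>2 * exp (- (norm y)\<^sup>2)) =
        ennreal (s x * exp (- (norm x)\<^sup>2) * ((norm y)\<^sup>2 * exp (- (norm y)\<^sup>2)))"
      by (simp add: ennreal_mult)
    then show "H (x, y) = ennreal (s x * exp (- (norm x)\<^sup>2)) * ennreal ((norm y)\<^sup>2 * exp (- (norm y)\<^sup>2))"
      by (simp add: H_def e_def mult_ac)
  qed
  also have "\<dots> = (\<integral>\<^sup>+x. ennreal (s x * exp (- (norm x)\<^sup>2)) \<partial>lborel) * ennreal (3 / 2 * pi powr (3/2))"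
  proof -
    have "s \<in> borel_measurable borel" by (rule borel_measurable_continuous_onI[OF sc])
    then show ?thesis by (simp add: nn_integral_cmult nn_integral_multc second_moment_gauss)
  qed
  finally have "(\<integral>\<^sup>+x. \<integral>\<^sup>+y. ennreal ((norm (f x - f y))\<^sup>2 * (exp (- (norm x)\<^sup>2) * exp (- (norm y)\<^sup>2))) \<partial>lborel \<partial>lborel) \<le>
     ennreal (pi / 2) * ((\<integral>\<^sup>+x. ennreal (s x * exp (- (norm x)\<^sup>2)) \<partial>lborel) * ennreal (3 / 2 * pi powr (3/2)) * ennreal (pi / 2))" .
  also have "\<dots> = ennreal (pi / 2) * ennreal (pi / 2) * ennreal (3 / 2 * pi powr (3/2)) * (\<integral>\<^sup>+x. ennreal (s x * exp (- (norm x)\<^sup>2)) \<partial>lborel)"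
    by (simp only: mult_ac)
  also have "ennreal (pi / 2) * ennreal (pi / 2) * ennreal (3 / 2 * pi powr (3/2)) = ennreal (3 * pi\<^sup>2 / 8 * pi powr (3/2))"
    by (simp add: ennreal_mult[symmetric] power2_eq_square)
  finally show ?thesis by (simp add: s_def)
qed

lemma L2_conv_add:
  assumes "L2_conv F f" "L2_conv G g"
  shows "L2_conv (\<lambda>n x. F n x + G n x) (\<lambda>x. f x + g x)"
proof -
  have L: "\<And>n. F n \<in> L2_space" "f \<in> L2_space" "\<And>n. G n \<in> L2_space" "g \<in> L2_space"
    using assms by (auto simp: L2_conv_def)
  have "(\<lambda>n. 2 * mass (\<lambda>x. F n x - f x) + 2 * mass (\<lambda>x. G n x - g x)) \<longlonglongrightarrow> 2 * 0 + 2 * 0"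
    using assms by (intro tendsto_intros) (auto simp: L2_conv_def)
  then have lim: "(\<lambda>n. 2 * mass (\<lambda>x. F n x - f x) + 2 * mass (\<lambda>x. G n x - g x)) \<longlonglongrightarrow> 0" by simp
  have "mass (\<lambda>x. F n x + G n x - (f x + g x)) \<le> 2 * mass (\<lambda>x. F n x - f x) + 2 * mass (\<lambda>x. G n x - g x)" for n
    using mass_add_le[OF L2_diff[OF L(1,2)] L2_diff[OF L(3,4)], of n n] by (simp add: algebra_simps)
  then have "(\<lambda>n. mass (\<lambda>x. F n x + G n x - (f x + g x))) \<longlonglongrightarrow> 0"
    by (intro tendsto_sandwich[OF _ _ tendsto_const lim]) (auto simp: mass_nonneg)
  then show ?thesis using L by (simp add: L2_conv_def L2_add)
qed

lemma lborel_integral_cnj: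
  fixes f :: "real^3 \<Rightarrow> complex"
  assumes "integrable lborel f"
  shows "(\<integral>x. cnj (f x) \<partial>lborel) = cnj (\<integral>x. f x \<partial>lborel)"
  by (rule integral_bounded_linear[OF bounded_linear_cnj assms])

section \<open>Oscillator estimates for smooth functions\<close>

lemma has_grad_ginv:
  "has_grad (\<lambda>x. complex_of_real (exp ((norm x)\<^sup>2 / 2))) (\<lambda>j x. complex_of_real (x $ j) * complex_of_real (exp ((norm x)\<^sup>2 / 2)))"
proof -
  let ?g = "\<lambda>x::real^3. complex_of_real (exp ((norm x)\<^sup>2 / 2))"
  have "(?g has_derivative (\<lambda>h. complex_of_real (exp ((x \<bullet> x) / 2) * (x \<bullet> h)))) (at x)" for x
    unfolding power2_norm_eq_inner
    by (intro has_derivative_of_real)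
      (auto intro!: derivative_eq_intros simp: inner_commute algebra_simps)
  also have "(\<lambda>h. complex_of_real (exp ((x \<bullet> x) / 2) * (x \<bullet> h))) =
      (\<lambda>h. \<Sum>j\<in>UNIV. h $ j *\<^sub>R (complex_of_real (x $ j) * ?g x))" for x
    by (auto simp: power2_norm_eq_inner inner_vec_def sum_distrib_left
        scaleR_conv_of_real fun_eq_iff intro!: sum.cong)
  finally have D: "(?g has_derivative (\<lambda>h. \<Sum>j\<in>UNIV. h $ j *\<^sub>R (complex_of_real (x $ j) * ?g x))) (at x)" for x .
  then have "continuous_on UNIV ?g"
    by (meson continuous_at_imp_continuous_on has_derivative_continuous)
  with D show ?thesis unfolding has_grad_def by (auto intro!: continuous_intros)
qed

text \<open>The variance bound is applied to \<open>f = u / gauss\<close>. Its gradient times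
  \<open>gauss\<close> is \<open>p j + x_j u\<close>, and expanding the square shows that the double
  integral of \<open>|f x - f y|^2\<close> against both Gaussian weights is
  \<open>2 * (mass u * mass gauss - |S|^2)\<close>.\<close>

lemma poincare_smooth:
  assumes g: "has_grad u p" and u: "u \<in> L2_space" and a: "\<And>j. (\<lambda>x. p j x + complex_of_real (x $ j) * u x) \<in> L2_space"
  shows "mass u - (norm (\<integral>x. u x * gauss x \<partial>lborel))\<^sup>2 / mass gauss \<le>
    3 * (\<Sum>j\<in>UNIV. mass (\<lambda>x. p j x + complex_of_real (x $ j) * u x))"
proof -
  define S where "S = (\<integral>x. u x * gauss x \<partial>lborel)"
  let ?a = "\<lambda>j x. p j x + complex_of_real (x $ j) * u x"
  let ?i = "\<lambda>x::real^3. complex_of_real (exp ((norm x)\<^sup>2 / 2))"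
  let ?f = "\<lambda>x. u x * ?i x"
  let ?q = "\<lambda>j x. u x * (complex_of_real (x $ j) * ?i x) + p j x * ?i x"
  have f: "has_grad ?f ?q" by (rule has_grad_mult[OF g has_grad_ginv])
  have gi: "?i x * gauss x = 1" for x
    by (simp add: gauss_def mult_exp_exp flip: of_real_mult)
  have G0: "0 < mass gauss" by (simp add: mass_gauss)
  have ui: "integrable lborel (\<lambda>x. u x * gauss x)" by (rule L2_integrable_mult[OF u gauss_L2])
  have e: "(norm (?f x - ?f y))\<^sup>2 * (exp (- (norm x)\<^sup>2) * exp (- (norm y)\<^sup>2)) = (norm (u x * gauss y + (- gauss x) * u y))\<^sup>2" for x y
  proof -
    have "(?f x - ?f y) * (gauss x * gauss y) = u x * gauss y * (?i x * gauss x) - gauss x * u y * (?i y * gauss y)"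
      by (simp add: algebra_simps)
    then have "u x * gauss y + (- gauss x) * u y = (?f x - ?f y) * (gauss x * gauss y)" by (simp add: gi)
    then show ?thesis by (simp only: norm_mult power_mult_distrib gauss_norm(2))
  qed
  have q: "(\<Sum>j\<in>UNIV. (norm (?q j x))\<^sup>2) * exp (- (norm x)\<^sup>2) = (\<Sum>j\<in>UNIV. (norm (?a j x))\<^sup>2)" for x
    unfolding sum_distrib_right
  proof (rule sum.cong[OF refl])
    fix j
    have "?q j x * gauss x = ?a j x * (?i x * gauss x)" by (simp add: algebra_simps)
    then have "?a j x = ?q j x * gauss x" by (simp add: gi)
    then show "(norm (?q j x))\<^sup>2 * exp (- (norm x)\<^sup>2) = (norm (?a j x))\<^sup>2"
      by (simp only: norm_mult power_mult_distrib gauss_norm(2))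
  qed
  have inner: "mass (\<lambda>y. u x * gauss y + (- gauss x) * u y) =
      (norm (u x))\<^sup>2 * mass gauss + (norm (gauss x))\<^sup>2 * mass u - 2 * Re (u x * gauss x * cnj S)" for x
  proof -
    have cg: "cnj (gauss y) = gauss y" for y by (simp add: gauss_def)
    have "(\<integral>y. u x * gauss y * cnj ((- gauss x) * u y) \<partial>lborel) = (\<integral>y. - (u x * gauss x) * cnj (u y * gauss y) \<partial>lborel)"
      by (rule Bochner_Integration.integral_cong) (auto simp: cg algebra_simps)
    also have "\<dots> = - (u x * gauss x) * cnj S"
      unfolding S_def lborel_integral_cnj[OF ui, symmetric] by (rule integral_mult_right_zero)
    finally have E: "(\<integral>y. u x * gauss y * cnj ((- gauss x) * u y) \<partial>lborel) = - (u x * gauss x) * cnj S" .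
    show ?thesis
      unfolding mass_diff_expand[OF L2_cmult[OF gauss_L2, of "u x"] L2_cmult[OF u, of "- gauss x"]]
        E mass_cmult norm_minus_cancel by simp
  qed
  have "(\<integral>\<^sup>+x. \<integral>\<^sup>+y. ennreal ((norm (?f x - ?f y))\<^sup>2 * (exp (- (norm x)\<^sup>2) * exp (- (norm y)\<^sup>2))) \<partial>lborel \<partial>lborel)
    = (\<integral>\<^sup>+x. ennreal (mass (\<lambda>y. u x * gauss y + (- gauss x) * u y)) \<partial>lborel)"
    unfolding e by (intro nn_integral_cong mass_nn[symmetric] L2_add L2_cmult gauss_L2 u)
  also have "\<dots> = ennreal (\<integral>x. (norm (u x))\<^sup>2 * mass gauss + (norm (gauss x))\<^sup>2 * mass u - 2 * Re (u x * gauss x * cnj S) \<partial>lborel)"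
    unfolding inner
  proof (rule nn_integral_eq_integral)
    show "integrable lborel (\<lambda>x. (norm (u x))\<^sup>2 * mass gauss + (norm (gauss x))\<^sup>2 * mass u - 2 * Re (u x * gauss x * cnj S))"
      by (intro Bochner_Integration.integrable_add Bochner_Integration.integrable_diff integrable_mult_left integrable_mult_right
          L2_D(2) u gauss_L2 integrable_Re ui)
    show "AE x in lborel. 0 \<le> (norm (u x))\<^sup>2 * mass gauss + (norm (gauss x))\<^sup>2 * mass u - 2 * Re (u x * gauss x * cnj S)"
      unfolding inner[symmetric] by (simp add: mass_nonneg)
  qed
  also have "(\<integral>x. (norm (u x))\<^sup>2 * mass gauss + (norm (gauss x))\<^sup>2 * mass u - 2 * Re (u x * gauss x * cnj S) \<partial>lborel)
      = (\<integral>x. (norm (u x))\<^sup>2 * mass gauss + (norm (gauss x))\<^sup>2 * mass u \<partial>lborel) - (\<integral>x. 2 * Re (u x * gauss x * cnj S) \<partial>lborel)"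
    by (intro Bochner_Integration.integral_diff Bochner_Integration.integrable_add integrable_mult_left integrable_mult_right
          L2_D(2) u gauss_L2 integrable_Re ui)
  also have "(\<integral>x. (norm (u x))\<^sup>2 * mass gauss + (norm (gauss x))\<^sup>2 * mass u \<partial>lborel) = mass u * mass gauss + mass gauss * mass u"
    using L2_D(2)[OF u] L2_D(2)[OF gauss_L2] by (simp add: mass_def)
  also have "(\<integral>x. 2 * Re (u x * gauss x * cnj S) \<partial>lborel) = 2 * Re (S * cnj S)"
    unfolding S_def using ui integrable_mult_left[OF ui, of "cnj S"]
    by (simp only: integral_mult_right_zero integral_Re integral_mult_left_zero S_def)
  also have "Re (S * cnj S) = (norm S)\<^sup>2" by (simp add: complex_norm_square[symmetric] flip: of_real_power)
  finally have L: "(\<integral>\<^sup>+x. \<integral>\<^sup>+y. ennreal ((norm (?f x - ?f y))\<^sup>2 * (exp (- (norm x)\<^sup>2) * exp (- (norm y)\<^sup>2))) \<partial>lborel \<partial>lborel)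
    = ennreal (mass u * mass gauss + mass gauss * mass u - 2 * (norm S)\<^sup>2)" .
  have R: "(\<integral>\<^sup>+x. ennreal ((\<Sum>j\<in>UNIV. (norm (?q j x))\<^sup>2) * exp (- (norm x)\<^sup>2)) \<partial>lborel) = ennreal (\<Sum>j\<in>UNIV. mass (?a j))"
    unfolding q using L2_D(2)[OF a]
    by (subst nn_integral_eq_integral) (auto intro!: AE_I2 sum_nonneg simp: mass_def)
  have A0: "0 \<le> (\<Sum>j\<in>UNIV. mass (?a j))" by (simp add: sum_nonneg mass_nonneg)
  have "ennreal (mass u * mass gauss + mass gauss * mass u - 2 * (norm S)\<^sup>2) \<le> ennreal (3 * pi\<^sup>2 / 8 * mass gauss * (\<Sum>j\<in>UNIV. mass (?a j)))"
  proof -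
    have "ennreal (3 * pi\<^sup>2 / 8 * mass gauss * (\<Sum>j\<in>UNIV. mass (?a j))) =
        ennreal (3 * pi\<^sup>2 / 8 * mass gauss) * ennreal (\<Sum>j\<in>UNIV. mass (?a j))"
      using A0 G0 by (intro ennreal_mult) simp_all
    then show ?thesis
      using gauss_variance_bound[OF f] unfolding L R mass_gauss[symmetric] by (simp only:)
  qed
  then have "mass u * mass gauss + mass gauss * mass u - 2 * (norm S)\<^sup>2 \<le> 3 * pi\<^sup>2 / 8 * mass gauss * (\<Sum>j\<in>UNIV. mass (?a j))"
    using A0 G0 by simp
  also have "\<dots> \<le> 6 * mass gauss * (\<Sum>j\<in>UNIV. mass (?a j))"
  proof (intro mult_right_mono A0 less_imp_le[OF G0])
    \<comment> \<open>From \<open>pi < 4\<close>. Halving the resulting 6 gives the constant 3; the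
      sharp value would be \<open>1 / 2\<close>.\<close>
    have "pi\<^sup>2 \<le> 4\<^sup>2" by (intro power_mono) (use pi_less_4 in auto)
    then show "3 * pi\<^sup>2 / 8 \<le> 6" by simp
  qed
  finally have "2 * (mass u * mass gauss - (norm S)\<^sup>2) \<le> 2 * (3 * (\<Sum>j\<in>UNIV. mass (?a j)) * mass gauss)"
    by (simp add: algebra_simps)
  then have "mass u * mass gauss - (norm S)\<^sup>2 \<le> 3 * (\<Sum>j\<in>UNIV. mass (?a j)) * mass gauss"
    by (rule mult_left_le_imp_le) simp
  then show ?thesis unfolding S_def[symmetric] using G0 by (simp add: field_simps)
qed

text \<open>The commutator \<open>[d_j, x_j] = 1\<close> in integrated form: the \<open>j\<close>-th
  derivative of \<open>x_j * |u|^2\<close> has integral zero, so the cross term of each square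
  contributes \<open>- mass u\<close>. Three coordinates give the 3.\<close>

lemma excess_smooth:
  assumes g: "has_grad u p" and u: "u \<in> L2_space" and p: "\<And>j. p j \<in> L2_space"
    and xu: "\<And>j. (\<lambda>x. complex_of_real (x $ j) * u x) \<in> L2_space"
  shows "(\<Sum>j\<in>UNIV. mass (p j)) + (\<Sum>j\<in>UNIV. mass (\<lambda>x. complex_of_real (x $ j) * u x)) =
    3 * mass u + (\<Sum>j\<in>UNIV. mass (\<lambda>x. p j x + complex_of_real (x $ j) * u x))"
proof -
  let ?x = "\<lambda>j x. complex_of_real (x $ j) * u x"
  have cross: "2 * Re (\<integral>x. p j x * cnj (?x j x) \<partial>lborel) = - mass u" for j
  proof -
    note L = L2_integrable_mult
    have G: "has_grad (\<lambda>x. ?x j x * cnj (u x)) (\<lambda>i x. ?x j x * cnj (p i x) +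
       (complex_of_real (x $ j) * p i x + (if i = j then 1 else 0) * u x) * cnj (u x))"
      by (rule has_grad_mult[OF has_grad_mult[OF has_grad_coord g] has_grad_cnj[OF g]])
    have i: "integrable lborel (\<lambda>x. ?x j x * cnj (p j x))" "integrable lborel (\<lambda>x. p j x * cnj (?x j x))"
      "integrable lborel (\<lambda>x. u x * cnj (u x))"
      by (intro L L2_cnj xu p u)+
    have eq: "?x j x * cnj (p j x) + (complex_of_real (x $ j) * p j x + (if j = j then 1 else 0) * u x) * cnj (u x)
      = ?x j x * cnj (p j x) + p j x * cnj (?x j x) + u x * cnj (u x)" for x
      by (simp add: algebra_simps)
    have "(\<integral>x. ?x j x * cnj (p j x) + p j x * cnj (?x j x) + u x * cnj (u x) \<partial>lborel) = 0"
      using integral_grad_zero[OF G, of j] unfolding eq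
      using i by (simp add: L2_integrable_mult[OF xu L2_cnj[OF u]])
    then have "(\<integral>x. ?x j x * cnj (p j x) \<partial>lborel) + (\<integral>x. p j x * cnj (?x j x) \<partial>lborel) + (\<integral>x. u x * cnj (u x) \<partial>lborel) = 0"
      using i by simp
    moreover have "(\<integral>x. ?x j x * cnj (p j x) \<partial>lborel) = cnj (\<integral>x. p j x * cnj (?x j x) \<partial>lborel)"
      unfolding lborel_integral_cnj[OF i(2), symmetric] by (simp add: mult.commute)
    moreover have "(\<integral>x. u x * cnj (u x) \<partial>lborel) = complex_of_real (mass u)"
      by (simp add: mass_def complex_norm_square[symmetric] flip: of_real_power)
    ultimately have "Re (cnj (\<integral>x. p j x * cnj (?x j x) \<partial>lborel) + (\<integral>x. p j x * cnj (?x j x) \<partial>lborel) + complex_of_real (mass u)) = 0"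
      by simp
    then show ?thesis by (simp only: plus_complex.sel cnj.sel Re_complex_of_real)
  qed
  have "mass (\<lambda>x. p j x + ?x j x) = mass (p j) + mass (?x j) - mass u" for j
    using mass_diff_expand[OF p[of j] xu[of j]] cross[of j] by simp
  then show ?thesis by (simp add: sum_3)
qed

section \<open>The form domain of the oscillator\<close>

definition osc :: "(real^3 \<Rightarrow> complex) \<Rightarrow> (3 \<Rightarrow> real^3 \<Rightarrow> complex) \<Rightarrow> bool" where
  "osc u p \<longleftrightarrow> (\<forall>j. weak_partial j u (p j)) \<and> (\<forall>j. (\<lambda>x. complex_of_real (x $ j) * u x) \<in> L2_space)"

text \<open>The operators \<open>d_j + x_j\<close> are, up to normalization, the annihilation
  operators of the oscillator. They kill the Gaussian, and their squares sum to the quadratic form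
  above the ground state energy 3.\<close>

definition excess :: "(real^3 \<Rightarrow> complex) \<Rightarrow> (3 \<Rightarrow> real^3 \<Rightarrow> complex) \<Rightarrow> real" where
  "excess u p = (\<Sum>j\<in>UNIV. mass (\<lambda>x. p j x + complex_of_real (x $ j) * u x))"

definition osc_form :: "(real^3 \<Rightarrow> complex) \<Rightarrow> (3 \<Rightarrow> real^3 \<Rightarrow> complex) \<Rightarrow> real" where
  "osc_form u p = (\<Sum>j\<in>UNIV. mass (p j)) + (\<Sum>j\<in>UNIV. mass (\<lambda>x. complex_of_real (x $ j) * u x))"

lemma osc_D:
  assumes "osc u p"
  shows "u \<in> L2_space" "p j \<in> L2_space" "(\<lambda>x. complex_of_real (x $ j) * u x) \<in> L2_space" "weak_partial j u (p j)"
  using assms by (auto simp: osc_def weak_partial_def)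

lemma excess_nonneg: "0 \<le> excess u p"
  by (simp add: excess_def sum_nonneg mass_nonneg)

text \<open>Every quantity in the two smooth estimates is built from masses of mean square
  convergent sequences; the weighted ones converge by \<open>L2_conv_moll_weight\<close>.\<close>

lemma osc_conv:
  assumes "osc u p"
  shows "has_grad (moll n u) (\<lambda>j. moll n (p j))"
    "(\<lambda>n. osc_form (moll n u) (\<lambda>j. moll n (p j))) \<longlonglongrightarrow> osc_form u p"
    "(\<lambda>n. excess (moll n u) (\<lambda>j. moll n (p j))) \<longlonglongrightarrow> excess u p"
    "(\<lambda>n. mass (moll n u)) \<longlonglongrightarrow> mass u"
    "(\<lambda>x. complex_of_real (x $ j) * moll n u x) \<in> L2_space"
proof -
  note D = osc_D[OF assms]
  note w = L2_conv_moll_weight[OF D(1) D(3)]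
  show "has_grad (moll n u) (\<lambda>j. moll n (p j))" by (rule has_grad_moll[OF D(4)])
  show "(\<lambda>n. osc_form (moll n u) (\<lambda>j. moll n (p j))) \<longlonglongrightarrow> osc_form u p"
    unfolding osc_form_def by (intro tendsto_intros L2_conv_mass L2_conv_moll D w)
  show "(\<lambda>n. excess (moll n u) (\<lambda>j. moll n (p j))) \<longlonglongrightarrow> excess u p"
    unfolding excess_def by (intro tendsto_intros L2_conv_mass L2_conv_add L2_conv_moll D w)
  show "(\<lambda>n. mass (moll n u)) \<longlonglongrightarrow> mass u"
    by (intro L2_conv_mass L2_conv_moll D)
  show "(\<lambda>x. complex_of_real (x $ j) * moll n u x) \<in> L2_space"
    using w[of j] by (simp add: L2_conv_def)
qed

theorem osc_form_eq:
  assumes "osc u p"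
  shows "osc_form u p = 3 * mass u + excess u p"
proof -
  note D = osc_D[OF assms] and C = osc_conv[OF assms]
  have "osc_form (moll n u) (\<lambda>j. moll n (p j)) = 3 * mass (moll n u) + excess (moll n u) (\<lambda>j. moll n (p j))" for n
    unfolding osc_form_def excess_def
    by (rule excess_smooth[OF C(1) moll_contraction(1)[OF D(1)] moll_contraction(1)[OF D(2)] C(5)])
  then have "(\<lambda>n. osc_form (moll n u) (\<lambda>j. moll n (p j))) \<longlonglongrightarrow> 3 * mass u + excess u p"
    by (simp add: C tendsto_add tendsto_mult)
  with C(2) show ?thesis by (rule LIMSEQ_unique)
qed

theorem poincare:
  assumes "osc u p"
  shows "mass u - (norm (\<integral>x. u x * gauss x \<partial>lborel))\<^sup>2 / mass gauss \<le> 3 * excess u p"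
proof -
  note D = osc_D[OF assms] and C = osc_conv[OF assms]
  have "mass (moll n u) - (norm (\<integral>x. moll n u x * gauss x \<partial>lborel))\<^sup>2 / mass gauss \<le> 3 * excess (moll n u) (\<lambda>j. moll n (p j))" for n
    unfolding excess_def
    by (rule poincare_smooth[OF C(1) moll_contraction(1)[OF D(1)]])
      (intro L2_add moll_contraction D C(5))
  moreover have "(\<lambda>n. mass (moll n u) - (norm (\<integral>x. moll n u x * gauss x \<partial>lborel))\<^sup>2 / mass gauss) \<longlonglongrightarrow>
      mass u - (norm (\<integral>x. u x * gauss x \<partial>lborel))\<^sup>2 / mass gauss"
    by (intro tendsto_intros C L2_conv_pairing L2_conv_moll D gauss_L2) (simp add: mass_gauss)
  moreover have "(\<lambda>n. 3 * excess (moll n u) (\<lambda>j. moll n (p j))) \<longlonglongrightarrow> 3 * excess u p"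
    by (intro tendsto_intros C)
  ultimately show ?thesis by (meson LIMSEQ_le)
qed

section \<open>The magnetic form\<close>

lemma borel_measurable_vec_nth [measurable]: "(\<lambda>v::complex^3. v $ j) \<in> borel_measurable borel"
  by (intro borel_measurable_continuous_onI continuous_intros)

lemma norm_cvec3_sq: "(norm (v :: complex^3))\<^sup>2 = (\<Sum>j\<in>UNIV. (norm (v $ j))\<^sup>2)"
  by (simp add: norm_vec_def L2_set_def sum_nonneg)

lemma L2_vec_nth:
  fixes g :: "real^3 \<Rightarrow> complex^3"
  assumes "g \<in> L2_space"
  shows "(\<lambda>x. g x $ j) \<in> L2_space"
proof -
  have [measurable]: "g \<in> borel_measurable borel" using L2_D(1)[OF assms] by (simp add: measurable_lborel2)
  have "(\<lambda>x. g x $ j) \<in> borel_measurable borel" by measurable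
  then show ?thesis
  proof (rule L2_bound(1)[OF _ L2_D(2)[OF assms]])
    show "(norm (g x $ j))\<^sup>2 \<le> (norm (g x))\<^sup>2" for x
      by (intro power_mono Finite_Cartesian_Product.norm_nth_le) simp
  qed
qed

lemma L2_vec_lambda:
  fixes f :: "3 \<Rightarrow> real^3 \<Rightarrow> complex"
  assumes "\<And>j. f j \<in> L2_space"
  shows "(\<lambda>x. \<chi> j. f j x) \<in> L2_space"
proof -
  have [measurable]: "f j \<in> borel_measurable borel" for j by (rule L2_measurable[OF assms])
  have ax: "(axis j :: complex \<Rightarrow> complex^3) \<in> borel_measurable borel" for j :: 3
  proof -
    have "continuous_on UNIV (\<lambda>z::complex. if i = j then z else 0)" for i
      by (cases "i = j") (auto intro: continuous_intros)
    then have "continuous_on UNIV (axis j :: complex \<Rightarrow> complex^3)"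
      unfolding axis_def by (intro continuous_on_vec_lambda)
    then show "(axis j :: complex \<Rightarrow> complex^3) \<in> borel_measurable borel"
      by (rule borel_measurable_continuous_onI)
  qed
  have "(\<lambda>x. \<chi> j. f j x) = (\<lambda>x. \<Sum>j\<in>UNIV. axis j (f j x))"
    by (auto simp: fun_eq_iff vec_eq_iff axis_def if_distrib cong: if_cong)
  moreover have "(\<lambda>x. \<Sum>j\<in>UNIV. axis j (f j x)) \<in> borel_measurable borel"
    by (intro borel_measurable_sum measurable_compose[OF _ ax]) measurable
  ultimately have "(\<lambda>x. \<chi> j. f j x) \<in> borel_measurable borel" by simp
  moreover have "integrable lborel (\<lambda>x. (norm (\<chi> j. f j x))\<^sup>2)"
    unfolding norm_cvec3_sq by (simp add: L2_D(2)[OF assms])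
  ultimately show ?thesis by (simp add: L2_space_def measurable_lborel2)
qed

text \<open>Since \<open>mag_grad\<close> is a choice, this is what lets an explicit field
  representing the same distribution replace it under integrals.\<close>

lemma mag_grad_unique:
  assumes "is_mag_grad A u g" "is_mag_grad A u h"
  shows "AE x in lborel. g x = h x"
proof -
  have L: "(\<lambda>x. g x $ j) \<in> L2_space" "(\<lambda>x. h x $ j) \<in> L2_space" for j
    using assms by (auto simp: is_mag_grad_def intro: L2_vec_nth)
  have "AE x in lborel. g x $ j - h x $ j = 0" for j
  proof (rule L2_vanishing[OF L2_diff[OF L]])
    fix \<phi> assume \<phi>: "\<phi> \<in> test_fun"
    have "(\<integral>x. (g x $ j - h x $ j) * \<phi> x \<partial>lborel) = (\<integral>x. g x $ j * \<phi> x \<partial>lborel) - (\<integral>x. h x $ j * \<phi> x \<partial>lborel)"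
      using L2_integrable_mult[OF L(1) test_fun_grad(2)[OF \<phi>]] L2_integrable_mult[OF L(2) test_fun_grad(2)[OF \<phi>]]
      by (simp add: left_diff_distrib)
    also have "\<dots> = 0" using assms \<phi> by (simp add: is_mag_grad_def)
    finally show "(\<integral>x. (g x $ j - h x $ j) * \<phi> x \<partial>lborel) = 0" .
  qed
  then have "AE x in lborel. \<forall>j\<in>(UNIV::3 set). g x $ j - h x $ j = 0"
    by (intro AE_finite_allI) auto
  then show ?thesis by (rule AE_mp) (auto simp: vec_eq_iff)
qed

lemma mag_grad_is: "u \<in> H1_mag A \<Longrightarrow> is_mag_grad A u (mag_grad A u)"
  unfolding H1_mag_def mag_grad_def using someI_ex[of "is_mag_grad A u"] by auto

lemma A_rot_nth [simp]:
  "A_rot \<rho> x $ 1 = - (\<rho> * x $ 2)" "A_rot \<rho> x $ 2 = \<rho> * x $ 1" "A_rot \<rho> x $ 3 = 0"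
  by (simp_all add: A_rot_def xperp_def)

lemma norm_xperp_sq: "(norm (xperp x))\<^sup>2 = (x $ 1)\<^sup>2 + (x $ 2)\<^sup>2"
  unfolding norm_vec3_sq sum_3 by (simp add: xperp_def)

lemma V_rot_eq: "V_rot \<rho> x = (\<Sum>j\<in>UNIV. (x $ j)\<^sup>2) - \<rho>\<^sup>2 * ((x $ 1)\<^sup>2 + (x $ 2)\<^sup>2)"
  unfolding V_rot_def norm_xperp_sq by (simp add: norm_vec3_sq)

lemma A_rot_mult_L2:
  assumes "\<And>j. (\<lambda>x. complex_of_real (x $ j) * u x) \<in> L2_space"
  shows "(\<lambda>x. complex_of_real (A_rot \<rho> x $ j) * u x) \<in> L2_space"
proof -
  have "(\<lambda>x. complex_of_real (- \<rho>) * (complex_of_real (x $ 2) * u x)) \<in> L2_space"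
    "(\<lambda>x. complex_of_real \<rho> * (complex_of_real (x $ 1) * u x)) \<in> L2_space"
    "(\<lambda>x. complex_of_real 0 * (complex_of_real (x $ 1) * u x)) \<in> L2_space"
    by (intro L2_cmult assms)+
  then show ?thesis using exhaust_3[of j] by (auto simp: mult.assoc)
qed

lemma osc_mag_grad:
  assumes o: "osc u p"
  shows "is_mag_grad (A_rot \<rho>) u (\<lambda>x. \<chi> j. \<i> * p j x + complex_of_real (A_rot \<rho> x $ j) * u x)"
  unfolding is_mag_grad_def
proof (intro conjI ballI allI)
  note D = osc_D[OF o]
  note Au = A_rot_mult_L2[OF D(3)]
  show "(\<lambda>x. \<chi> j. \<i> * p j x + complex_of_real (A_rot \<rho> x $ j) * u x) \<in> L2_space"
    by (intro L2_vec_lambda L2_add L2_cmult D Au)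
  fix \<phi> j assume \<phi>: "\<phi> \<in> test_fun"
  note t = test_fun_grad[OF \<phi>]
  have i: "integrable lborel (\<lambda>x. p j x * \<phi> x)" "integrable lborel (\<lambda>x. complex_of_real (A_rot \<rho> x $ j) * u x * \<phi> x)"
    "integrable lborel (\<lambda>x. u x * partial_deriv j \<phi> x)"
    by (intro L2_integrable_mult D Au t)+
  have "(\<integral>x. (\<chi> j. \<i> * p j x + complex_of_real (A_rot \<rho> x $ j) * u x) $ j * \<phi> x \<partial>lborel) =
      (\<integral>x. \<i> * (p j x * \<phi> x) + complex_of_real (A_rot \<rho> x $ j) * u x * \<phi> x \<partial>lborel)"
    by (simp add: algebra_simps)
  also have "\<dots> = \<i> * (\<integral>x. p j x * \<phi> x \<partial>lborel) + (\<integral>x. complex_of_real (A_rot \<rho> x $ j) * u x * \<phi> x \<partial>lborel)"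
    using i by simp
  also have "(\<integral>x. p j x * \<phi> x \<partial>lborel) = - (\<integral>x. u x * partial_deriv j \<phi> x \<partial>lborel)"
    using D(4)[of j] \<phi> by (simp add: weak_partial_def)
  also have "\<i> * - (\<integral>x. u x * partial_deriv j \<phi> x \<partial>lborel) + (\<integral>x. complex_of_real (A_rot \<rho> x $ j) * u x * \<phi> x \<partial>lborel) =
     (\<integral>x. (- \<i>) * (u x * partial_deriv j \<phi> x) + complex_of_real (A_rot \<rho> x $ j) * u x * \<phi> x \<partial>lborel)"
    using i by simp
  also have "\<dots> = (\<integral>x. u x * (- \<i> * partial_deriv j \<phi> x + complex_of_real (A_rot \<rho> x $ j) * \<phi> x) \<partial>lborel)"
    by (simp add: algebra_simps)
  finally show "(\<integral>x. (\<chi> j. \<i> * p j x + complex_of_real (A_rot \<rho> x $ j) * u x) $ j * \<phi> x \<partial>lborel) =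
     (\<integral>x. u x * (- \<i> * partial_deriv j \<phi> x + complex_of_real (A_rot \<rho> x $ j) * \<phi> x) \<partial>lborel)" .
qed

lemma osc_V_integrable:
  assumes o: "osc u p"
  shows "integrable lborel (\<lambda>x. V_rot \<rho> x * (norm (u x))\<^sup>2)"
proof -
  have i: "integrable lborel (\<lambda>x. (x $ j)\<^sup>2 * (norm (u x))\<^sup>2)" for j
    using L2_D(2)[OF osc_D(3)[OF o, of j]] by (simp add: norm_mult power_mult_distrib)
  have "V_rot \<rho> x * (norm (u x))\<^sup>2 = (\<Sum>j\<in>UNIV. (x $ j)\<^sup>2 * (norm (u x))\<^sup>2) -
      (\<rho>\<^sup>2 * ((x $ 1)\<^sup>2 * (norm (u x))\<^sup>2) + \<rho>\<^sup>2 * ((x $ 2)\<^sup>2 * (norm (u x))\<^sup>2))" for x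
    by (simp add: V_rot_eq sum_3 algebra_simps)
  then show ?thesis using i by simp
qed

lemma osc_Sigma: "osc u p \<Longrightarrow> u \<in> Sigma_space (A_rot \<rho>) (V_rot \<rho>)"
  unfolding Sigma_space_def H1_mag_def
  using osc_mag_grad osc_D(1) osc_V_integrable by blast

text \<open>For \<open>|\<rho>| \<le> 1 / 2\<close> the potential dominates
  \<open>|x|^2 / 2\<close>, so finite potential energy gives finite second moments. Then
  \<open>A u\<close> is square integrable, and the weak gradient is recovered as
  \<open>- \<i> * (G - A u)\<close> from the magnetic gradient \<open>G\<close>.\<close>

lemma Sigma_osc:
  assumes u: "u \<in> Sigma_space (A_rot \<rho>) (V_rot \<rho>)" and r: "\<bar>\<rho>\<bar> \<le> 1 / 2"
  obtains p where "osc u p"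
proof -
  have uL: "u \<in> L2_space" and H: "u \<in> H1_mag (A_rot \<rho>)"
    and V: "integrable lborel (\<lambda>x. V_rot \<rho> x * (norm (u x))\<^sup>2)"
    using u by (auto simp: Sigma_space_def H1_mag_def)
  note [measurable] = L2_measurable[OF uL]
  let ?A = "A_rot \<rho>"
  define G where "G = mag_grad ?A u"
  have G: "is_mag_grad ?A u G" unfolding G_def by (rule mag_grad_is[OF H])
  have GL: "(\<lambda>x. G x $ j) \<in> L2_space" for j
    using G by (intro L2_vec_nth) (simp add: is_mag_grad_def)
  have xu: "(\<lambda>x. complex_of_real (x $ j) * u x) \<in> L2_space" for j
  proof (rule L2_bound(1)[OF _ integrable_mult_right[OF V, of 2]])
    fix x :: "real^3"
    have "\<rho>\<^sup>2 \<le> (1 / 2)\<^sup>2" using r by (metis abs_ge_zero power2_abs power_mono)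
    then have "\<rho>\<^sup>2 * ((x $ 1)\<^sup>2 + (x $ 2)\<^sup>2) \<le> (1 / 2) * ((x $ 1)\<^sup>2 + (x $ 2)\<^sup>2)"
      by (intro mult_right_mono) (auto simp: power2_eq_square)
    moreover have "V_rot \<rho> x = (x $ 1)\<^sup>2 + (x $ 2)\<^sup>2 + (x $ 3)\<^sup>2 - K"
      if "K = \<rho>\<^sup>2 * ((x $ 1)\<^sup>2 + (x $ 2)\<^sup>2)" for K
      using that by (simp add: V_rot_eq sum_3)
    ultimately have "(x $ 1)\<^sup>2 + (x $ 2)\<^sup>2 + (x $ 3)\<^sup>2 \<le> 2 * V_rot \<rho> x"
      using zero_le_power2[of "x $ 3"] by fastforce
    then have "(x $ 1)\<^sup>2 \<le> 2 * V_rot \<rho> x \<and> (x $ 2)\<^sup>2 \<le> 2 * V_rot \<rho> x \<and> (x $ 3)\<^sup>2 \<le> 2 * V_rot \<rho> x"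
      using zero_le_power2[of "x $ 1"] zero_le_power2[of "x $ 2"] zero_le_power2[of "x $ 3"]
      by linarith
    then have "(x $ j)\<^sup>2 \<le> 2 * V_rot \<rho> x"
      using exhaust_3[of j] by auto
    then show "(norm (complex_of_real (x $ j) * u x))\<^sup>2 \<le> 2 * (V_rot \<rho> x * (norm (u x))\<^sup>2)"
      using mult_right_mono[of "(x $ j)\<^sup>2" "2 * V_rot \<rho> x" "(norm (u x))\<^sup>2"]
      by (simp add: norm_mult power_mult_distrib)
  qed measurable
  note Au = A_rot_mult_L2[OF xu]
  define p where "p j x = - \<i> * (G x $ j - complex_of_real (?A x $ j) * u x)" for j x
  have pL: "p j \<in> L2_space" for j unfolding p_def by (intro L2_cmult L2_diff GL Au)
  have "weak_partial j u (p j)" for j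
    unfolding weak_partial_def
  proof (intro conjI uL pL ballI)
    fix \<phi> assume \<phi>: "\<phi> \<in> test_fun"
    note t = test_fun_grad[OF \<phi>]
    have i: "integrable lborel (\<lambda>x. G x $ j * \<phi> x)" "integrable lborel (\<lambda>x. complex_of_real (?A x $ j) * u x * \<phi> x)"
      "integrable lborel (\<lambda>x. u x * partial_deriv j \<phi> x)"
      by (intro L2_integrable_mult uL GL Au t)+
    have "(\<integral>x. p j x * \<phi> x \<partial>lborel) = (\<integral>x. - \<i> * (G x $ j * \<phi> x) + \<i> * (complex_of_real (?A x $ j) * u x * \<phi> x) \<partial>lborel)"
      by (simp add: p_def algebra_simps)
    also have "\<dots> = - \<i> * (\<integral>x. G x $ j * \<phi> x \<partial>lborel) + \<i> * (\<integral>x. complex_of_real (?A x $ j) * u x * \<phi> x \<partial>lborel)"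
      using i by simp
    also have "(\<integral>x. G x $ j * \<phi> x \<partial>lborel) = (\<integral>x. u x * (- \<i> * partial_deriv j \<phi> x + complex_of_real (?A x $ j) * \<phi> x) \<partial>lborel)"
      using G \<phi> by (simp add: is_mag_grad_def)
    also have "\<dots> = (\<integral>x. (- \<i>) * (u x * partial_deriv j \<phi> x) + complex_of_real (?A x $ j) * u x * \<phi> x \<partial>lborel)"
      by (simp add: algebra_simps)
    also have "\<dots> = - \<i> * (\<integral>x. u x * partial_deriv j \<phi> x \<partial>lborel) + (\<integral>x. complex_of_real (?A x $ j) * u x * \<phi> x \<partial>lborel)"
      using i by simp
    finally show "(\<integral>x. p j x * \<phi> x \<partial>lborel) = - (\<integral>x. u x * partial_deriv j \<phi> x \<partial>lborel)"
      by (simp add: algebra_simps)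
  qed
  with xu have "osc u p" by (simp add: osc_def)
  then show ?thesis by (rule that)
qed

lemma osc_mag_grad_AE:
  assumes o: "osc u p"
  shows "AE x in lborel. mag_grad (A_rot \<rho>) u x = (\<chi> j. \<i> * p j x + complex_of_real (A_rot \<rho> x $ j) * u x)"
proof (rule mag_grad_unique[OF mag_grad_is osc_mag_grad[OF o]])
  show "u \<in> H1_mag (A_rot \<rho>)" using osc_Sigma[OF o] by (simp add: Sigma_space_def)
qed

text \<open>Minus the expectation of the third angular momentum component
  \<open>- \<i> * (x_1 d_2 - x_2 d_1)\<close>.\<close>

definition rot_form :: "(real^3 \<Rightarrow> complex) \<Rightarrow> (3 \<Rightarrow> real^3 \<Rightarrow> complex) \<Rightarrow> real" where
  "rot_form u p = Re (\<i> * ((\<integral>x. p 2 x * cnj (complex_of_real (x $ 1) * u x) \<partial>lborel) -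
     (\<integral>x. p 1 x * cnj (complex_of_real (x $ 2) * u x) \<partial>lborel)))"

lemma Sigma_dot_osc:
  assumes o: "osc u p"
  shows "Sigma_dot_norm_sq (A_rot \<rho>) (V_rot \<rho>) u = osc_form u p + 2 * \<rho> * rot_form u p"
proof -
  note D = osc_D[OF o]
  let ?x = "\<lambda>j x. complex_of_real (x $ j) * u x"
  have i: "integrable lborel (\<lambda>x. p 2 x * cnj (?x 1 x))" "integrable lborel (\<lambda>x. p 1 x * cnj (?x 2 x))"
    by (intro L2_integrable_mult D L2_cnj)+
  let ?R = "\<lambda>x. \<i> * (p 2 x * cnj (?x 1 x) - p 1 x * cnj (?x 2 x))"
  have iR: "integrable lborel ?R" using i by simp
  have pt: "(norm (\<chi> j. \<i> * p j x + complex_of_real (A_rot \<rho> x $ j) * u x))\<^sup>2 + V_rot \<rho> x * (norm (u x))\<^sup>2 =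
    (\<Sum>j\<in>UNIV. (norm (p j x))\<^sup>2) + (\<Sum>j\<in>UNIV. (norm (?x j x))\<^sup>2) + 2 * \<rho> * Re (?R x)" for x
    unfolding norm_cvec3_sq V_rot_eq sum_3 cmod_power2
    by (simp add: power2_eq_square algebra_simps)
  have "Sigma_dot_norm_sq (A_rot \<rho>) (V_rot \<rho>) u =
    (\<integral>x. (\<Sum>j\<in>UNIV. (norm (p j x))\<^sup>2) + (\<Sum>j\<in>UNIV. (norm (?x j x))\<^sup>2) + 2 * \<rho> * Re (?R x) \<partial>lborel)"
    unfolding Sigma_dot_norm_sq_def
  proof (rule integral_cong_AE)
    have 1: "(\<lambda>x. (norm (mag_grad (A_rot \<rho>) u x))\<^sup>2) \<in> borel_measurable lborel"
      using mag_grad_is[of u "A_rot \<rho>"] osc_Sigma[OF o, of \<rho>]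
      by (auto simp: Sigma_space_def is_mag_grad_def dest!: L2_D(2))
    have 2: "(\<lambda>x. V_rot \<rho> x * (norm (u x))\<^sup>2) \<in> borel_measurable lborel"
      using osc_V_integrable[OF o] by auto
    show "(\<lambda>x. (norm (mag_grad (A_rot \<rho>) u x))\<^sup>2 + V_rot \<rho> x * (norm (u x))\<^sup>2) \<in> borel_measurable lborel"
      by (rule borel_measurable_add[OF 1 2])
    show "(\<lambda>x. (\<Sum>j\<in>UNIV. (norm (p j x))\<^sup>2) + (\<Sum>j\<in>UNIV. (norm (?x j x))\<^sup>2) + 2 * \<rho> * Re (?R x)) \<in> borel_measurable lborel"
      using L2_D(2)[OF D(2)] L2_D(2)[OF D(3)] integrable_Re[OF iR]
      by (intro borel_measurable_add borel_measurable_sum borel_measurable_times borel_measurable_const)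
        (simp_all only: borel_measurable_integrable)
    show "AE x in lborel. (norm (mag_grad (A_rot \<rho>) u x))\<^sup>2 + V_rot \<rho> x * (norm (u x))\<^sup>2 =
      (\<Sum>j\<in>UNIV. (norm (p j x))\<^sup>2) + (\<Sum>j\<in>UNIV. (norm (?x j x))\<^sup>2) + 2 * \<rho> * Re (?R x)"
      using osc_mag_grad_AE[OF o, of \<rho>] by eventually_elim (simp only: pt)
  qed
  also have "\<dots> = (\<integral>x. (\<Sum>j\<in>UNIV. (norm (p j x))\<^sup>2) \<partial>lborel) + (\<integral>x. (\<Sum>j\<in>UNIV. (norm (?x j x))\<^sup>2) \<partial>lborel) + 2 * \<rho> * Re (\<integral>x. ?R x \<partial>lborel)"
    using L2_D(2)[OF D(2)] L2_D(2)[OF D(3)] integrable_Re[OF iR]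
    by (simp only: Bochner_Integration.integral_add Bochner_Integration.integrable_add Bochner_Integration.integrable_sum
        integrable_mult_right integral_mult_right_zero integral_Re[OF iR])
  also have "(\<integral>x. (\<Sum>j\<in>UNIV. (norm (p j x))\<^sup>2) \<partial>lborel) + (\<integral>x. (\<Sum>j\<in>UNIV. (norm (?x j x))\<^sup>2) \<partial>lborel) = osc_form u p"
    unfolding osc_form_def mass_def
    by (simp only: Bochner_Integration.integral_sum L2_D(2)[OF D(2)] L2_D(2)[OF D(3)])
  also have "Re (\<integral>x. ?R x \<partial>lborel) = rot_form u p"
    unfolding rot_form_def using i by (simp only: integral_mult_right_zero Bochner_Integration.integral_diff)
  finally show ?thesis .
qed

lemma abs_two_Re_pairing_le:
  assumes "f \<in> L2_space" "g \<in> L2_space" "norm c = 1"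
  shows "\<bar>2 * Re (c * (\<integral>x. f x * cnj (g x) \<partial>lborel))\<bar> \<le> mass f + mass g"
proof -
  let ?I = "\<integral>x. f x * cnj (g x) \<partial>lborel"
  have "mass (\<lambda>x. cnj (g x)) = mass g" by (simp add: mass_def)
  then have "(norm ?I)\<^sup>2 \<le> mass f * mass g"
    using L2_cauchy_schwarz[OF assms(1) L2_cnj[OF assms(2)]] by simp
  then have "norm ?I \<le> sqrt (mass f * mass g)" by (rule real_le_rsqrt)
  also have "\<dots> \<le> (mass f + mass g) / 2" by (rule arith_geo_mean_sqrt) (simp_all add: mass_nonneg)
  finally have "2 * norm ?I \<le> mass f + mass g" by simp
  moreover have "\<bar>Re (c * ?I)\<bar> \<le> norm ?I"
    using abs_Re_le_cmod[of "c * ?I"] assms(3) by (simp add: norm_mult)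
  ultimately show ?thesis by simp
qed

text \<open>The arithmetic-geometric mean inequality on the two pairings uses four of the six
  squares in \<open>osc_form\<close>.\<close>

lemma rot_form_bound:
  assumes o: "osc u p"
  shows "\<bar>2 * rot_form u p\<bar> \<le> osc_form u p"
proof -
  note D = osc_D[OF o]
  let ?x = "\<lambda>j x. complex_of_real (x $ j) * u x"
  have "\<bar>2 * rot_form u p\<bar> \<le> (mass (p 2) + mass (?x 1)) + (mass (p 1) + mass (?x 2))"
    using abs_two_Re_pairing_le[OF D(2)[of 2] D(3)[of 1], of \<i>] abs_two_Re_pairing_le[OF D(2)[of 1] D(3)[of 2], of \<i>]
    unfolding rot_form_def right_diff_distrib by simp
  also have "\<dots> \<le> osc_form u p" by (simp add: osc_form_def sum_3 mass_nonneg)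
  finally show ?thesis .
qed

text \<open>The gradient of \<open>u - l * gauss\<close>; the sign is plus because the
  \<open>j\<close>-th derivative of \<open>gauss\<close> is \<open>- x_j * gauss\<close>.\<close>

definition proj_grad :: "complex \<Rightarrow> (3 \<Rightarrow> real^3 \<Rightarrow> complex) \<Rightarrow> 3 \<Rightarrow> real^3 \<Rightarrow> complex" where
  "proj_grad l p j x = p j x + l * (complex_of_real (x $ j) * gauss x)"

text \<open>The excess is unchanged pointwise, since \<open>d_j + x_j\<close> kills the Gaussian. In
  the rotation term, the Gaussian part of the gradient cancels pointwise because
  \<open>x_1 x_2\<close> enters with both signs; what is paired with the Gaussian becomes symmetric
  in the two indices after integration by parts and cancels as well.\<close>

lemma osc_proj:
  assumes o: "osc u p"
  shows "osc (\<lambda>x. u x - l * gauss x) (proj_grad l p)"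
    "excess (\<lambda>x. u x - l * gauss x) (proj_grad l p) = excess u p"
    "rot_form u p = rot_form (\<lambda>x. u x - l * gauss x) (proj_grad l p)"
proof -
  note D = osc_D[OF o]
  let ?w = "\<lambda>x. u x - l * gauss x"
  let ?p = "proj_grad l p"
  have wL: "?w \<in> L2_space" by (intro L2_diff L2_cmult gauss_L2 D)
  have pL: "?p j \<in> L2_space" for j
    unfolding proj_grad_def[abs_def] by (intro L2_add L2_cmult coord_gauss_L2 D)
  have xw: "(\<lambda>x. complex_of_real (x $ j) * ?w x) \<in> L2_space" for j
  proof -
    have "(\<lambda>x. complex_of_real (x $ j) * u x - l * (complex_of_real (x $ j) * gauss x)) \<in> L2_space"
      by (intro L2_diff L2_cmult coord_gauss_L2 D)
    then show ?thesis by (simp add: algebra_simps)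
  qed
  have wp: "weak_partial j ?w (?p j)" for j
    unfolding weak_partial_def
  proof (intro conjI wL pL ballI)
    fix \<phi> assume \<phi>: "\<phi> \<in> test_fun"
    note t = test_fun_grad[OF \<phi>]
    have i: "integrable lborel (\<lambda>x. p j x * \<phi> x)" "integrable lborel (\<lambda>x. complex_of_real (x $ j) * gauss x * \<phi> x)"
      "integrable lborel (\<lambda>x. u x * partial_deriv j \<phi> x)" "integrable lborel (\<lambda>x. gauss x * partial_deriv j \<phi> x)"
      by (intro L2_integrable_mult D gauss_L2 coord_gauss_L2 t)+
    have g: "(\<integral>x. complex_of_real (x $ j) * gauss x * \<phi> x \<partial>lborel) = (\<integral>x. gauss x * partial_deriv j \<phi> x \<partial>lborel)"
      using gauss_weak_partial[of j] \<phi> by (simp add: weak_partial_def)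
    have "(\<integral>x. ?p j x * \<phi> x \<partial>lborel) = (\<integral>x. p j x * \<phi> x + l * (complex_of_real (x $ j) * gauss x * \<phi> x) \<partial>lborel)"
      by (simp add: proj_grad_def algebra_simps)
    also have "\<dots> = (\<integral>x. p j x * \<phi> x \<partial>lborel) + l * (\<integral>x. gauss x * partial_deriv j \<phi> x \<partial>lborel)"
      using i by (simp add: g)
    also have "(\<integral>x. p j x * \<phi> x \<partial>lborel) = - (\<integral>x. u x * partial_deriv j \<phi> x \<partial>lborel)"
      using D(4)[of j] \<phi> by (simp add: weak_partial_def)
    also have "- (\<integral>x. u x * partial_deriv j \<phi> x \<partial>lborel) + l * (\<integral>x. gauss x * partial_deriv j \<phi> x \<partial>lborel) =
        - (\<integral>x. u x * partial_deriv j \<phi> x - l * (gauss x * partial_deriv j \<phi> x) \<partial>lborel)"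
      using i by simp
    also have "(\<integral>x. u x * partial_deriv j \<phi> x - l * (gauss x * partial_deriv j \<phi> x) \<partial>lborel) = (\<integral>x. ?w x * partial_deriv j \<phi> x \<partial>lborel)"
      by (simp add: algebra_simps)
    finally show "(\<integral>x. ?p j x * \<phi> x \<partial>lborel) = - (\<integral>x. ?w x * partial_deriv j \<phi> x \<partial>lborel)" .
  qed
  show "osc ?w ?p" using wp xw by (simp add: osc_def)
  show "excess ?w ?p = excess u p"
    unfolding excess_def proj_grad_def by (intro sum.cong refl arg_cong[of _ _ mass]) (simp add: fun_eq_iff algebra_simps)
  let ?x = "\<lambda>j x. complex_of_real (x $ j)"
  \<comment> \<open>For \<open>i \<noteq> k\<close> the diagonal term in the derivative of
    \<open>x_k * gauss\<close> is absent, which leaves the symmetric weight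
    \<open>x_k * x_i * gauss\<close>.\<close>
  have ibp: "(\<integral>x. ?p i x * (?x k x * gauss x) \<partial>lborel) = (\<integral>x. ?w x * (?x k x * (?x i x * gauss x)) \<partial>lborel)" if "i \<noteq> k" for i k
    using integration_by_parts[OF wp has_grad_coord_gauss coord_gauss_L2(1) coord_gauss_deriv_L2, of i k] that by simp
  have eq: "(\<integral>x. ?p 2 x * (?x 1 x * gauss x) \<partial>lborel) = (\<integral>x. ?p 1 x * (?x 2 x * gauss x) \<partial>lborel)"
    unfolding ibp[of 2 1, simplified] ibp[of 1 2, simplified] by (simp add: algebra_simps)
  have I: "integrable lborel (\<lambda>x. ?p i x * cnj (?x k x * ?w x))" "integrable lborel (\<lambda>x. ?p i x * (?x k x * gauss x))"
     "integrable lborel (\<lambda>x. p i x * cnj (?x k x * u x))" for i k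
    by (intro L2_integrable_mult L2_cnj pL xw coord_gauss_L2 D)+
  have cg: "cnj (gauss x) = gauss x" for x by (simp add: gauss_def)
  have "p 2 x * cnj (?x 1 x * u x) - p 1 x * cnj (?x 2 x * u x) =
    (?p 2 x * cnj (?x 1 x * ?w x) - ?p 1 x * cnj (?x 2 x * ?w x)) +
    cnj l * (?p 2 x * (?x 1 x * gauss x) - ?p 1 x * (?x 2 x * gauss x))" for x
    by (simp add: proj_grad_def cg algebra_simps)
  then have "(\<integral>x. p 2 x * cnj (?x 1 x * u x) - p 1 x * cnj (?x 2 x * u x) \<partial>lborel) =
    (\<integral>x. (?p 2 x * cnj (?x 1 x * ?w x) - ?p 1 x * cnj (?x 2 x * ?w x)) +
    cnj l * (?p 2 x * (?x 1 x * gauss x) - ?p 1 x * (?x 2 x * gauss x)) \<partial>lborel)" by presburger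
  then have "(\<integral>x. p 2 x * cnj (?x 1 x * u x) \<partial>lborel) - (\<integral>x. p 1 x * cnj (?x 2 x * u x) \<partial>lborel) =
    (\<integral>x. ?p 2 x * cnj (?x 1 x * ?w x) \<partial>lborel) - (\<integral>x. ?p 1 x * cnj (?x 2 x * ?w x) \<partial>lborel) +
    cnj l * ((\<integral>x. ?p 2 x * (?x 1 x * gauss x) \<partial>lborel) - (\<integral>x. ?p 1 x * (?x 2 x * gauss x) \<partial>lborel))"
    by (simp only: I Bochner_Integration.integral_diff Bochner_Integration.integral_add Bochner_Integration.integrable_diff
        integrable_mult_right integral_mult_right_zero)
  then show "rot_form u p = rot_form ?w ?p" unfolding rot_form_def eq by simp
qed

lemma gauss_coeff_mass: "gauss_coeff u * complex_of_real (mass gauss) = (\<integral>x. u x * gauss x \<partial>lborel)"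
  by (simp add: gauss_coeff_def mass_gauss)

text \<open>The projection onto the Gaussian changes neither the excess nor the rotation term, so the
  latter is controlled by the excess as well.\<close>

theorem spectral_gap:
  assumes o: "osc u p" and r: "\<bar>\<rho>\<bar> \<le> 1 / 20"
  defines "Q \<equiv> Sigma_dot_norm_sq (A_rot \<rho>) (V_rot \<rho>) u"
  shows "3 * mass u + excess u p / 2 \<le> Q"
    "Q \<le> 3 * mass u + 2 * excess u p"
    "Sigma_norm_sq (A_rot \<rho>) (V_rot \<rho>) (\<lambda>x. u x - gauss_coeff u * gauss x) \<le> 23 * excess u p"
    "osc_form u p \<le> 2 * Q"
proof -
  let ?l = "gauss_coeff u"
  let ?w = "\<lambda>x. u x - ?l * gauss x" and ?p = "proj_grad ?l p"
  let ?E = "excess u p"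
  note D = osc_D[OF o] and P = osc_proj[OF o, of ?l]
  have E0: "0 \<le> ?E" by (rule excess_nonneg)
  have gg: "(\<integral>x. gauss x * gauss x \<partial>lborel) = complex_of_real (mass gauss)"
    by (simp add: mass_def gauss_def power2_eq_square flip: of_real_mult)
  have "(\<integral>x. ?w x * gauss x \<partial>lborel) = (\<integral>x. u x * gauss x \<partial>lborel) - ?l * (\<integral>x. gauss x * gauss x \<partial>lborel)"
    using L2_integrable_mult[OF D(1) gauss_L2] L2_integrable_mult[OF gauss_L2 gauss_L2]
    by (simp add: left_diff_distrib mult.assoc)
  then have "(\<integral>x. ?w x * gauss x \<partial>lborel) = 0" by (simp add: gg gauss_coeff_mass)
  then have mw: "mass ?w \<le> 3 * ?E" using poincare[OF P(1)] P(2) by simp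
  have ow: "osc_form ?w ?p = 3 * mass ?w + ?E" using osc_form_eq[OF P(1)] P(2) by simp
  \<comment> \<open>Here \<open>3 * 3 + 1 = 10\<close>. With \<open>|\<rho>| \<le> 1 / 20\<close>
    the rotation term is then at most half the excess, which is the origin of that
    threshold.\<close>
  have rw: "\<bar>2 * rot_form ?w ?p\<bar> \<le> 10 * ?E" using rot_form_bound[OF P(1)] ow mw by linarith
  have small: "\<bar>2 * \<rho> * a\<bar> \<le> b / 20" if "\<bar>2 * a\<bar> \<le> b" for a b
  proof -
    have "\<bar>\<rho>\<bar> * \<bar>2 * a\<bar> \<le> 1 / 20 * b" by (intro mult_mono r that) auto
    then show ?thesis by (simp add: abs_mult mult_ac)
  qed
  have Q: "Q = 3 * mass u + ?E + 2 * \<rho> * rot_form ?w ?p"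
    unfolding Q_def Sigma_dot_osc[OF o] osc_form_eq[OF o] P(3) ..
  show "3 * mass u + ?E / 2 \<le> Q" "Q \<le> 3 * mass u + 2 * ?E"
    using small[OF rw] E0 unfolding Q by linarith+
  have "Sigma_norm_sq (A_rot \<rho>) (V_rot \<rho>) ?w = osc_form ?w ?p + 2 * \<rho> * rot_form ?w ?p + mass ?w"
    unfolding Sigma_norm_sq_def Sigma_dot_osc[OF P(1)] ..
  \<comment> \<open>The three summands are at most \<open>10\<close>, \<open>1 / 2\<close> and
    \<open>3\<close> times the excess; 23 is a generous total.\<close>
  then show "Sigma_norm_sq (A_rot \<rho>) (V_rot \<rho>) ?w \<le> 23 * ?E"
    using small[OF rw] ow mw E0 by linarith
  have o0: "0 \<le> osc_form u p" by (simp add: osc_form_def sum_nonneg mass_nonneg)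
  \<comment> \<open>Now the rotation bound is used for \<open>u\<close> itself: it takes away at
    most a twentieth of the form.\<close>
  have "osc_form u p \<le> 2 * (osc_form u p + t)" if "\<bar>t\<bar> \<le> osc_form u p / 20" for t
    using that o0 by (auto simp: abs_le_iff)
  from this[OF small[OF rot_form_bound[OF o]]]
  show "osc_form u p \<le> 2 * Q" unfolding Q_def Sigma_dot_osc[OF o] .
qed

lemma Sigma_quartic_bound:
  assumes o: "osc u p" and r: "\<bar>\<rho>\<bar> \<le> 1 / 20"
  defines "Q \<equiv> Sigma_dot_norm_sq (A_rot \<rho>) (V_rot \<rho>) u"
  shows "(\<integral>x. (norm (u x))^4 \<partial>lborel) \<le> sqrt (3456 * mass u * Q ^ 3)" "0 \<le> Q"
proof -
  have E0: "0 \<le> excess u p" by (rule excess_nonneg)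
  have xp: "0 \<le> (\<Sum>j\<in>UNIV. mass (\<lambda>x. complex_of_real (x $ j) * u x))" "0 \<le> (\<Sum>j\<in>UNIV. mass (p j))"
    by (simp_all add: sum_nonneg mass_nonneg)
  have M: "0 \<le> mass u" by (rule mass_nonneg)
  have g: "3 * mass u + excess u p / 2 \<le> Q" "osc_form u p \<le> 2 * Q"
    using spectral_gap[OF o r] unfolding Q_def by auto
  show Q0: "0 \<le> Q" using g E0 M by linarith
  have "(\<Sum>j\<in>UNIV. mass (p j)) \<le> 2 * Q" using g(2) xp unfolding osc_form_def by linarith
  \<comment> \<open>The gradient contributes at most \<open>4 * Q\<close> and \<open>mass u\<close>
    at most \<open>Q / 3\<close>. Rounding up to \<open>6 * Q\<close> yields the constant
    \<open>3456 = 16 * 6 ^ 3\<close>.\<close>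
  then have le: "2 * (\<Sum>j\<in>UNIV. mass (p j)) + mass u \<le> 6 * Q" using g(1) E0 Q0 M by linarith
  have "(\<integral>x. (norm (u x))^4 \<partial>lborel) \<le> sqrt (16 * mass u * (2 * (\<Sum>j\<in>UNIV. mass (p j)) + mass u) ^ 3)"
    by (rule L4_bound(2)[OF osc_D(4)[OF o]])
  also have "\<dots> \<le> sqrt (16 * mass u * (6 * Q) ^ 3)"
    using le xp M by (intro real_sqrt_le_mono mult_left_mono power_mono) auto
  also have "16 * mass u * (6 * Q) ^ 3 = 3456 * mass u * Q ^ 3" by (simp add: power_mult_distrib)
  finally show "(\<integral>x. (norm (u x))^4 \<partial>lborel) \<le> sqrt (3456 * mass u * Q ^ 3)" .
qed

section \<open>Minimizers of small mass\<close>

text \<open>Obtained by subtracting a multiple of the Gaussian from the zero function, so that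
  \<open>osc_proj\<close> does the work.\<close>

lemma osc_gauss: "osc (\<lambda>x. k * gauss x) (\<lambda>j x. - (k * (complex_of_real (x $ j) * gauss x)))"
proof -
  have z: "osc (\<lambda>x. 0) (\<lambda>j x. 0)"
    by (auto simp: osc_def weak_partial_def L2_space_def)
  have "(\<lambda>x. 0 - - k * gauss x) = (\<lambda>x. k * gauss x)"
    "proj_grad (- k) (\<lambda>j x. 0) = (\<lambda>j x. - (k * (complex_of_real (x $ j) * gauss x)))"
    by (simp_all add: proj_grad_def fun_eq_iff)
  with osc_proj(1)[OF z, of "- k"] show ?thesis by simp
qed

text \<open>The competitor for the minimization is a Gaussian. It has zero excess, so the two bounds
  of \<open>spectral_gap\<close> meet and fix its quadratic form at \<open>3 * c\<close> for every
  admissible \<open>\<rho>\<close>; the quartic term only lowers the energy.\<close>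

lemma energy_gauss_le:
  assumes r: "\<bar>\<rho>\<bar> \<le> 1 / 20" and c: "0 < c"
  obtains v where "v \<in> mass_sphere (A_rot \<rho>) (V_rot \<rho>) c" "Sigma_dot_norm_sq (A_rot \<rho>) (V_rot \<rho>) v = 3 * c"
    "energy (A_rot \<rho>) (V_rot \<rho>) v \<le> 3 / 2 * c"
proof -
  define k where "k = complex_of_real (sqrt (c / mass gauss))"
  let ?v = "\<lambda>x. k * gauss x" and ?p = "\<lambda>j x. - (k * (complex_of_real (x $ j) * gauss x))"
  have o: "osc ?v ?p" by (rule osc_gauss)
  have G: "0 < mass gauss" by (simp add: mass_gauss)
  have m: "mass ?v = c" using c G by (simp add: mass_cmult k_def)
  have "excess ?v ?p = 0" by (simp add: excess_def mass_def)
  then have Q: "Sigma_dot_norm_sq (A_rot \<rho>) (V_rot \<rho>) ?v = 3 * c"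
    using spectral_gap(1,2)[OF o r] m by simp
  have "energy (A_rot \<rho>) (V_rot \<rho>) ?v \<le> 3 / 2 * c"
    unfolding energy_def Q by simp
  then show ?thesis using that[of ?v] osc_Sigma[OF o] m Q by (simp add: mass_sphere_def)
qed

text \<open>The equation tested with its own solution. Splitting the integral requires each term to
  be integrable; for the quartic one this is \<open>L4_bound\<close>.\<close>

lemma weak_solution_test_self:
  assumes o: "osc u p" and w: "weak_solution (A_rot \<rho>) (V_rot \<rho>) c u lam"
  shows "Sigma_dot_norm_sq (A_rot \<rho>) (V_rot \<rho>) u - lam * mass u - (\<integral>x. (norm (u x))^4 \<partial>lborel) = 0"
proof -
  let ?G = "mag_grad (A_rot \<rho>) u"
  have S: "u \<in> Sigma_space (A_rot \<rho>) (V_rot \<rho>)" by (rule osc_Sigma[OF o])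
  have "is_mag_grad (A_rot \<rho>) u ?G" using S by (intro mag_grad_is) (simp add: Sigma_space_def)
  then have iG: "integrable lborel (\<lambda>x. (norm (?G x))\<^sup>2)" by (auto simp: is_mag_grad_def dest: L2_D(2))
  have iV: "integrable lborel (\<lambda>x. V_rot \<rho> x * (norm (u x))\<^sup>2)" by (rule osc_V_integrable[OF o])
  have iu: "integrable lborel (\<lambda>x. (norm (u x))\<^sup>2)" by (rule L2_D(2)[OF osc_D(1)[OF o]])
  have i4: "integrable lborel (\<lambda>x. (norm (u x))^4)" by (rule L4_bound(1)[OF osc_D(4)[OF o]])
  have pt: "(\<Sum>j\<in>UNIV. ?G x $ j * cnj (?G x $ j)) + complex_of_real (V_rot \<rho> x - lam) * u x * cnj (u x)
      - complex_of_real ((norm (u x))\<^sup>2) * u x * cnj (u x) =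
    complex_of_real ((norm (?G x))\<^sup>2 + V_rot \<rho> x * (norm (u x))\<^sup>2 - lam * (norm (u x))\<^sup>2 - (norm (u x))^4)" for x
  proof -
    have z: "z * cnj z = complex_of_real ((norm z)\<^sup>2)" for z
      by (rule complex_norm_square[symmetric])
    have "(norm (u x))^4 = (norm (u x))\<^sup>2 * (norm (u x))\<^sup>2" by (simp flip: power_add)
    then show ?thesis
      unfolding norm_cvec3_sq by (simp only: mult.assoc z of_real_sum of_real_add of_real_diff of_real_mult)
        (simp add: algebra_simps)
  qed
  have "Re (\<integral>x. complex_of_real ((norm (?G x))\<^sup>2 + V_rot \<rho> x * (norm (u x))\<^sup>2 - lam * (norm (u x))\<^sup>2 - (norm (u x))^4) \<partial>lborel) = 0"
    using w S unfolding weak_solution_def pt[symmetric] by blast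
  then have "(\<integral>x. (norm (?G x))\<^sup>2 + V_rot \<rho> x * (norm (u x))\<^sup>2 - lam * (norm (u x))\<^sup>2 - (norm (u x))^4 \<partial>lborel) = 0"
    by (simp only: integral_complex_of_real Re_complex_of_real)
  then show ?thesis
    using iG iV iu i4 unfolding Sigma_dot_norm_sq_def mass_def by simp
qed

text \<open>The two smallness conditions have separate jobs: \<open>3 * c \<le> R\<close> puts the
  Gaussian competitor into the ball, and \<open>3456 * (c * R) \<le> 1\<close> makes the quartic
  term at most the quadratic form there, so that it can be absorbed in the energy
  comparison.\<close>

lemma minimizer_estimates:
  assumes r: "\<bar>\<rho>\<bar> \<le> 1 / 20" and R: "0 < R" and c: "0 < c" "3 * c \<le> R" "3456 * (c * R) \<le> 1"
    and w: "weak_solution (A_rot \<rho>) (V_rot \<rho>) c u lam" and min: "u \<in> local_minimizers (A_rot \<rho>) (V_rot \<rho>) R c"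
  shows "\<bar>3 - lam\<bar> \<le> 864 * c"
    "Sigma_norm_sq (A_rot \<rho>) (V_rot \<rho>) (\<lambda>x. u x - gauss_coeff u * gauss x) \<le> 19872 * c\<^sup>2"
proof -
  let ?A = "A_rot \<rho>" and ?V = "V_rot \<rho>"
  let ?S = "mass_sphere ?A ?V c \<inter> Sigma_ball ?A ?V R"
  define N where "N u = (\<integral>x. (norm (u x))^4 \<partial>lborel)" for u :: "real^3 \<Rightarrow> complex"
  let ?Q = "Sigma_dot_norm_sq ?A ?V"
  have half: "\<bar>\<rho>\<bar> \<le> 1 / 2" using r by simp
  have N0: "0 \<le> N v" for v by (simp add: N_def)
  have S: "\<exists>p. osc v p" "mass v = c" "?Q v \<le> R" "N v \<le> sqrt (3456 * c * ?Q v ^ 3)" "0 \<le> ?Q v" if "v \<in> ?S" for v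
  proof -
    have v: "v \<in> Sigma_space ?A ?V" "mass v = c" "?Q v \<le> R" using that by (auto simp: mass_sphere_def Sigma_ball_def)
    obtain p where p: "osc v p" by (rule Sigma_osc[OF v(1) half])
    show "\<exists>p. osc v p" "mass v = c" "?Q v \<le> R" "N v \<le> sqrt (3456 * c * ?Q v ^ 3)" "0 \<le> ?Q v"
      using p v Sigma_quartic_bound[OF p r] by (auto simp: N_def)
  qed
  have uS: "u \<in> ?S" and ulev: "energy ?A ?V u = local_min_level ?A ?V R c" using min by (auto simp: local_minimizers_def)
  \<comment> \<open>The ball supplies the lower bound that \<open>cINF_lower\<close> asks for:
    inside it the quartic term is controlled by \<open>c\<close> and \<open>R\<close>.\<close>
  have bdd: "bdd_below (energy ?A ?V ` ?S)"
  proof (rule bdd_belowI2)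
    fix v assume v: "v \<in> ?S"
    have "sqrt (3456 * c * ?Q v ^ 3) \<le> sqrt (3456 * c * R ^ 3)"
      using S(3,5)[OF v] c(1) by (intro real_sqrt_le_mono mult_left_mono power_mono) auto
    then show "- (1 / 4 * sqrt (3456 * c * R ^ 3)) \<le> energy ?A ?V v"
      using S(4,5)[OF v] unfolding energy_def N_def by linarith
  qed
  obtain v where v: "v \<in> mass_sphere ?A ?V c" "?Q v = 3 * c" "energy ?A ?V v \<le> 3 / 2 * c"
    by (rule energy_gauss_le[OF r c(1)])
  then have "v \<in> ?S" using c(2) by (auto simp: mass_sphere_def Sigma_ball_def)
  then have "local_min_level ?A ?V R c \<le> energy ?A ?V v"
    unfolding local_min_level_def by (rule cINF_lower[OF bdd])
  then have en: "?Q u \<le> 3 * c + N u / 2" using ulev v(3) unfolding energy_def N_def by linarith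
  let ?q = "?Q u"
  have q0: "0 \<le> ?q" and qR: "?q \<le> R" and Nq: "N u \<le> sqrt (3456 * c * ?q ^ 3)" using S[OF uS] by auto
  have "3456 * c * ?q ^ 3 \<le> ?q\<^sup>2"
  proof -
    have "3456 * (c * ?q) \<le> 3456 * (c * R)" using qR c(1) by simp
    then have "3456 * (c * ?q) * ?q\<^sup>2 \<le> 1 * ?q\<^sup>2" using c(3) by (intro mult_right_mono) auto
    then show ?thesis by (simp add: power2_eq_square power3_eq_cube mult_ac)
  qed
  then have "sqrt (3456 * c * ?q ^ 3) \<le> ?q" using q0 by (intro real_le_lsqrt) auto
  \<comment> \<open>First round: \<open>N u \<le> ?q\<close> turns the comparison into
    \<open>?q \<le> 3 * c + ?q / 2\<close>.\<close>
  then have "?q \<le> 6 * c" using Nq en by linarith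
  \<comment> \<open>Second round: with \<open>?q\<close> of order \<open>c\<close> the quartic bound
    becomes of order \<open>c\<^sup>2\<close>. The constant comes from
    \<open>3456 * 6 ^ 3 = 864\<^sup>2\<close>.\<close>
  then have "3456 * c * ?q ^ 3 \<le> 3456 * c * (6 * c) ^ 3"
    using c(1) q0 by (intro mult_left_mono power_mono) auto
  also have "\<dots> = (864 * c\<^sup>2)\<^sup>2" by (simp add: power2_eq_square power3_eq_cube)
  finally have "sqrt (3456 * c * ?q ^ 3) \<le> 864 * c\<^sup>2" by (intro real_le_lsqrt) auto
  then have N: "N u \<le> 864 * c\<^sup>2" using Nq by linarith
  obtain p where o: "osc u p" using S(1)[OF uS] by blast
  have gap: "3 * c + excess u p / 2 \<le> ?q" using spectral_gap(1)[OF o r] S(2)[OF uS] by simp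
  \<comment> \<open>The gap bounds half the excess by \<open>?q - 3 * c\<close>, and the comparison
    bounds this by \<open>N u / 2\<close>.\<close>
  have "excess u p \<le> 864 * c\<^sup>2" using gap en N by linarith
  then show "Sigma_norm_sq ?A ?V (\<lambda>x. u x - gauss_coeff u * gauss x) \<le> 19872 * c\<^sup>2"
    using spectral_gap(3)[OF o r] by linarith
  have lam: "?q - lam * c - N u = 0" using weak_solution_test_self[OF o w] S(2)[OF uS] by (simp add: N_def)
  have "\<bar>(3 - lam) * c\<bar> \<le> 864 * c * c"
  proof -
    \<comment> \<open>Both terms of the difference lie between 0 and \<open>864 * c\<^sup>2\<close>,
      which bounds its absolute value.\<close>
    have "(3 - lam) * c = N u - (?q - 3 * c)" using lam by (simp add: algebra_simps)
    moreover have "0 \<le> ?q - 3 * c" using gap excess_nonneg[of u p] by linarith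
    moreover have "?q - 3 * c \<le> 864 * c\<^sup>2" using en N N0[of u] by linarith
    ultimately show ?thesis using N N0[of u] by (simp add: power2_eq_square)
  qed
  then show "\<bar>3 - lam\<bar> \<le> 864 * c" using c(1) by (simp add: abs_mult)
qed

text \<open>Choosing \<open>f\<close> and \<open>g\<close> before \<open>\<rho>\<close>,
  \<open>u\<close> and \<open>lam\<close> makes both asymptotics uniform in the rotation parameter
  and in the choice of the solution.\<close>

theorem theorem1p11:
  fixes r :: real
  assumes "r > 0"
  shows "\<exists>\<rho>0 c0 :: real. 0 < \<rho>0 \<and> \<rho>0 \<le> 1 \<and> 0 < c0 \<and>
    (\<exists>f g :: real \<Rightarrow> real.
       f \<in> O[at_right 0](\<lambda>c. c) \<and> g \<in> o[at_right 0](\<lambda>c. c) \<and>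
       (\<forall>\<rho> c u lam.
          \<bar>\<rho>\<bar> < \<rho>0 \<longrightarrow> 0 < c \<longrightarrow> c < c0 \<longrightarrow> c < c_thr (A_rot \<rho>) (V_rot \<rho>) r \<longrightarrow>
          weak_solution (A_rot \<rho>) (V_rot \<rho>) c u lam \<longrightarrow>
          u \<in> local_minimizers (A_rot \<rho>) (V_rot \<rho>) r c \<longrightarrow>
          \<bar>3 - lam\<bar> \<le> f c \<and>
          Sigma_norm_sq (A_rot \<rho>) (V_rot \<rho>) (\<lambda>x. u x - gauss_coeff u * gauss x) \<le> g c))"
proof (intro exI conjI allI impI)
  \<comment> \<open>The two entries are the smallness conditions of
    \<open>minimizer_estimates\<close>: the competitor lies in the ball, and the quartic term can be
    absorbed.\<close>
  define c0 where "c0 = min (r / 3) (1 / (3456 * r))"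
  show "0 < (1 / 20 :: real)" "1 / 20 \<le> (1 :: real)" by simp_all
  show "0 < c0" using assms by (simp add: c0_def)
  show "(\<lambda>c. 864 * c) \<in> O[at_right 0](\<lambda>c::real. c)" by simp
  show "(\<lambda>c. 19872 * c\<^sup>2) \<in> o[at_right 0](\<lambda>c::real. c)"
  proof (rule smalloI_tendsto)
    have "((\<lambda>c::real. 19872 * c) \<longlongrightarrow> 19872 * 0) (at_right 0)" by (intro tendsto_intros)
    then have "((\<lambda>c::real. 19872 * c) \<longlongrightarrow> 0) (at_right 0)" by simp
    moreover have "\<forall>\<^sub>F c::real in at_right 0. 19872 * c = 19872 * c\<^sup>2 / c"
      by (auto simp: eventually_at_filter power2_eq_square)
    ultimately show "((\<lambda>c::real. 19872 * c\<^sup>2 / c) \<longlongrightarrow> 0) (at_right 0)" by (rule Lim_transform_eventually)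
    show "\<forall>\<^sub>F c::real in at_right 0. c \<noteq> 0" by (auto simp: eventually_at_filter)
  qed
  fix \<rho> c u lam
  assume *: "\<bar>\<rho>\<bar> < 1 / 20" "0 < c" "c < c0" "weak_solution (A_rot \<rho>) (V_rot \<rho>) c u lam"
    "u \<in> local_minimizers (A_rot \<rho>) (V_rot \<rho>) r c"
  have c: "3 * c \<le> r" "3456 * (c * r) \<le> 1"
    using *(3) assms by (auto simp: c0_def field_simps)
  show "\<bar>3 - lam\<bar> \<le> 864 * c"
    "Sigma_norm_sq (A_rot \<rho>) (V_rot \<rho>) (\<lambda>x. u x - gauss_coeff u * gauss x) \<le> 19872 * c\<^sup>2"
    using minimizer_estimates[OF _ assms *(2) c *(4,5)] *(1) by simp_all
qed

end
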